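(* Fix $D\ge2$ and bounded sequences $\mathbf{p}_1,\dots,\mathbf{p}_D$ defining a $D$-parameter Vilenkin filtration $\{\mathcal{F}_n\}_{n\in\mathbb{Z}_+^D}$ on $[0,1)^D$. Let $V$ be a linear operator taking $D$-parameter Vilenkin martingales into measurable functions on $[0,1)^D$. Assume the following. 1) $V:\mathfrak{L}^2\to L^2$ is bounded. 2) For any $D$-parameter Vilenkin martingale $f$ such that $f_0=0$ and, for all $n\in\mathbb{Z}_+^D$ and all $l\in L_n$, $$\Delta_{n,l}f=\mathbf{1}_{e_n}\Delta_{n,l}f\quad\text{for some } e_n\in\mathcal{F}_{n-\mathbf{1}}\ \text{(not depending on } l),$$ we have $\{|Vf|>0\}\subseteq\bigcup_{n\in\mathbb{Z}_+^D\setminus\{0\}}e_n$. Then $V:\mathfrak{H}^p\to L^p$ is bounded for any $0<p\le1$, and $V:\mathfrak{L}^r\to L^r$ is bounded for $1<r\le2$.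
   Context: $\mathbb{Z}_+=\{0,1,2,\dots\}$. For $n,m\in\mathbb{Z}_+^D$, $n\le m$ means $n_d\le m_d$ for all $d$; $n-\mathbf{1}$ denotes the vector with components $(n-\mathbf{1})_d=\max(n_d-1,0)$. $\mathbf{1}_e$ is the indicator function of $e$. Intervals $[a,b)$ of indices are $\{x\in\mathbb{Z}_+:a\le x<b\}$. For $d=1,\dots,D$, $\mathbf{p}_d=\{p^{(d)}_n\}_{n\in\mathbb{N}}$ is a sequence of integers $p^{(d)}_n\ge2$ with $\sup_n p^{(d)}_n<\infty$; $P^{(d)}_0=1$, $P^{(d)}_n=p^{(d)}_1\cdots p^{(d)}_n$. $\mathcal{F}_n$, $n\in\mathbb{Z}_+^D$, is the $\sigma$-algebra generated by the rectangles $\prod_{d=1}^D\big[l_d/P^{(d)}_{n_d},(l_d+1)/P^{(d)}_{n_d}\big)$, $0\le l_d<P^{(d)}_{n_d}$. $\mathbb{E}_n$ is the conditional expectation (Lebesgue measure) onto $\mathcal{F}_n$. Vilenkin functions of a sequence $\mathbf{p}=\{p_k\}$ (with $P_k=p_1\cdots p_k$): for $x=\sum_{k\ge1}x_k/P_k\in[0,1)$, $0\le x_k<p_k$ (if there are two representations, the one with $x_k\to0$), and $m=\sum_{k\ge1}m_kP_{k-1}\in\mathbb{Z}_+$, $0\le m_k<p_k$, set $v_m(x)=\prod_k\exp(2\pi i x_k/p_k)^{m_k}$. The $D$-parameter Vilenkin functions are $v_m(x)=v^{(1)}_{m_1}(x_1)\cdots v^{(D)}_{m_D}(x_D)$, $m\in\mathbb{Z}_+^D$,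 where $\{v^{(d)}_m\}$ corresponds to $\mathbf{p}_d$. A $D$-parameter Vilenkin martingale is a family $f=\{f_n\}_{n\in\mathbb{Z}_+^D}$ of integrable functions on $[0,1)^D$ with $f_n$ being $\mathcal{F}_n$-measurable and $\mathbb{E}_nf_m=f_n$ whenever $n\le m$. The martingale differences are $\Delta_nf=\sum_{\varepsilon\in\{0,1\}^D}(-1)^{\varepsilon_1+\dots+\varepsilon_D}f_{n-\varepsilon}$, terms with some index $-1$ being zero. Modified martingale differences: let $L_n=\prod_{d=1}^DL^{(d)}_{n_d}$ with $L^{(d)}_m=\{1,\dots,p^{(d)}_m-1\}$ for $m\ge1$ and $L^{(d)}_0=\{1\}$. For $l\in L_n$ let $\delta_{n,l}=\prod_{d=1}^D\delta^{(d)}_{n_d,l_d}$, where $\delta^{(d)}_{m,j}=[jP^{(d)}_{m-1},(j+1)P^{(d)}_{m-1})$ for $m\ge1$ and $\delta^{(d)}_{0,1}=\{0\}$. Then $$\Delta_{n,l}f=\sum_{k\in\delta_{n,l}}\langle f_m,v_k\rangle v_k\quad(\text{any } m\ge n),$$ with $\langle\cdot,\cdot\rangle$ the $L^2[0,1)^D$ pairing $\int f_m\overline{v_k}$. $\mathfrak{L}^p$ is the space of martingales with $\|f\|_{\mathfrak{L}^p}=\sup_n\|f_n\|_{L^p}<\infty$. $\mathfrak{H}^p$ is the space of martingales with $\|f\|_{\mathfrak{H}^p}=\big\|\big(\sum_{n\in\mathbb{Z}_+^D}|\Delta_nf|^2\big)^{1/2}\big\|_{L^p}<\infty$. $L^p=L^p([0,1)^D)$.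 *)

theory Defs
  imports "HOL-Probability.Probability"
begin

section \<open>Vilenkin functions of one variable\<close>

text \<open>
  A sequence \<open>q\<close> stands for \<open>q 1, q 2, \<dots>\<close>; the value \<open>q 0\<close> is never used.  Digit sequences are
  likewise indexed from \<open>1\<close>; their entry at \<open>0\<close> is fixed to be \<open>0\<close>.
\<close>

definition pprod :: "(nat \<Rightarrow> nat) \<Rightarrow> nat \<Rightarrow> nat" where
  "pprod q n = (\<Prod>k=1..n. q k)"

definition is_expansion :: "(nat \<Rightarrow> nat) \<Rightarrow> real \<Rightarrow> (nat \<Rightarrow> nat) \<Rightarrow> bool" where
  "is_expansion q x a \<longleftrightarrow>
     a 0 = 0 \<and> (\<forall>k\<ge>1. a k < q k) \<and> (\<lambda>k. real (a k) / real (pprod q k)) sums x"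

definition digit :: "(nat \<Rightarrow> nat) \<Rightarrow> real \<Rightarrow> nat \<Rightarrow> nat" where
  "digit q x = (THE a. is_expansion q x a \<and>
     ((\<exists>b. is_expansion q x b \<and> b \<noteq> a) \<longrightarrow> (\<lambda>k. real (a k)) \<longlonglongrightarrow> 0))"

definition is_nat_expansion :: "(nat \<Rightarrow> nat) \<Rightarrow> nat \<Rightarrow> (nat \<Rightarrow> nat) \<Rightarrow> bool" where
  "is_nat_expansion q m b \<longleftrightarrow>
     b 0 = 0 \<and> (\<forall>k\<ge>1. b k < q k) \<and> finite {k. b k \<noteq> 0} \<and>
     m = (\<Sum>k | b k \<noteq> 0. b k * pprod q (k - 1))"

definition nat_digit :: "(nat \<Rightarrow> nat) \<Rightarrow> nat \<Rightarrow> nat \<Rightarrow> nat" where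
  "nat_digit q m = (THE b. is_nat_expansion q m b)"

definition vilenkin1 :: "(nat \<Rightarrow> nat) \<Rightarrow> nat \<Rightarrow> real \<Rightarrow> complex" where
  "vilenkin1 q m x =
     (\<Prod>k | nat_digit q m k \<noteq> 0.
        exp (2 * of_real pi * \<i> * of_nat (digit q x k) / of_nat (q k)) ^ nat_digit q m k)"

text \<open>The digits are well defined and given by the usual closed formulas.\<close>

definition floor_digit :: "(nat \<Rightarrow> nat) \<Rightarrow> real \<Rightarrow> nat \<Rightarrow> nat" where
  "floor_digit q x k = (if k = 0 then 0 else nat \<lfloor>x * real (pprod q k)\<rfloor> mod q k)"

context
  fixes q :: "nat \<Rightarrow> nat"
  assumes q2: "\<And>k. k \<ge> 1 \<Longrightarrow> q k \<ge> 2"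
begin

lemma pprod_Suc: "pprod q (Suc n) = q (Suc n) * pprod q n"
  by (simp add: pprod_def mult.commute)

lemma pprod_0: "pprod q 0 = 1"
  by (simp add: pprod_def)

lemma pprod_ge: "pprod q n \<ge> 2 ^ n"
proof (induction n)
  case (Suc n)
  have "2 * 2 ^ n \<le> q (Suc n) * pprod q n"
    by (intro mult_mono Suc.IH q2) auto
  then show ?case by (simp add: pprod_Suc)
qed (simp add: pprod_0)

lemma pprod_pos: "pprod q n > 0"
  using pprod_ge[of n] by (metis less_le_trans zero_less_numeral zero_less_power)

lemma pprod_inverse_tendsto: "(\<lambda>n. 1 / real (pprod q n)) \<longlonglongrightarrow> 0"
proof (rule tendsto_sandwich[where f = "\<lambda>_. 0" and h = "\<lambda>n. (1/2::real) ^ n"])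
  have "1 / real (pprod q n) \<le> (1/2) ^ n" for n
  proof -
    have "(2::real) ^ n \<le> real (pprod q n)"
      using pprod_ge[of n] by (metis of_nat_le_iff of_nat_numeral of_nat_power)
    then have "1 / real (pprod q n) \<le> 1 / 2 ^ n"
      using frac_le[of 1 1 "2 ^ n" "real (pprod q n)"] by simp
    then show ?thesis by (simp add: power_one_over)
  qed
  then show "\<forall>\<^sub>F n in sequentially. 1 / real (pprod q n) \<le> (1/2) ^ n" by simp
  show "(\<lambda>n. (1/2::real) ^ n) \<longlonglongrightarrow> 0" by (rule LIMSEQ_realpow_zero) auto
qed auto

lemma floor_Suc:
  assumes "x \<ge> 0"
  shows "nat \<lfloor>x * real (pprod q (Suc n))\<rfloor> =
         q (Suc n) * nat \<lfloor>x * real (pprod q n)\<rfloor> + floor_digit q x (Suc n)"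
proof -
  let ?q = "q (Suc n)" and ?y = "x * real (pprod q (Suc n))"
  have q0: "?q > 0" using q2[of "Suc n"] by simp
  have "\<lfloor>?y\<rfloor> div int ?q = \<lfloor>?y / real_of_int (int ?q)\<rfloor>"
    by (rule floor_divide_real_eq_div[symmetric]) auto
  also have "?y / real_of_int (int ?q) = x * real (pprod q n)"
    using q0 by (simp add: pprod_Suc)
  finally have "\<lfloor>?y\<rfloor> div int ?q = \<lfloor>x * real (pprod q n)\<rfloor>" .
  moreover have "nat (\<lfloor>?y\<rfloor> div int ?q) = nat \<lfloor>?y\<rfloor> div nat (int ?q)"
    by (rule nat_div_distrib') simp
  ultimately have div: "nat \<lfloor>?y\<rfloor> div ?q = nat \<lfloor>x * real (pprod q n)\<rfloor>"
    by simp
  have "nat \<lfloor>?y\<rfloor> = ?q * (nat \<lfloor>?y\<rfloor> div ?q) + nat \<lfloor>?y\<rfloor> mod ?q"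
    by (rule mult_div_mod_eq[symmetric])
  then show ?thesis
    unfolding div by (simp only: floor_digit_def) simp
qed

lemma is_expansion_floor_digit:
  assumes x: "0 \<le> x" "x < 1"
  shows "is_expansion q x (floor_digit q x)"
proof -
  have S: "(\<Sum>k\<le>n. real (floor_digit q x k) / real (pprod q k))
           = real (nat \<lfloor>x * real (pprod q n)\<rfloor>) / real (pprod q n)" for n
  proof (induction n)
    case 0
    have "\<lfloor>x\<rfloor> = 0" using x by linarith
    then show ?case by (simp add: floor_digit_def pprod_0)
  next
    case (Suc n)
    have q0: "real (q (Suc n)) > 0" using q2[of "Suc n"] by simp
    have *: "real u / real (pprod q n) + real v / real (pprod q (Suc n))
        = real (q (Suc n) * u + v) / real (pprod q (Suc n))" for u v
      using pprod_pos[of n] q0 by (simp add: pprod_Suc field_simps)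
    show ?case
      unfolding sum.atMost_Suc Suc.IH * floor_Suc[OF x(1), of n] ..
  qed
  have "(\<lambda>n. x - 1 / real (pprod q n)) \<longlonglongrightarrow> x - 0"
    by (intro tendsto_intros pprod_inverse_tendsto)
  then have l: "(\<lambda>n. x - 1 / real (pprod q n)) \<longlonglongrightarrow> x" by simp
  have "(\<lambda>n. \<Sum>k\<le>n. real (floor_digit q x k) / real (pprod q k)) \<longlonglongrightarrow> x"
  proof (rule tendsto_sandwich[OF _ _ l tendsto_const[of x]])
    have b: "x - 1 / real (pprod q n) \<le> real (nat \<lfloor>x * real (pprod q n)\<rfloor>) / real (pprod q n)"
      "real (nat \<lfloor>x * real (pprod q n)\<rfloor>) / real (pprod q n) \<le> x" for n
    proof -
      have p: "real (pprod q n) > 0" using pprod_pos by simp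
      have "x * real (pprod q n) \<ge> 0" using x by simp
      then have lo: "real (nat \<lfloor>x * real (pprod q n)\<rfloor>) \<le> x * real (pprod q n)"
        and hi: "x * real (pprod q n) - 1 \<le> real (nat \<lfloor>x * real (pprod q n)\<rfloor>)" by linarith+
      have "x - 1 / real (pprod q n) = (x * real (pprod q n) - 1) / real (pprod q n)"
        using p by (simp add: field_simps)
      then show "x - 1 / real (pprod q n) \<le> real (nat \<lfloor>x * real (pprod q n)\<rfloor>) / real (pprod q n)"
        "real (nat \<lfloor>x * real (pprod q n)\<rfloor>) / real (pprod q n) \<le> x"
        using lo divide_right_mono[OF hi, of "real (pprod q n)"] p
        by (simp_all add: pos_divide_le_eq)
    qed
    show "\<forall>\<^sub>F n in sequentially.
        x - 1 / real (pprod q n) \<le> (\<Sum>k\<le>n. real (floor_digit q x k) / real (pprod q k))"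
      "\<forall>\<^sub>F n in sequentially. (\<Sum>k\<le>n. real (floor_digit q x k) / real (pprod q k)) \<le> x"
      unfolding S using b by simp_all
  qed
  moreover have "floor_digit q x k < q k" if "k \<ge> 1" for k
    using q2[OF that] that by (simp add: floor_digit_def)
  ultimately show ?thesis
    by (simp add: is_expansion_def sums_def_le floor_digit_def)
qed

lemma expansion_cases:
  assumes x: "0 \<le> x" "x < 1" and a: "is_expansion q x a"
  shows "a = floor_digit q x \<or>
    (\<exists>N. (\<forall>k>N. a k = q k - 1) \<and> (\<forall>k>N. floor_digit q x k = 0))"
proof -
  define S where "S = rec_nat 0 (\<lambda>n s. q (Suc n) * s + a (Suc n))"
  have S0: "S 0 = 0" and SS: "S (Suc n) = q (Suc n) * S n + a (Suc n)" for n
    by (simp_all add: S_def)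
  define t where "t = (\<lambda>n. x * real (pprod q n) - real (S n))"
  have p: "real (pprod q n) > 0" for n using pprod_pos by simp
  have qp: "real (q (Suc n)) > 0" for n using q2[of "Suc n"] by simp
  have a0: "a 0 = 0" and alt: "\<And>k. k \<ge> 1 \<Longrightarrow> a k < q k"
    and sums: "(\<lambda>k. real (a k) / real (pprod q k)) sums x"
    using a by (auto simp: is_expansion_def)
  have Ssum: "(\<Sum>k\<le>n. real (a k) / real (pprod q k)) = real (S n) / real (pprod q n)" for n
  proof (induction n)
    case (Suc n)
    then show ?case using p[of n] qp[of n] by (simp add: SS pprod_Suc field_simps)
  qed (simp add: S0 a0)
  have lim: "(\<lambda>n. real (S n) / real (pprod q n)) \<longlonglongrightarrow> x"
    using sums unfolding sums_def_le Ssum .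
  have t0: "t n \<ge> 0" for n
  proof -
    have "(\<Sum>k\<le>n. real (a k) / real (pprod q k)) \<le> x"
      using sum_le_suminf[OF sums_summable[OF sums], of "{..n}"] sums_unique[OF sums] by simp
    then show ?thesis using p[of n] by (simp add: Ssum t_def field_simps)
  qed
  have tS: "t (Suc n) = real (q (Suc n)) * t n - real (a (Suc n))" for n
    by (simp add: t_def SS pprod_Suc algebra_simps)
  have step: "(t (Suc n) - 1) / real (pprod q (Suc n)) = (t n - 1) / real (pprod q n)
      + (real (q (Suc n)) - 1 - real (a (Suc n))) / real (pprod q (Suc n))" for n
    using p[of n] qp[of n] by (simp add: tS pprod_Suc field_simps)
  have nn: "real (q (Suc n)) - 1 - real (a (Suc n)) \<ge> 0" for n
    using alt[of "Suc n"] by simp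
  have inc: "incseq (\<lambda>n. (t n - 1) / real (pprod q n))"
    by (rule incseq_SucI) (use step nn p in \<open>simp\<close>)
  have "(\<lambda>n. x - real (S n) / real (pprod q n) - 1 / real (pprod q n)) \<longlonglongrightarrow> x - x - 0"
    by (intro tendsto_intros lim pprod_inverse_tendsto)
  moreover have "(\<lambda>n. x - real (S n) / real (pprod q n) - 1 / real (pprod q n))
      = (\<lambda>n. (t n - 1) / real (pprod q n))"
  proof
    fix n show "x - real (S n) / real (pprod q n) - 1 / real (pprod q n)
      = (t n - 1) / real (pprod q n)"
      using p[of n] by (simp add: t_def field_simps)
  qed
  ultimately have tl: "(\<lambda>n. (t n - 1) / real (pprod q n)) \<longlonglongrightarrow> 0" by simp
  have le0: "(t n - 1) / real (pprod q n) \<le> 0" for n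
    by (rule incseq_le[OF inc tl])
  then have t1: "t n \<le> 1" for n
    using p[of n] le0[of n] by (metis diff_le_0_iff_le divide_le_0_iff not_le)
  show ?thesis
  proof (cases "\<exists>N. t N = 1")
    case False
    then have lt: "t n < 1" for n using t1[of n] by (metis less_le)
    have fl: "nat \<lfloor>x * real (pprod q n)\<rfloor> = S n" for n
    proof -
      have "\<lfloor>x * real (pprod q n)\<rfloor> = int (S n)"
        using lt[of n] t0[of n] unfolding t_def by linarith
      then show ?thesis by simp
    qed
    have "a k = floor_digit q x k" for k
    proof (cases k)
      case (Suc n)
      then show ?thesis using floor_Suc[OF x(1), of n] by (simp add: fl SS)
    qed (simp add: a0 floor_digit_def)
    then show ?thesis by blast
  next
    case True
    then obtain N where N: "t N = 1" by blast
    have z: "t n = 1" if "n \<ge> N" for n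
    proof -
      have "(t N - 1) / real (pprod q N) \<le> (t n - 1) / real (pprod q n)"
        using inc that by (rule incseqD)
      then have "t n \<ge> 1" using N p[of n] by (simp add: field_simps)
      then show ?thesis using t1[of n] by simp
    qed
    have "a k = q k - 1 \<and> floor_digit q x k = 0" if "k > N" for k
    proof -
      define n where "n = k - 1"
      have n: "k = Suc n" "n \<ge> N" using that by (auto simp: n_def)
      have "real (a k) = real (q k) - 1"
        using tS[of n] z[of n] z[of "Suc n"] n by simp
      then have "a k = q k - 1" using q2[of k] n by linarith
      have "x * real (pprod q n) = real (S n + 1)"
        using z[of n] n by (simp add: t_def)
      moreover have "x * real (pprod q k) = real (q k) * (x * real (pprod q n))"
        by (simp add: n pprod_Suc)
      ultimately have "x * real (pprod q k) = real (q k * (S n + 1))"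
        by (simp only: of_nat_mult)
      then have "\<lfloor>x * real (pprod q k)\<rfloor> = int (q k * (S n + 1))"
        by (metis floor_of_nat)
      then have "floor_digit q x k = 0" by (simp only: floor_digit_def nat_int) simp
      with \<open>a k = q k - 1\<close> show ?thesis by simp
    qed
    then show ?thesis by blast
  qed
qed

lemma digit_eq:
  assumes x: "0 \<le> x" "x < 1"
  shows "digit q x = floor_digit q x"
  unfolding digit_def
proof (rule the_equality)
  have "(\<lambda>k. real (floor_digit q x k)) \<longlonglongrightarrow> 0" if b: "is_expansion q x b" "b \<noteq> floor_digit q x" for b
  proof -
    obtain N where "\<forall>k>N. floor_digit q x k = 0"
      using expansion_cases[OF x b(1)] b(2) by blast
    then have "\<forall>\<^sub>F k in sequentially. real (floor_digit q x k) = 0"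
      by (auto simp: eventually_at_top_dense)
    then show ?thesis by (rule tendsto_eventually)
  qed
  then show "is_expansion q x (floor_digit q x) \<and>
    ((\<exists>b. is_expansion q x b \<and> b \<noteq> floor_digit q x) \<longrightarrow> (\<lambda>k. real (floor_digit q x k)) \<longlonglongrightarrow> 0)"
    using is_expansion_floor_digit[OF x] by blast
next
  fix a
  assume a: "is_expansion q x a \<and>
    ((\<exists>b. is_expansion q x b \<and> b \<noteq> a) \<longrightarrow> (\<lambda>k. real (a k)) \<longlonglongrightarrow> 0)"
  show "a = floor_digit q x"
  proof (rule ccontr)
    assume ne: "a \<noteq> floor_digit q x"
    then have "(\<lambda>k. real (a k)) \<longlonglongrightarrow> 0"
      using a is_expansion_floor_digit[OF x] by metis
    then have "\<forall>\<^sub>F k in sequentially. real (a k) < 1"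
      by (rule order_tendstoD) simp
    then obtain M where M: "\<And>k. k \<ge> M \<Longrightarrow> real (a k) < 1"
      by (auto simp: eventually_sequentially)
    obtain N where N: "\<And>k. k > N \<Longrightarrow> a k = q k - 1"
      using expansion_cases[OF x] a ne by blast
    show False
      using M[of "Suc (M + N)"] N[of "Suc (M + N)"] q2[of "Suc (M + N)"] by simp
  qed
qed

lemma nat_expansion_unique:
  assumes b: "is_nat_expansion q m b" and k: "k \<ge> 1"
  shows "b k = m div pprod q (k - 1) mod q k"
proof -
  have fin: "finite {k. b k \<noteq> 0}" and b0: "b 0 = 0" and lt: "\<And>k. k \<ge> 1 \<Longrightarrow> b k < q k"
    and m: "m = (\<Sum>k | b k \<noteq> 0. b k * pprod q (k - 1))"
    using b by (auto simp: is_nat_expansion_def)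
  obtain j where j: "k = Suc j" using k by (cases k) auto
  obtain N where N: "\<And>i. b i \<noteq> 0 \<Longrightarrow> i \<le> N"
    using fin by (metis (mono_tags, lifting) finite_nat_set_iff_bounded_le mem_Collect_eq)
  define M where "M = max N k"
  have m2: "m = (\<Sum>i\<in>{..M}. b i * pprod q (i - 1))"
    unfolding m by (rule sum.mono_neutral_left) (use N in \<open>auto simp: M_def le_max_iff_disj\<close>)
  have small: "(\<Sum>i\<le>n. b i * pprod q (i - 1)) < pprod q n" for n
  proof (induction n)
    case (Suc n)
    have "b (Suc n) + 1 \<le> q (Suc n)" using lt[of "Suc n"] by simp
    then have "(b (Suc n) + 1) * pprod q n \<le> q (Suc n) * pprod q n" by (rule mult_right_mono) simp
    then show ?case using Suc by (simp add: pprod_Suc algebra_simps)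
  qed (simp add: b0 pprod_0)
  have dvd: "pprod q n dvd pprod q i" if "n \<le> i" for n i
    unfolding pprod_def by (rule prod_dvd_prod_subset) (use that in auto)
  have "(\<Sum>i\<in>{..M}. b i * pprod q (i - 1))
     = (\<Sum>i\<in>{..k}. b i * pprod q (i - 1)) + (\<Sum>i\<in>{k<..M}. b i * pprod q (i - 1))"
    by (subst sum.union_disjoint[symmetric]) (auto intro!: sum.cong simp: M_def)
  moreover have "pprod q k dvd (\<Sum>i\<in>{k<..M}. b i * pprod q (i - 1))"
    by (intro dvd_sum dvd_mult dvd) auto
  ultimately obtain c where c: "m = (\<Sum>i\<le>j. b i * pprod q (i - 1)) + b k * pprod q j + pprod q k * c"
    by (auto simp: m2 j dvd_def)
  have "m = (\<Sum>i\<le>j. b i * pprod q (i - 1)) + (b k + q k * c) * pprod q j"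
    by (simp add: c j pprod_Suc algebra_simps)
  then have "m div pprod q j = b k + q k * c"
    using small[of j] by simp
  then show ?thesis using lt[OF k] by (simp add: j)
qed

lemma is_nat_expansion_div_mod:
  "is_nat_expansion q m (\<lambda>k. if k = 0 then 0 else m div pprod q (k - 1) mod q k)"
proof -
  define b where "b = (\<lambda>k. if k = 0 then 0 else m div pprod q (k - 1) mod q k)"
  have b_Suc: "b (Suc n) = m div pprod q n mod q (Suc n)" and b_0: "b 0 = 0" for n
    by (simp_all add: b_def)
  have big: "m < pprod q n" if "n \<ge> m" for n
  proof -
    have "m < 2 ^ m" by simp
    also have "(2::nat) ^ m \<le> 2 ^ n" using that by simp
    also have "\<dots> \<le> pprod q n" by (rule pprod_ge)
    finally show ?thesis .
  qed
  have zero: "b k = 0" if "k > m" for k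
  proof -
    have "k = Suc (k - 1)" "k - 1 \<ge> m" using that by simp_all
    then show ?thesis using big[of "k - 1"] b_Suc[of "k - 1"] by simp
  qed
  have sub: "{k. b k \<noteq> 0} \<subseteq> {..m}"
  proof
    fix k assume "k \<in> {k. b k \<noteq> 0}"
    then have "\<not> k > m" using zero[of k] by auto
    then show "k \<in> {..m}" by simp
  qed
  have "(\<Sum>i\<le>n. b i * pprod q (i - 1)) = m mod pprod q n" for n
  proof (induction n)
    case 0
    then show ?case by (simp add: b_0 pprod_0)
  next
    case (Suc n)
    have "m mod (pprod q n * q (Suc n)) = pprod q n * (m div pprod q n mod q (Suc n)) + m mod pprod q n"
      by (rule mod_mult2_eq)
    then show ?case
      unfolding sum.atMost_Suc Suc.IH by (simp add: pprod_Suc b_Suc mult.commute)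
  qed
  from this[of m] have "(\<Sum>i\<le>m. b i * pprod q (i - 1)) = m" using big[of m] by simp
  moreover have "(\<Sum>i | b i \<noteq> 0. b i * pprod q (i - 1)) = (\<Sum>i\<le>m. b i * pprod q (i - 1))"
    by (rule sum.mono_neutral_left) (use sub in auto)
  moreover have "finite {k. b k \<noteq> 0}" using sub finite_subset by blast
  moreover have "b k < q k" if "k \<ge> 1" for k using q2[OF that] that by (simp add: b_def)
  ultimately have "is_nat_expansion q m b"
    unfolding is_nat_expansion_def by (simp add: b_0)
  then show ?thesis by (simp only: b_def)
qed

lemma nat_digit_eq:
  "nat_digit q m = (\<lambda>k. if k = 0 then 0 else m div pprod q (k - 1) mod q k)"
  unfolding nat_digit_def
proof (rule the_equality)
  show "is_nat_expansion q m (\<lambda>k. if k = 0 then 0 else m div pprod q (k - 1) mod q k)"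
    by (rule is_nat_expansion_div_mod)
next
  fix b assume b: "is_nat_expansion q m b"
  show "b = (\<lambda>k. if k = 0 then 0 else m div pprod q (k - 1) mod q k)"
    using nat_expansion_unique[OF b] b by (auto simp: is_nat_expansion_def)
qed

end

section \<open>Multi-parameter Vilenkin martingales\<close>

text \<open>
  The coordinates are indexed by the finite type \<open>'d\<close>, so \<open>D = CARD('d)\<close>; multi-indices are functions
  \<open>'d \<Rightarrow> nat\<close>, with the pointwise order of function spaces.  Truncated subtraction gives
  \<open>n - 1\<close> in the sense of \<open>max (n d - 1) 0\<close>.
\<close>

definition unit_cube :: "(real ^ 'd) set" where
  "unit_cube = {x. \<forall>d. 0 \<le> x $ d \<and> x $ d < 1}"

abbreviation cube_measure :: "(real ^ 'd::finite) measure" where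
  "cube_measure \<equiv> lebesgue_on unit_cube"

definition rectangle :: "('d \<Rightarrow> nat \<Rightarrow> nat) \<Rightarrow> ('d \<Rightarrow> nat) \<Rightarrow> ('d \<Rightarrow> nat) \<Rightarrow> (real ^ 'd) set" where
  "rectangle p n l =
     {x. \<forall>d. real (l d) / real (pprod (p d) (n d)) \<le> x $ d \<and>
             x $ d < real (l d + 1) / real (pprod (p d) (n d))}"

definition vfiltration :: "('d \<Rightarrow> nat \<Rightarrow> nat) \<Rightarrow> ('d \<Rightarrow> nat) \<Rightarrow> (real ^ 'd) measure" where
  "vfiltration p n =
     sigma unit_cube {rectangle p n l | l. \<forall>d. l d < pprod (p d) (n d)}"

definition pred_index :: "('d \<Rightarrow> nat) \<Rightarrow> 'd \<Rightarrow> nat" where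
  "pred_index n = (\<lambda>d. n d - 1)"

definition vilenkin ::
    "('d::finite \<Rightarrow> nat \<Rightarrow> nat) \<Rightarrow> ('d \<Rightarrow> nat) \<Rightarrow> real ^ 'd \<Rightarrow> complex" where
  "vilenkin p m x = (\<Prod>d\<in>UNIV. vilenkin1 (p d) (m d) (x $ d))"

text \<open>The library's conditional expectation is real-valued; here it is applied to real and
  imaginary parts.\<close>

definition complex_cond_exp ::
    "'a measure \<Rightarrow> 'a measure \<Rightarrow> ('a \<Rightarrow> complex) \<Rightarrow> 'a \<Rightarrow> complex" where
  "complex_cond_exp M F f x =
     Complex (real_cond_exp M F (\<lambda>y. Re (f y)) x) (real_cond_exp M F (\<lambda>y. Im (f y)) x)"

type_synonym 'd family = "('d \<Rightarrow> nat) \<Rightarrow> real ^ 'd \<Rightarrow> complex"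

text \<open>Functions on the cube are represented by functions on the whole space that vanish outside of
  the cube, so that distinct families represent distinct martingales.\<close>

definition vmartingale :: "('d::finite \<Rightarrow> nat \<Rightarrow> nat) \<Rightarrow> 'd family \<Rightarrow> bool" where
  "vmartingale p f \<longleftrightarrow>
     (\<forall>n. \<forall>x. x \<notin> unit_cube \<longrightarrow> f n x = 0) \<and>
     (\<forall>n. integrable cube_measure (f n)) \<and>
     (\<forall>n. f n \<in> borel_measurable (vfiltration p n)) \<and>
     (\<forall>n m. n \<le> m \<longrightarrow>
        (AE x in cube_measure. complex_cond_exp cube_measure (vfiltration p n) (f m) x = f n x))"

definition mdiff :: "'d::finite family \<Rightarrow> 'd family" where
  "mdiff f n x =
     (\<Sum>\<epsilon> \<in> UNIV \<rightarrow>\<^sub>E {0, 1}.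
        (-1) ^ (\<Sum>d\<in>UNIV. \<epsilon> d) * (if \<exists>d. n d < \<epsilon> d then 0 else f (\<lambda>d. n d - \<epsilon> d) x))"

definition L1 :: "(nat \<Rightarrow> nat) \<Rightarrow> nat \<Rightarrow> nat set" where
  "L1 q m = (if m = 0 then {1} else {1..q m - 1})"

definition L_index :: "('d \<Rightarrow> nat \<Rightarrow> nat) \<Rightarrow> ('d \<Rightarrow> nat) \<Rightarrow> ('d \<Rightarrow> nat) set" where
  "L_index p n = {l. \<forall>d. l d \<in> L1 (p d) (n d)}"

definition delta1 :: "(nat \<Rightarrow> nat) \<Rightarrow> nat \<Rightarrow> nat \<Rightarrow> nat set" where
  "delta1 q m j = (if m = 0 then {0} else {j * pprod q (m - 1) ..< (j + 1) * pprod q (m - 1)})"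

definition delta :: "('d \<Rightarrow> nat \<Rightarrow> nat) \<Rightarrow> ('d \<Rightarrow> nat) \<Rightarrow> ('d \<Rightarrow> nat) \<Rightarrow> ('d \<Rightarrow> nat) set" where
  "delta p n l = {k. \<forall>d. k d \<in> delta1 (p d) (n d) (l d)}"

definition pairing :: "(real ^ 'd::finite \<Rightarrow> complex) \<Rightarrow> (real ^ 'd \<Rightarrow> complex) \<Rightarrow> complex" where
  "pairing f g = (LINT x|cube_measure. f x * cnj (g x))"

text \<open>The Fourier coefficients at frequencies in \<open>delta p n l\<close> are the same for all \<open>f m\<close>
  with \<open>n \<le> m\<close>, since these Vilenkin functions are measurable with respect to
  \<open>vfiltration p n\<close>; we use \<open>m = n\<close>.\<close>

definition mod_mdiff ::
    "('d::finite \<Rightarrow> nat \<Rightarrow> nat) \<Rightarrow> 'd family \<Rightarrow> ('d \<Rightarrow> nat) \<Rightarrow> ('d \<Rightarrow> nat) \<Rightarrow> real ^ 'd \<Rightarrow> complex"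
  where
  "mod_mdiff p f n l x = (\<Sum>k\<in>delta p n l. pairing (f n) (vilenkin p k) * vilenkin p k x)"

section \<open>Norms and boundedness\<close>

text \<open>Powers with a positive real exponent.\<close>

definition enn_powr :: "ennreal \<Rightarrow> real \<Rightarrow> ennreal" where
  "enn_powr a s = (if a = \<infinity> then \<infinity> else ennreal (enn2real a powr s))"

definition Lp_norm_enn :: "real \<Rightarrow> (real ^ 'd::finite \<Rightarrow> ennreal) \<Rightarrow> ennreal" where
  "Lp_norm_enn s g = enn_powr (\<integral>\<^sup>+ x. enn_powr (g x) s \<partial>cube_measure) (1 / s)"

definition Lp_norm :: "real \<Rightarrow> (real ^ 'd::finite \<Rightarrow> complex) \<Rightarrow> ennreal" where
  "Lp_norm s g = Lp_norm_enn s (\<lambda>x. ennreal (norm (g x)))"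

definition mart_L_norm :: "real \<Rightarrow> 'd::finite family \<Rightarrow> ennreal" where
  "mart_L_norm s f = (SUP n. Lp_norm s (f n))"

definition mart_H_norm :: "real \<Rightarrow> 'd::finite family \<Rightarrow> ennreal" where
  "mart_H_norm s f =
     Lp_norm_enn s (\<lambda>x. enn_powr (\<Sum>\<^sub>\<infinity>n\<in>UNIV. ennreal ((norm (mdiff f n x))\<^sup>2)) (1 / 2))"

text \<open>An operator takes values in functions modulo equality almost everywhere.\<close>

definition linear_operator ::
    "('d::finite \<Rightarrow> nat \<Rightarrow> nat) \<Rightarrow> ('d family \<Rightarrow> real ^ 'd \<Rightarrow> complex) \<Rightarrow> bool" where
  "linear_operator p V \<longleftrightarrow>
     (\<forall>f. vmartingale p f \<longrightarrow> V f \<in> borel_measurable cube_measure) \<and>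
     (\<forall>f g. vmartingale p f \<longrightarrow> vmartingale p g \<longrightarrow>
        (AE x in cube_measure. V (\<lambda>n y. f n y + g n y) x = V f x + V g x)) \<and>
     (\<forall>c f. vmartingale p f \<longrightarrow>
        (AE x in cube_measure. V (\<lambda>n y. c * f n y) x = c * V f x))"

text \<open>\<open>N\<close> is the norm of the source space, which consists of the martingales of finite norm; the
  target space is the Lebesgue space with exponent \<open>s\<close>.\<close>

definition bounded_operator ::
    "('d::finite \<Rightarrow> nat \<Rightarrow> nat) \<Rightarrow> ('d family \<Rightarrow> real ^ 'd \<Rightarrow> complex) \<Rightarrow>
     ('d family \<Rightarrow> ennreal) \<Rightarrow> real \<Rightarrow> bool" where
  "bounded_operator p V N s \<longleftrightarrow>
     (\<exists>C::real. 0 \<le> C \<and>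
        (\<forall>f. vmartingale p f \<longrightarrow> N f < \<infinity> \<longrightarrow> Lp_norm s (V f) \<le> ennreal C * N f))"

end

theory Submission
  imports Defs
begin

text \<open>
  The idea is to split a martingale \<open>f\<close> at each level \<open>t > 0\<close>, in the manner of Gundy, and to
  interpolate.  Let \<open>S\<close> be the square function of \<open>f\<close> and \<open>\<Omega> = {S > t}\<close>.  The index \<open>n\<close> counts as
  exceptional on the set \<open>e n\<close>, measurable in the generation \<open>n - 1\<close>, on which the average of the indicator
  of \<open>\<Omega>\<close> in the generation \<open>n - 1\<close> exceeds a constant \<open>c\<close>.  Let \<open>h\<close> be the martingale with the
  differences \<open>mdiff f n\<close> restricted to the complement of \<open>e n\<close>, and \<open>g = f - h\<close>.

  \<^item> The union of the sets \<open>e n\<close> is contained in the set where the strong maximal function of the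
    indicator of \<open>\<Omega>\<close> exceeds \<open>c\<close>.  So its measure is at most a constant times the measure of \<open>\<Omega>\<close>
    (\<open>maximal_measure\<close>), and locality of \<open>V\<close> makes \<open>V g\<close> vanish outside of it.  Locality is
    formulated with the modified differences; they vanish on every cell of generation \<open>n - 1\<close> on
    which \<open>mdiff g n\<close> vanishes (\<open>mod_mdiff_eq_0\<close>).
  \<^item> The sequences \<open>p d\<close> are bounded, so the filtration is regular.  For a suitable \<open>c\<close> it follows that,
    off \<open>e n\<close>, at least half of each cell of generation \<open>n\<close> lies outside \<open>\<Omega>\<close>.  By orthogonality of the
    differences the second moment of \<open>h\<close> is then at most twice the integral of \<open>S\<^sup>2\<close> over \<open>{S \<le> t}\<close>
    (\<open>transform_L2_bound\<close>), and boundedness of \<open>V\<close> on \<open>L\<^sup>2\<close> applies.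

  Together, \<open>\<mu> {\<bar>V f\<bar> \<ge> t} \<le> A * \<mu> {S \<ge> t} + B * t\<^sup>-\<^sup>2 * \<integral> S\<^sup>2\<close>, where the integral is over \<open>{S \<le> t}\<close>
  (\<open>weak_estimate\<close>).  Integration against \<open>s * t powr (s - 1)\<close> gives boundedness from \<open>H^s\<close> to \<open>L^s\<close> for
  all \<open>0 < s < 2\<close> at once (\<open>strong_from_distribution\<close>, \<open>H_to_L\<close>).

  For \<open>1 < r < 2\<close> it remains to bound the square function in \<open>L^r\<close> by the martingale
  (\<open>martingale_square_function\<close>).  In one parameter, with values in a Hilbert space, this follows from
  the strict convexity of \<open>\<bar>x\<bar>^r\<close> (\<open>square_function_chain\<close>), and the parameters are treated one after
  the other.  The case \<open>r = 2\<close> is the hypothesis.  Doob's inequality, needed both here and for the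
  strong maximal function, is integrated from a pathwise inequality (\<open>doob_pathwise\<close>).

  All this is done with functions that are constant on cells and with the explicit averages over
  cells, which compose as \<open>avg n (avg m g) = avg (inf n m) g\<close> (\<open>avg_avg\<close>); \<open>vmartingale_iff\<close> identifies
  them with the conditional expectations that define martingales.
\<close>

section \<open>Cells, step functions and averages\<close>

text \<open>The number of the cell of generation \<open>n\<close> that contains \<open>t\<close>.  Measurability with respect to
\<open>vfiltration p n\<close> will be expressed by cell numbers, one for each coordinate.\<close>
definition icell :: "(nat \<Rightarrow> nat) \<Rightarrow> nat \<Rightarrow> real \<Rightarrow> nat" where
  "icell q n t = nat \<lfloor>t * real (pprod q n)\<rfloor>"

lemma icell_Suc:
  assumes "\<And>k. k \<ge> 1 \<Longrightarrow> q k \<ge> 2" and "t \<ge> 0"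
  shows "icell q (Suc n) t = q (Suc n) * icell q n t + floor_digit q t (Suc n)"
  unfolding icell_def by (rule floor_Suc[OF assms])

lemma icell_0: "0 \<le> t \<Longrightarrow> t < 1 \<Longrightarrow> icell q 0 t = 0"
  by (simp add: icell_def pprod_def floor_eq_iff)

lemma floor_digit_less:
  assumes "\<And>k. k \<ge> 1 \<Longrightarrow> q k \<ge> 2" shows "floor_digit q t (Suc n) < q (Suc n)"
  using assms[of "Suc n"] by (simp add: floor_digit_def)

text \<open>Division with remainder by \<open>q (Suc n)\<close>: a cell of generation \<open>Suc n\<close> is a cell of generation \<open>n\<close>
together with one more digit.\<close>
lemma icell_Suc_eq_iff:
  assumes q: "\<And>k. k \<ge> 1 \<Longrightarrow> q k \<ge> 2" and t: "t \<ge> 0" "u \<ge> 0"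
  shows "icell q (Suc n) t = icell q (Suc n) u \<longleftrightarrow>
    icell q n t = icell q n u \<and> floor_digit q t (Suc n) = floor_digit q u (Suc n)"
proof -
  have D: "icell q n v = icell q (Suc n) v div q (Suc n)"
    "floor_digit q v (Suc n) = icell q (Suc n) v mod q (Suc n)" if "v \<ge> 0" for v
    using icell_Suc[of q v n, OF q that] floor_digit_less[of q v n] q by simp_all
  show ?thesis
    using D[OF t(1)] D[OF t(2)] icell_Suc[of q t n, OF q t(1)] icell_Suc[of q u n, OF q t(2)] by metis
qed

lemma icell_mono_eq:
  assumes q: "\<And>k. k \<ge> 1 \<Longrightarrow> q k \<ge> 2" and t: "t \<ge> 0" "u \<ge> 0"
    and "m \<le> n" "icell q n t = icell q n u"
  shows "icell q m t = icell q m u"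
  using assms(4,5)
proof (induction n)
  case (Suc n)
  then show ?case using icell_Suc_eq_iff[of q t u n, OF q t] by (cases "m = Suc n") auto
qed simp

lemma icell_eq_iff:
  assumes P: "pprod q n > 0" and t: "t \<ge> 0"
  shows "icell q n t = l \<longleftrightarrow>
    real l / real (pprod q n) \<le> t \<and> t < real (l + 1) / real (pprod q n)"
proof -
  have "icell q n t = l \<longleftrightarrow> \<lfloor>t * real (pprod q n)\<rfloor> = int l"
    using t unfolding icell_def by (metis int_nat_eq nat_int of_nat_0_le_iff zero_le_floor zero_le_mult_iff)
  also have "\<dots> \<longleftrightarrow> real l \<le> t * real (pprod q n) \<and> t * real (pprod q n) < real l + 1"
    by (simp add: floor_eq_iff)
  also have "\<dots> \<longleftrightarrow> real l / real (pprod q n) \<le> t \<and> t < real (l + 1) / real (pprod q n)"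
    using P by (simp add: field_simps)
  finally show ?thesis .
qed

locale vilenkin_system =
  fixes p :: "'d::finite \<Rightarrow> nat \<Rightarrow> nat"
  assumes p_ge: "k \<ge> 1 \<Longrightarrow> p d k \<ge> 2"
begin

abbreviation cube_mu :: "(real ^ 'd) measure" ("\<mu>") where "\<mu> \<equiv> cube_measure"

definition cell :: "('d \<Rightarrow> nat) \<Rightarrow> real ^ 'd \<Rightarrow> 'd \<Rightarrow> nat" where
  "cell n x = (\<lambda>d. icell (p d) (n d) (x $ d))"

definition grid :: "('d \<Rightarrow> nat) \<Rightarrow> ('d \<Rightarrow> nat) set" where
  "grid n = {l. \<forall>d. l d < pprod (p d) (n d)}"

definition ncells :: "('d \<Rightarrow> nat) \<Rightarrow> real" where
  "ncells n = (\<Prod>d\<in>UNIV. real (pprod (p d) (n d)))"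

definition atom :: "('d \<Rightarrow> nat) \<Rightarrow> real ^ 'd \<Rightarrow> (real ^ 'd) set" where
  "atom n x = {y \<in> unit_cube. cell n y = cell n x}"

text \<open>The condition is imposed at every point of the cube, not just almost everywhere.  This is possible
because the \<open>\<sigma>\<close>-algebras of the filtration are finite, and it turns the statements about
martingales into pointwise ones.\<close>
definition step :: "('d \<Rightarrow> nat) \<Rightarrow> (real ^ 'd \<Rightarrow> 'b) \<Rightarrow> bool" where
  "step n g \<longleftrightarrow> (\<forall>x\<in>unit_cube. \<forall>y\<in>unit_cube. cell n x = cell n y \<longrightarrow> g x = g y)"

text \<open>The version of the conditional expectation that is constant on cells.  It takes values in an
arbitrary Banach space, so that real maximal functions and complex martingales are treated
together.\<close>
definition avg :: "('d \<Rightarrow> nat) \<Rightarrow> (real ^ 'd \<Rightarrow> 'b) \<Rightarrow> real ^ 'd \<Rightarrow> 'b::{banach, second_countable_topology}" where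
  "avg n g x = ncells n *\<^sub>R (LINT y|\<mu>. indicator (atom n x) y *\<^sub>R g y)"

lemma pprod_gt_zero: "pprod (p d) n > 0"
  by (rule pprod_pos) (rule p_ge)

lemma ncells_pos: "ncells n > 0"
  unfolding ncells_def by (intro prod_pos) (use pprod_gt_zero in auto)

lemma cube_nonneg: "x \<in> unit_cube \<Longrightarrow> 0 \<le> x $ d" "x \<in> unit_cube \<Longrightarrow> x $ d < 1"
  by (simp_all add: unit_cube_def)

lemma finite_grid: "finite (grid n)"
proof -
  have "grid n = PiE UNIV (\<lambda>d. {..<pprod (p d) (n d)})" by (auto simp: grid_def)
  then show ?thesis by (simp add: finite_PiE)
qed

lemma rectangle_eq:
  assumes l: "l \<in> grid n"
  shows "rectangle p n l = {x \<in> unit_cube. cell n x = l}"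
proof -
  have "x \<in> rectangle p n l \<longleftrightarrow> x \<in> unit_cube \<and> cell n x = l" for x :: "real^'d"
  proof
    assume x: "x \<in> rectangle p n l"
    have b: "0 \<le> x $ d \<and> x $ d < 1 \<and> icell (p d) (n d) (x $ d) = l d" for d
    proof -
      have P: "real (pprod (p d) (n d)) > 0" using pprod_gt_zero by simp
      have r: "real (l d) / real (pprod (p d) (n d)) \<le> x $ d"
        "x $ d < real (l d + 1) / real (pprod (p d) (n d))"
        using x by (simp_all add: rectangle_def)
      have "0 \<le> real (l d) / real (pprod (p d) (n d))" by simp
      then have 0: "0 \<le> x $ d" using r by linarith
      have "l d + 1 \<le> pprod (p d) (n d)" using l by (simp add: grid_def Suc_leI)
      then have "real (l d + 1) \<le> real (pprod (p d) (n d))" by (rule of_nat_mono)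
      then have "real (l d + 1) / real (pprod (p d) (n d)) \<le> 1" using P by simp
      then have 1: "x $ d < 1" using r(2) by linarith
      have "icell (p d) (n d) (x $ d) = l d" 
        by (subst icell_eq_iff[OF pprod_gt_zero 0]) (intro conjI r)
      then show ?thesis using 0 1 by simp
    qed
    then show "x \<in> unit_cube \<and> cell n x = l" by (auto simp: unit_cube_def cell_def)
  next
    assume x: "x \<in> unit_cube \<and> cell n x = l"
    then have "icell (p d) (n d) (x $ d) = l d" for d by (auto simp: cell_def)
    then show "x \<in> rectangle p n l"
      using icell_eq_iff[OF pprod_gt_zero cube_nonneg(1)] x unfolding rectangle_def by blast
  qed
  then show ?thesis by blast
qed

lemma cell_in_grid: "x \<in> unit_cube \<Longrightarrow> cell n x \<in> grid n"
proof -
  assume x: "x \<in> unit_cube"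
  have "icell (p d) (n d) (x $ d) < pprod (p d) (n d)" for d
  proof -
    have "x $ d * real (pprod (p d) (n d)) < real (pprod (p d) (n d))"
      using cube_nonneg(2)[OF x, of d] pprod_gt_zero[of d "n d"] by simp
    then have "\<lfloor>x $ d * real (pprod (p d) (n d))\<rfloor> < int (pprod (p d) (n d))"
      by (simp add: floor_less_iff)
    then show ?thesis unfolding icell_def using pprod_gt_zero[of d "n d"] by (simp add: nat_less_iff)
  qed
  then show ?thesis by (simp add: grid_def cell_def)
qed

lemma atom_eq_rectangle: "x \<in> unit_cube \<Longrightarrow> atom n x = rectangle p n (cell n x)"
  by (simp add: rectangle_eq cell_in_grid atom_def)

lemma grid_cell_surj:
  assumes "l \<in> grid n" obtains x where "x \<in> unit_cube" "cell n x = l"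
proof -
  define x :: "real^'d" where "x = (\<chi> d. real (l d) / real (pprod (p d) (n d)))"
  have "x \<in> rectangle p n l"
    using pprod_gt_zero by (simp add: rectangle_def x_def divide_strict_right_mono)
  then show ?thesis using that rectangle_eq[OF assms] by blast
qed

text \<open>The half-open rectangle lies between an open and a closed box of the same volume.\<close>
lemma rectangle_measure:
  "rectangle p n l \<in> sets borel" "emeasure lborel (rectangle p n l) = ennreal (1 / ncells n)"
proof -
  define a :: "real^'d" where "a = (\<chi> d. real (l d) / real (pprod (p d) (n d)))"
  define b :: "real^'d" where "b = (\<chi> d. real (l d + 1) / real (pprod (p d) (n d)))"
  have R: "rectangle p n l = {x. \<forall>d. a $ d \<le> x $ d \<and> x $ d < b $ d}"
    by (simp add: rectangle_def a_def b_def)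
  have "rectangle p n l = (\<Inter>d\<in>UNIV. {x. a $ d \<le> x $ d} \<inter> {x. x $ d < b $ d})"
    by (auto simp: R)
  also have "\<dots> \<in> sets borel" by (intro sets.countable_INT'') auto
  finally show m: "rectangle p n l \<in> sets borel" .
  have ab: "a $ d \<le> b $ d" for d by (simp add: a_def b_def divide_right_mono)
  have le: "a \<bullet> i \<le> b \<bullet> i" if "i \<in> Basis" for i
    using that ab by (auto simp: Basis_vec_def inner_axis)
  have "(\<Prod>i\<in>Basis. (b - a) \<bullet> i) = (\<Prod>d\<in>UNIV. (b - a) $ d)"
  proof -
    have B: "(Basis :: (real^'d) set) = (\<lambda>d. axis d 1) ` UNIV" by (auto simp: Basis_vec_def)
    have I: "inj (\<lambda>d::'d. axis d (1::real))" by (auto simp: inj_on_def axis_eq_axis)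
    have "(\<Prod>i\<in>Basis. (b - a) \<bullet> i) = (\<Prod>d\<in>UNIV. (b - a) \<bullet> axis d 1)"
      unfolding B prod.reindex[OF I] by simp
    then show ?thesis by (simp add: inner_axis)
  qed
  also have "\<dots> = 1 / ncells n"
    unfolding ncells_def a_def b_def by (simp add: prod_dividef flip: diff_divide_distrib)
  finally have P: "(\<Prod>i\<in>Basis. (b - a) \<bullet> i) = 1 / ncells n" .
  have "box a b \<subseteq> rectangle p n l" unfolding R by (auto simp: mem_box_cart less_imp_le)
  then have 1: "ennreal (1 / ncells n) \<le> emeasure lborel (rectangle p n l)"
    using emeasure_mono[of "box a b" "rectangle p n l" lborel] m by (simp add: emeasure_lborel_box[OF le] P)
  have "rectangle p n l \<subseteq> cbox a b" unfolding R by (auto simp: mem_box_cart less_imp_le)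
  then have 2: "emeasure lborel (rectangle p n l) \<le> ennreal (1 / ncells n)"
    using emeasure_mono[of "rectangle p n l" "cbox a b" lborel] by (simp add: emeasure_lborel_cbox[OF le] P)
  show "emeasure lborel (rectangle p n l) = ennreal (1 / ncells n)" using 1 2 by (rule antisym[rotated])
qed

lemma cube_eq_rectangle: "(unit_cube :: (real^'d) set) = rectangle p (\<lambda>_. 0) (\<lambda>_. 0)"
  by (auto simp: unit_cube_def rectangle_def pprod_def)

lemma cube_sets [measurable]: "(unit_cube :: (real^'d) set) \<in> sets borel" 
  by (subst cube_eq_rectangle) (rule rectangle_measure)

lemma cube_sets' [measurable, simp]: "(unit_cube :: (real^'d) set) \<in> sets lebesgue"
  using cube_sets by (simp add: sets_completionI_sets)

lemma space_cube [simp]: "space \<mu> = unit_cube"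
  by simp

lemma borel_subset_cube: "A \<in> sets borel \<Longrightarrow> A \<subseteq> unit_cube \<Longrightarrow> A \<in> sets \<mu>"
  by (simp add: sets_restrict_space_iff sets_completionI_sets)

lemma rectangle_cube:
  assumes l: "l \<in> grid n"
  shows "rectangle p n l \<in> sets \<mu>" "emeasure \<mu> (rectangle p n l) = ennreal (1 / ncells n)"
    "measure \<mu> (rectangle p n l) = 1 / ncells n"
proof -
  have sub: "rectangle p n l \<subseteq> unit_cube" using rectangle_eq[OF l] by blast
  show "rectangle p n l \<in> sets \<mu>" by (rule borel_subset_cube[OF rectangle_measure(1) sub])
  have "emeasure \<mu> (rectangle p n l) = emeasure lebesgue (rectangle p n l)"
    using sub by (intro emeasure_restrict_space) auto
  also have "\<dots> = emeasure lborel (rectangle p n l)" using rectangle_measure(1) by simp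
  finally show e: "emeasure \<mu> (rectangle p n l) = ennreal (1 / ncells n)"
    by (simp add: rectangle_measure)
  show "measure \<mu> (rectangle p n l) = 1 / ncells n"
    using e ncells_pos[of n] by (simp add: measure_def)
qed

lemma integral_cube_cong:
  fixes f g :: "real^'d \<Rightarrow> 'b::{banach, second_countable_topology}"
  assumes "\<And>y. y \<in> unit_cube \<Longrightarrow> f y = g y"
  shows "(LINT y|\<mu>. f y) = (LINT y|\<mu>. g y)"
  by (rule Bochner_Integration.integral_cong) (simp_all add: assms)

lemma integral_cube_mono:
  fixes f g :: "real^'d \<Rightarrow> real"
  assumes "integrable \<mu> f" "integrable \<mu> g"
    and "\<And>y. y \<in> unit_cube \<Longrightarrow> f y \<le> g y"
  shows "(LINT y|\<mu>. f y) \<le> (LINT y|\<mu>. g y)"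
  by (rule integral_mono) (simp_all add: assms)

lemma prob_cube: "prob_space \<mu>"
proof
  show "emeasure \<mu> (space \<mu>) = 1"
    using rectangle_cube(2)[of "\<lambda>_. 0" "\<lambda>_. 0"] 
    by (simp flip: cube_eq_rectangle add: grid_def ncells_def pprod_def)
qed

sublocale cube: prob_space \<mu>
  by (rule prob_cube)

lemma atom_cube:
  assumes "x \<in> unit_cube"
  shows "atom n x \<in> sets \<mu>" "measure \<mu> (atom n x) = 1 / ncells n"
    "emeasure \<mu> (atom n x) = ennreal (1 / ncells n)"
  using rectangle_cube[OF cell_in_grid[OF assms]] by (simp_all add: atom_eq_rectangle[OF assms])

lemma icell_refine:
  assumes "x \<in> unit_cube" "y \<in> unit_cube" "m \<le> k" "icell (p d) k (x $ d) = icell (p d) k (y $ d)"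
  shows "icell (p d) m (x $ d) = icell (p d) m (y $ d)"
  using icell_mono_eq[of "p d" "x $ d" "y $ d" m k] p_ge cube_nonneg(1) assms by blast

lemma cell_mono_eq:
  assumes "x \<in> unit_cube" "y \<in> unit_cube" "m \<le> n" "cell n x = cell n y"
  shows "cell m x = cell m y"
proof
  fix d
  have "icell (p d) (n d) (x $ d) = icell (p d) (n d) (y $ d)"
    using fun_cong[OF assms(4), of d] by (simp add: cell_def)
  moreover have "m d \<le> n d" using assms(3) by (simp add: le_fun_def)
  ultimately show "cell m x d = cell m y d"
    unfolding cell_def using icell_refine[OF assms(1,2)] by simp
qed

lemma stepD: "step n g \<Longrightarrow> x \<in> unit_cube \<Longrightarrow> y \<in> unit_cube \<Longrightarrow> cell n x
    = cell n y \<Longrightarrow> g x = g y"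
  unfolding step_def by blast

lemma step_mono: "step m g \<Longrightarrow> m \<le> n \<Longrightarrow> step n g"
  unfolding step_def using cell_mono_eq by blast

lemma step_const: "step n (\<lambda>x. c)"
  by (simp add: step_def)

lemma step_comp: "step n f \<Longrightarrow> step n (\<lambda>x. F (f x))"
  unfolding step_def by metis

lemma step_comp2: "step n f \<Longrightarrow> step n g \<Longrightarrow> step n (\<lambda>x. F (f x) (g x))"
  unfolding step_def by metis

lemma stepI:
  "(\<And>x y. x \<in> unit_cube \<Longrightarrow> y \<in> unit_cube \<Longrightarrow> cell n x = cell n y \<Longrightarrow> g x
      = g y) \<Longrightarrow> step n g"
  unfolding step_def by blast

lemma step_sum: "(\<And>i. i \<in> I \<Longrightarrow> step n (f i)) \<Longrightarrow> step n (\<lambda>x. \<Sum>i\<in>I. f i x)"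
  by (intro stepI sum.cong refl) (rule stepD)

lemma step_avg: "step n (avg n g)"
  by (simp add: step_def avg_def atom_def)

lemma avg_cong: "(\<And>y. y \<in> unit_cube \<Longrightarrow> f y = g y) \<Longrightarrow> avg n f = avg n g"
  unfolding avg_def by (intro ext arg_cong2[of _ _ _ _ scaleR] Bochner_Integration.integral_cong refl) auto

text \<open>A sample point of a cell, at which a step function may be evaluated.\<close>
definition cell_point :: "('d \<Rightarrow> nat) \<Rightarrow> ('d \<Rightarrow> nat) \<Rightarrow> real ^ 'd" where
  "cell_point n l = (SOME x. x \<in> unit_cube \<and> cell n x = l)"

lemma cell_point: assumes "l \<in> grid n" shows "cell_point n l \<in> unit_cube" "cell n (cell_point n l) = l"
  using someI_ex[of "\<lambda>x. x \<in> unit_cube \<and> cell n x = l"] grid_cell_surj[OF assms] 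
  unfolding cell_point_def by metis+

lemma cell_decomp:
  fixes g :: "real^'d \<Rightarrow> 'b::real_vector"
  assumes x: "x \<in> unit_cube"
  shows "g x = (\<Sum>l\<in>grid n. indicator (rectangle p n l) x *\<^sub>R g x)"
proof -
  have "(\<Sum>l\<in>grid n. indicator (rectangle p n l) x *\<^sub>R g x) = (\<Sum>l\<in>grid n. if l = cell n x then g x else 0)"
    by (intro sum.cong refl) (auto simp: rectangle_eq x)
  then show ?thesis using cell_in_grid[OF x] by (simp add: finite_grid)
qed

lemma step_decomp:
  fixes u :: "real^'d \<Rightarrow> real" and g :: "real^'d \<Rightarrow> 'b::real_vector"
  assumes "step n u" and x: "x \<in> unit_cube"
  shows "u x *\<^sub>R g x = (\<Sum>l\<in>grid n. u (cell_point n l) *\<^sub>R indicator (rectangle p n l) x *\<^sub>R g x)"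
proof -
  have "u x *\<^sub>R g x = (\<Sum>l\<in>grid n. indicator (rectangle p n l) x *\<^sub>R u x *\<^sub>R g x)"
    by (rule cell_decomp[OF x])
  also have "\<dots> = (\<Sum>l\<in>grid n. u (cell_point n l) *\<^sub>R indicator (rectangle p n l) x *\<^sub>R g x)"
  proof (intro sum.cong refl)
    fix l assume l: "l \<in> grid n"
    have "u x = u (cell_point n l)" if "x \<in> rectangle p n l"
      using stepD[OF assms(1) x cell_point(1)[OF l]] that cell_point[OF l] rectangle_eq[OF l] by simp
    then show "indicator (rectangle p n l) x *\<^sub>R u x *\<^sub>R g x = u (cell_point n l) *\<^sub>R indicator (rectangle p n l) x *\<^sub>R g x"
      by (auto simp: indicator_def)
  qed
  finally show ?thesis .
qed

lemma integrable_rect: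
  fixes g :: "real^'d \<Rightarrow> 'b::{banach, second_countable_topology}"
  assumes "l \<in> grid n" "integrable \<mu> g"
  shows "integrable \<mu> (\<lambda>x. indicator (rectangle p n l) x *\<^sub>R g x)"
  by (rule integrable_mult_indicator[OF rectangle_cube(1)[OF assms(1)] assms(2)])

lemma integrable_atom:
  fixes g :: "real^'d \<Rightarrow> 'b::{banach, second_countable_topology}"
  assumes "x \<in> unit_cube" "integrable \<mu> g"
  shows "integrable \<mu> (\<lambda>y. indicator (atom n x) y *\<^sub>R g y)"
  by (rule integrable_mult_indicator[OF atom_cube(1)[OF assms(1)] assms(2)])

lemma integrable_step_scale:
  fixes u :: "real^'d \<Rightarrow> real" and g :: "real^'d \<Rightarrow> 'b::{banach, second_countable_topology}"
  assumes "step n u" "integrable \<mu> g"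
  shows "integrable \<mu> (\<lambda>x. u x *\<^sub>R g x)"
proof -
  have "integrable \<mu> (\<lambda>x. u x *\<^sub>R g x) \<longleftrightarrow>
    integrable \<mu> (\<lambda>x. \<Sum>l\<in>grid n. u (cell_point n l) *\<^sub>R indicator (rectangle p n l) x *\<^sub>R g x)"
    by (rule Bochner_Integration.integrable_cong) (use step_decomp[OF assms(1)] in auto)
  also have "\<dots>"
    by (intro Bochner_Integration.integrable_sum Bochner_Integration.integrable_scaleR_right impI integrable_rect assms)
  finally show ?thesis .
qed

lemma step_integrable:
  fixes g :: "real^'d \<Rightarrow> 'b::{banach, second_countable_topology}"
  assumes "step n g"
  shows "integrable \<mu> g"
proof -
  have "integrable \<mu> g \<longleftrightarrow>
    integrable \<mu> (\<lambda>x. \<Sum>l\<in>grid n. indicator (rectangle p n l) x *\<^sub>R g (cell_point n l))"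
  proof (rule Bochner_Integration.integrable_cong[OF refl])
    fix x :: "real^'d" assume "x \<in> space \<mu>"
    then have x: "x \<in> unit_cube" by simp
    show "g x = (\<Sum>l\<in>grid n. indicator (rectangle p n l) x *\<^sub>R g (cell_point n l))"
      using cell_decomp[OF x, of g n] 
    proof (rule trans, intro sum.cong refl)
      fix l assume l: "l \<in> grid n"
      show "indicator (rectangle p n l) x *\<^sub>R g x = indicator (rectangle p n l) x *\<^sub>R g (cell_point n l)"
        using stepD[OF assms(1) x cell_point(1)[OF l]] cell_point[OF l] rectangle_eq[OF l] by (auto simp: indicator_def)
    qed
  qed
  also have "\<dots>" by (intro Bochner_Integration.integrable_sum integrable_rect) auto
  finally show ?thesis .
qed

lemma integral_cells:
  fixes g :: "real^'d \<Rightarrow> 'b::{banach, second_countable_topology}"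
  assumes "integrable \<mu> g"
  shows "(LINT x|\<mu>. g x) = (\<Sum>l\<in>grid n. LINT x|\<mu>. indicator (rectangle p n l) x *\<^sub>R g x)"
proof -
  have "(LINT x|\<mu>. g x) = (LINT x|\<mu>. (\<Sum>l\<in>grid n. indicator (rectangle p n l) x *\<^sub>R g x))"
    by (rule integral_cube_cong) (use cell_decomp in auto)
  also have "\<dots> = (\<Sum>l\<in>grid n. LINT x|\<mu>. indicator (rectangle p n l) x *\<^sub>R g x)"
    by (intro Bochner_Integration.integral_sum integrable_rect assms)
  finally show ?thesis .
qed

lemma avg_on_rectangle:
  assumes l: "l \<in> grid n" and x: "x \<in> rectangle p n l"
  shows "avg n g x = ncells n *\<^sub>R (LINT y|\<mu>. indicator (rectangle p n l) y *\<^sub>R g y)"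
  using x rectangle_eq[OF l] atom_eq_rectangle[of x n] unfolding avg_def by auto

text \<open>Both sides equal \<open>\<Sum>l. ncells m * (\<integral>u over l) * (\<integral>g over l)\<close>, the sum being over the cells \<open>l\<close> of
generation \<open>m\<close>, and this expression is symmetric in \<open>u\<close> and \<open>g\<close>.\<close>
lemma avg_self_adjoint:
  fixes u :: "real^'d \<Rightarrow> real" and g :: "real^'d \<Rightarrow> 'b::{banach, second_countable_topology}"
  assumes u: "step N u" and g: "integrable \<mu> g"
  shows "(LINT x|\<mu>. u x *\<^sub>R avg m g x) = (LINT x|\<mu>. avg m u x *\<^sub>R g x)"
proof -
  have iu: "integrable \<mu> u" by (rule step_integrable[OF u])
  define U where "U l = (LINT y|\<mu>. indicator (rectangle p m l) y *\<^sub>R u y)" for l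
  define G where "G l = (LINT y|\<mu>. indicator (rectangle p m l) y *\<^sub>R g y)" for l
  have "(LINT x|\<mu>. u x *\<^sub>R avg m g x)
      = (\<Sum>l\<in>grid m. LINT x|\<mu>. indicator (rectangle p m l) x *\<^sub>R u x *\<^sub>R avg m g x)"
    by (intro integral_cells integrable_step_scale[OF u] step_integrable[OF step_avg])
  also have "\<dots> = (\<Sum>l\<in>grid m. U l *\<^sub>R (ncells m *\<^sub>R G l))"
  proof (intro sum.cong refl)
    fix l assume l: "l \<in> grid m"
    have "(LINT x|\<mu>. indicator (rectangle p m l) x *\<^sub>R u x *\<^sub>R avg m g x)
        = (LINT x|\<mu>. (indicator (rectangle p m l) x *\<^sub>R u x) *\<^sub>R (ncells m *\<^sub>R G l))"
      unfolding G_def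
      by (rule integral_cube_cong) (auto simp: indicator_def avg_on_rectangle[OF l])
    then show "(LINT x|\<mu>. indicator (rectangle p m l) x *\<^sub>R u x *\<^sub>R avg m g x)
        = U l *\<^sub>R (ncells m *\<^sub>R G l)"
      unfolding U_def using integrable_rect[OF l iu] by simp
  qed
  also have "\<dots> = (\<Sum>l\<in>grid m. (ncells m *\<^sub>R U l) *\<^sub>R G l)"
    by (simp add: mult.commute)
  also have "\<dots> = (\<Sum>l\<in>grid m. LINT x|\<mu>. indicator (rectangle p m l) x *\<^sub>R avg m u x *\<^sub>R g x)"
  proof (intro sum.cong refl)
    fix l assume l: "l \<in> grid m"
    have "(LINT x|\<mu>. indicator (rectangle p m l) x *\<^sub>R avg m u x *\<^sub>R g x)
        = (LINT x|\<mu>. (ncells m *\<^sub>R U l) *\<^sub>R indicator (rectangle p m l) x *\<^sub>R g x)"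
      unfolding U_def
      by (rule integral_cube_cong) (auto simp: indicator_def avg_on_rectangle[OF l])
    then show "(ncells m *\<^sub>R U l) *\<^sub>R G l =
      (LINT x|\<mu>. indicator (rectangle p m l) x *\<^sub>R avg m u x *\<^sub>R g x)"
      unfolding G_def by (simp only: integral_scaleR_right)
  qed
  also have "\<dots> = (LINT x|\<mu>. avg m u x *\<^sub>R g x)"
    by (intro integral_cells[symmetric] integrable_step_scale[OF step_avg g])
  finally show ?thesis .
qed

text \<open>In each coordinate the two intervals are nested, and the intersection is the finer one of them;
hence it is again a cell, of generation \<open>sup n m\<close>.\<close>
lemma inter_atom:
  assumes x: "x \<in> unit_cube" and z: "z \<in> unit_cube" and eq: "cell (inf n m) x = cell (inf n m) z"
  obtains y where "y \<in> unit_cube" "atom n x \<inter> atom m z = atom (sup n m) y"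
proof -
  \<comment> \<open>in each coordinate the point that belongs to the finer of the two intervals\<close>
  define y :: "real^'d" where "y = (\<chi> d. if m d \<le> n d then x $ d else z $ d)"
  have y: "y \<in> unit_cube" using x z by (simp add: unit_cube_def y_def)
  have "cell n w = cell n x \<and> cell m w = cell m z \<longleftrightarrow> cell (sup n m) w = cell (sup n m) y"
    if w: "w \<in> unit_cube" for w
  proof -
    have "icell (p d) (n d) (w $ d) = icell (p d) (n d) (x $ d) \<and> icell (p d) (m d) (w $ d) = icell (p d) (m d) (z $ d)
       \<longleftrightarrow> icell (p d) (max (n d) (m d)) (w $ d) = icell (p d) (max (n d) (m d)) (y $ d)" for d
    proof -
      have e: "icell (p d) (min (n d) (m d)) (x $ d) = icell (p d) (min (n d) (m d)) (z $ d)"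
        using fun_cong[OF eq, of d] by (simp add: cell_def inf_min)
      show ?thesis
      proof (cases "m d \<le> n d")
        case True
        then have "min (n d) (m d) = m d" "max (n d) (m d) = n d" "y $ d = x $ d"
          by (simp_all add: y_def)
        then show ?thesis using e icell_refine[OF w x True] by auto
      next
        case False
        then have "min (n d) (m d) = n d" "max (n d) (m d) = m d" "y $ d = z $ d" "n d \<le> m d"
          by (simp_all add: y_def)
        then show ?thesis using e icell_refine[OF w z, of "n d" "m d" d] by auto
      qed
    qed
    then have "cell n w d = cell n x d \<and> cell m w d = cell m z d \<longleftrightarrow> cell (sup n m) w d = cell (sup n m) y d" for d
      by (simp add: cell_def sup_max)
    then show ?thesis unfolding fun_eq_iff by blast
  qed
  then have "atom n x \<inter> atom m z = atom (sup n m) y" by (auto simp: atom_def)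
  then show ?thesis using that y by blast
qed

lemma ncells_inf_sup: "ncells n * ncells m = ncells (inf n m) * ncells (sup n m)"
  unfolding ncells_def prod.distrib[symmetric]
  by (intro prod.cong refl) (auto simp: inf_min sup_max min_def max_def)

text \<open>The kernels of \<open>avg n\<close> and \<open>avg m\<close> compose to the kernel of \<open>avg (inf n m)\<close>: two cells that meet
intersect in a cell of generation \<open>sup n m\<close>, and
\<open>ncells n * ncells m = ncells (inf n m) * ncells (sup n m)\<close>.\<close>
lemma avg_atom_indicator:
  assumes x: "x \<in> unit_cube" and z: "z \<in> unit_cube"
  shows "ncells n * avg m (indicator (atom n x)) z = ncells (inf n m) * indicator (atom (inf n m) x) z"
proof -
  have I: "avg m (indicator (atom n x)) z = ncells m * measure \<mu> (atom n x \<inter> atom m z)"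
  proof -
    have "avg m (indicator (atom n x) :: _ \<Rightarrow> real) z = ncells m * (LINT y|\<mu>. indicator (atom n x \<inter> atom m z) y)"
      unfolding avg_def by (simp add: indicator_inter_arith mult.commute)
    moreover have "atom n x \<inter> atom m z \<subseteq> unit_cube" by (auto simp: atom_def)
    ultimately show ?thesis
      using atom_cube(1)[OF x, of n] atom_cube(1)[OF z, of m] by (simp add: Int_absorb2)
  qed
  show ?thesis
  proof (cases "cell (inf n m) x = cell (inf n m) z")
    case True
    obtain y where y: "y \<in> unit_cube" "atom n x \<inter> atom m z = atom (sup n m) y"
      using inter_atom[OF x z True] by blast
    have "ncells n * (ncells m * (1 / ncells (sup n m))) = ncells (inf n m)"
      using ncells_inf_sup[of n m] ncells_pos[of "sup n m"] by (simp add: field_simps)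
    then have "ncells n * avg m (indicator (atom n x)) z = ncells (inf n m)"
      by (simp add: I y atom_cube)
    then show ?thesis using True z by (simp add: atom_def)
  next
    case False
    have "atom n x \<inter> atom m z = {}"
    proof (rule ccontr)
      assume "atom n x \<inter> atom m z \<noteq> {}"
      then obtain w where w: "w \<in> unit_cube" "cell n w = cell n x" "cell m w = cell m z" 
        by (auto simp: atom_def)
      show False
        using False cell_mono_eq[OF w(1) x inf_le1 w(2)] cell_mono_eq[OF w(1) z inf_le2 w(3)] by metis
    qed
    then have "ncells n * avg m (indicator (atom n x)) z = 0" by (simp add: I)
    then show ?thesis using False z by (simp add: atom_def)
  qed
qed

lemma step_atom: "step n (\<lambda>y. indicator (atom n x) y)"
  by (auto simp: step_def atom_def indicator_def)

text \<open>The averages commute, and their product is the average at the coordinatewise minimum.  This is the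
property of a multi-parameter filtration (the condition of Cairoli and Walsh) on which all
arguments by iteration over the coordinates rest.\<close>
theorem avg_avg:
  fixes g :: "real^'d \<Rightarrow> 'b::{banach, second_countable_topology}"
  assumes g: "integrable \<mu> g" and x: "x \<in> unit_cube"
  shows "avg n (avg m g) x = avg (inf n m) g x"
proof -
  have "avg n (avg m g) x = ncells n *\<^sub>R (LINT y|\<mu>. indicator (atom n x) y *\<^sub>R avg m g y)"
    by (simp add: avg_def)
  also have "\<dots> = ncells n *\<^sub>R (LINT y|\<mu>. avg m (indicator (atom n x)) y *\<^sub>R g y)"
    by (simp only: avg_self_adjoint[OF step_atom g])
  also have "\<dots> = (LINT y|\<mu>. (ncells n * avg m (indicator (atom n x)) y) *\<^sub>R g y)"
    by (simp only: scaleR_scaleR[symmetric] integral_scaleR_right)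
  also have "\<dots> = (LINT y|\<mu>. (ncells (inf n m) * indicator (atom (inf n m) x) y) *\<^sub>R g y)"
    by (rule integral_cube_cong) (simp add: avg_atom_indicator[OF x])
  also have "\<dots> = avg (inf n m) g x"
    by (simp only: avg_def scaleR_scaleR[symmetric] integral_scaleR_right)
  finally show ?thesis .
qed

lemma step_atomD: "step n g \<Longrightarrow> x \<in> unit_cube \<Longrightarrow> y \<in> atom n x \<Longrightarrow> g y = g x"
  unfolding atom_def by (auto intro: stepD)

lemma avg_step:
  fixes g :: "real^'d \<Rightarrow> 'b::{banach, second_countable_topology}"
  assumes g: "step n g" and x: "x \<in> unit_cube"
  shows "avg n g x = g x"
proof -
  have "(LINT y|\<mu>. indicator (atom n x) y *\<^sub>R g y) = (LINT y|\<mu>. indicator (atom n x) y *\<^sub>R g x)"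
    by (rule integral_cube_cong) (auto simp: indicator_def step_atomD[OF g x])
  also have "\<dots> = (1 / ncells n) *\<^sub>R g x"
  proof -
    have "atom n x \<inter> unit_cube = atom n x" by (auto simp: atom_def)
    then show ?thesis
      using atom_cube[OF x, of n] by (subst integral_scaleR_left) (auto intro!: integrable_real_indicator)
  qed
  finally show ?thesis using ncells_pos[of n] by (simp add: avg_def)
qed

lemma integral_avg:
  fixes g :: "real^'d \<Rightarrow> 'b::{banach, second_countable_topology}"
  assumes g: "integrable \<mu> g"
  shows "(LINT x|\<mu>. avg n g x) = (LINT x|\<mu>. g x)"
proof -
  have "(LINT x|\<mu>. (1::real) *\<^sub>R avg n g x) = (LINT x|\<mu>. avg n (\<lambda>_. 1::real) x *\<^sub>R g x)"
    by (rule avg_self_adjoint[OF step_const g])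
  also have "\<dots> = (LINT x|\<mu>. g x)"
    by (rule integral_cube_cong) (simp add: avg_step[OF step_const])
  finally show ?thesis by simp
qed

lemma avg_mult_left:
  fixes c :: "'b::{banach, second_countable_topology, real_normed_field}"
  shows "avg n (\<lambda>y. c * g y) x = c * avg n g x"
  by (simp only: avg_def mult_scaleR_right[symmetric] integral_mult_right_zero)

lemma avg_pull_out:
  fixes g :: "real^'d \<Rightarrow> 'b::{banach, second_countable_topology, real_normed_field}"
  assumes u: "step n u" and x: "x \<in> unit_cube"
  shows "avg n (\<lambda>y. u y * g y) x = u x * avg n g x"
proof -
  have "(LINT y|\<mu>. indicator (atom n x) y *\<^sub>R (u y * g y)) = (LINT y|\<mu>. indicator (atom n x) y *\<^sub>R (u x * g y))"
    by (rule integral_cube_cong) (auto simp: indicator_def step_atomD[OF u x])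
  then have "avg n (\<lambda>y. u y * g y) x = avg n (\<lambda>y. u x * g y) x"
    by (simp only: avg_def)
  then show ?thesis by (simp only: avg_mult_left)
qed

lemma avg_diff:
  fixes f g :: "real^'d \<Rightarrow> 'b::{banach, second_countable_topology}"
  assumes "x \<in> unit_cube" "integrable \<mu> f" "integrable \<mu> g"
  shows "avg n (\<lambda>y. f y - g y) x = avg n f x - avg n g x"
  using integrable_atom[OF assms(1,2), of n] integrable_atom[OF assms(1,3), of n]
  by (simp add: avg_def scaleR_diff_right)

lemma avg_sum:
  fixes f :: "'i \<Rightarrow> real^'d \<Rightarrow> 'b::{banach, second_countable_topology}"
  assumes "x \<in> unit_cube" "\<And>i. i \<in> I \<Longrightarrow> integrable \<mu> (f i)"
  shows "avg n (\<lambda>y. \<Sum>i\<in>I. f i y) x = (\<Sum>i\<in>I. avg n (f i) x)"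
  using integrable_atom[OF assms(1) assms(2), of _ n]
  by (simp add: avg_def scaleR_sum_right)

lemma avg_mono:
  fixes f g :: "real^'d \<Rightarrow> real"
  assumes "x \<in> unit_cube" "integrable \<mu> f" "integrable \<mu> g"
    and "\<And>y. y \<in> unit_cube \<Longrightarrow> f y \<le> g y"
  shows "avg n f x \<le> avg n g x"
  unfolding avg_def real_scaleR_def
  using integrable_atom[OF assms(1,2), of n] integrable_atom[OF assms(1,3), of n] ncells_pos[of n]
  by (intro mult_left_mono integral_cube_mono) (auto simp: assms(4) intro!: mult_left_mono)

lemma avg_nonneg:
  fixes f :: "real^'d \<Rightarrow> real"
  assumes "\<And>y. y \<in> unit_cube \<Longrightarrow> 0 \<le> f y"
  shows "0 \<le> avg n f x"
  unfolding avg_def real_scaleR_def using ncells_pos[of n]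
  by (intro mult_nonneg_nonneg Bochner_Integration.integral_nonneg) (auto simp: assms)

lemma norm_avg_le:
  fixes f :: "real^'d \<Rightarrow> 'b::{banach, second_countable_topology}"
  shows "norm (avg n f x) \<le> avg n (\<lambda>y. norm (f y)) x"
proof -
  have "norm (LINT y|\<mu>. indicator (atom n x) y *\<^sub>R f y)
     \<le> (LINT y|\<mu>. norm (indicator (atom n x) y *\<^sub>R f y))" by (rule integral_norm_bound)
  then show ?thesis using ncells_pos[of n] by (simp add: avg_def mult_left_mono)
qed

end

section \<open>Mixed differences\<close>

lemma finite_le_multi [simp]: "finite {m :: 'd::finite \<Rightarrow> nat. m \<le> n}"
proof -
  have "{m. m \<le> n} = PiE UNIV (\<lambda>d. {..n d})" by (auto simp: le_fun_def)
  then show ?thesis by (simp add: finite_PiE)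
qed

definition bits :: "'d set \<Rightarrow> ('d \<Rightarrow> nat) set" where
  "bits S = PiE UNIV (\<lambda>i. if i \<in> S then {0, 1} else {0})"

definition bsign :: "('d::finite \<Rightarrow> nat) \<Rightarrow> complex" where
  "bsign \<epsilon> = (-1) ^ (\<Sum>d\<in>UNIV. \<epsilon> d)"

definition shift :: "(('d \<Rightarrow> nat) \<Rightarrow> 'a \<Rightarrow> complex) \<Rightarrow> ('d \<Rightarrow> nat) \<Rightarrow> ('d \<Rightarrow> nat) \<Rightarrow> 'a \<Rightarrow> complex" where
  "shift f n \<epsilon> = (if \<exists>d. n d < \<epsilon> d then (\<lambda>_. 0) else f (\<lambda>d. n d - \<epsilon> d))"

text \<open>The mixed difference \<open>pdiff S f n\<close> is taken in the coordinates of \<open>S\<close> only.  It interpolates between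
\<open>f n\<close>, for \<open>S = {}\<close>, and the martingale difference \<open>mdiff f n\<close>, for \<open>S = UNIV\<close>, and makes
induction over the coordinates possible.\<close>
definition pdiff :: "'d::finite set \<Rightarrow> (('d \<Rightarrow> nat) \<Rightarrow> 'a \<Rightarrow> complex) \<Rightarrow> ('d \<Rightarrow> nat) \<Rightarrow> 'a \<Rightarrow> complex" where
  "pdiff S f n x = (\<Sum>\<epsilon>\<in>bits S. bsign \<epsilon> * shift f n \<epsilon> x)"

lemma bits_iff: "\<epsilon> \<in> bits S \<longleftrightarrow> (\<forall>i. \<epsilon> i \<in> (if i \<in> S then {0, 1} else {0}))"
  by (simp add: bits_def PiE_iff)

lemma bits_0: "\<epsilon> \<in> bits S \<Longrightarrow> d \<notin> S \<Longrightarrow> \<epsilon> d = 0"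
  unfolding bits_iff by (drule spec[of _ d]) simp

lemma finite_bits: "finite (bits (S :: 'd::finite set))"
  unfolding bits_def by (intro finite_PiE) auto

lemma bits_insert:
  assumes "d \<notin> S"
  shows "bits (insert d S) = bits S \<union> (\<lambda>\<epsilon>. \<epsilon>(d := 1)) ` bits S"
proof (intro equalityI subsetI)
  fix \<epsilon> assume "\<epsilon> \<in> bits (insert d S)"
  then have m: "\<epsilon> i \<in> (if i \<in> insert d S then {0, 1} else {0})" for i by (simp only: bits_iff)
  have "(\<epsilon>(d := 0)) i \<in> (if i \<in> S then {0, 1} else {0})" for i
    using m[of i] by (cases "i = d") auto
  then have "\<epsilon>(d := 0) \<in> bits S" by (simp only: bits_iff) simp
  moreover have "\<epsilon> = \<epsilon>(d := 0) \<or> \<epsilon> = (\<epsilon>(d := 0))(d := 1)"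
    using m[of d] by (auto simp: fun_eq_iff)
  ultimately show "\<epsilon> \<in> bits S \<union> (\<lambda>\<epsilon>. \<epsilon>(d := 1)) ` bits S" by (elim disjE) (simp, blast)
next
  fix \<epsilon> assume "\<epsilon> \<in> bits S \<union> (\<lambda>\<epsilon>. \<epsilon>(d := 1)) ` bits S"
  then obtain \<eta> where \<eta>: "\<eta> \<in> bits S" "\<epsilon> = \<eta> \<or> \<epsilon> = \<eta>(d := 1)" by blast
  have "\<epsilon> i \<in> (if i \<in> insert d S then {0, 1} else {0})" for i
  proof -
    have "\<eta> i \<in> (if i \<in> S then {0, 1} else {0})" using \<eta>(1) by (simp only: bits_iff)
    then show ?thesis using \<eta>(2) by (auto split: if_splits)
  qed
  then show "\<epsilon> \<in> bits (insert d S)" by (simp only: bits_iff) simp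
qed

lemma sum_bits_insert:
  assumes d: "d \<notin> S"
  shows "(\<Sum>\<epsilon>\<in>bits (insert d S). F \<epsilon>) = (\<Sum>\<epsilon>\<in>bits (S :: 'd::finite set). F \<epsilon>
      + F (\<epsilon>(d := 1)))"
proof -
  have disj: "bits S \<inter> (\<lambda>\<epsilon>. \<epsilon>(d := 1)) ` bits S = {}"
  proof (rule equals0I)
    fix e assume "e \<in> bits S \<inter> (\<lambda>\<epsilon>. \<epsilon>(d := 1)) ` bits S"
    then obtain b where "e \<in> bits S" "e = b(d := 1)" by blast
    then show False using bits_0[of e S, OF _ d] by simp
  qed
  have "inj_on (\<lambda>\<epsilon>. \<epsilon>(d := 1)) (bits S)"
  proof (rule inj_onI)
    fix a b assume ab: "a \<in> bits S" "b \<in> bits S" "a(d := 1) = b(d := 1)"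
    have "a i = b i" for i
      using bits_0[OF ab(1) d] bits_0[OF ab(2) d] fun_cong[OF ab(3), of i] by (cases "i = d") simp_all
    then show "a = b" by blast
  qed
  then show ?thesis
    unfolding bits_insert[OF d] using disj by (simp add: sum.union_disjoint finite_bits sum.reindex sum.distrib)
qed

lemma mdiff_eq_pdiff: "mdiff f n x = pdiff UNIV f n x"
proof -
  have "UNIV \<rightarrow>\<^sub>E {0, 1} = bits UNIV" by (simp add: bits_def)
  then show ?thesis
    unfolding mdiff_def pdiff_def bsign_def shift_def by (intro sum.cong) auto
qed

lemma pdiff_empty:
  fixes f :: "('d::finite \<Rightarrow> nat) \<Rightarrow> 'a \<Rightarrow> complex"
  shows "pdiff {} f n x = f n x"
proof -
  have "bits ({} :: 'd set) = {\<lambda>_. 0}" by (auto simp: bits_iff)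
  then show ?thesis by (simp add: pdiff_def bsign_def shift_def)
qed

text \<open>The mixed difference in one more coordinate is an ordinary first difference in that coordinate,
where the term with index \<open>-1\<close> is zero.\<close>
lemma pdiff_insert:
  assumes d: "d \<notin> S"
  shows "pdiff (insert d S) f n x = pdiff S f n x - (if n d = 0 then 0 else pdiff S f (n(d := n d - 1)) x)"
proof -
  let ?n = "n(d := n d - 1)"
  have "pdiff (insert d S) f n x = (\<Sum>\<epsilon>\<in>bits S. bsign \<epsilon> * shift f n \<epsilon> x
      + bsign (\<epsilon>(d := 1)) * shift f n (\<epsilon>(d := 1)) x)"
    unfolding pdiff_def by (rule sum_bits_insert[OF d])
  also have "\<dots> = (\<Sum>\<epsilon>\<in>bits S. bsign \<epsilon> * shift f n \<epsilon> x - (if n d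
      = 0 then 0 else bsign \<epsilon> * shift f ?n \<epsilon> x))"
  proof (intro sum.cong refl)
    fix \<epsilon> assume "\<epsilon> \<in> bits S"
    then have e: "\<epsilon> d = 0" by (rule bits_0[OF _ d])
    have "bsign (\<epsilon>(d := 1)) = - bsign \<epsilon>"
      using e by (simp add: bsign_def sum.remove[of UNIV d])
    moreover have "shift f n (\<epsilon>(d := 1)) x = (if n d = 0 then 0 else shift f ?n \<epsilon> x)"
    proof (cases "n d = 0")
      case True
      then have "n d < (\<epsilon>(d := 1)) d" by simp
      then have "\<exists>i. n i < (\<epsilon>(d := 1)) i" by blast
      then have "shift f n (\<epsilon>(d := 1)) = (\<lambda>_. 0)" unfolding shift_def by (rule if_P)
      then show ?thesis using True by simp
    next
      case False
      have "n i < (\<epsilon>(d := 1)) i \<longleftrightarrow> ?n i < \<epsilon> i" for i using e False by (cases "i = d") auto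
      moreover have "(\<lambda>i. n i - (\<epsilon>(d := 1)) i) = (\<lambda>i. ?n i - \<epsilon> i)" using e by auto
      ultimately show ?thesis using False by (simp only: shift_def if_False)
    qed
    ultimately show "bsign \<epsilon> * shift f n \<epsilon> x + bsign (\<epsilon>(d := 1)) * shift f n (\<epsilon>(d := 1)) x
      = bsign \<epsilon> * shift f n \<epsilon> x - (if n d = 0 then 0 else bsign \<epsilon> * shift f ?n \<epsilon> x)" by simp
  qed
  also have "\<dots> = pdiff S f n x - (if n d = 0 then 0 else pdiff S f ?n x)"
    by (simp add: pdiff_def sum_subtractf)
  finally show ?thesis .
qed

text \<open>Each difference in a coordinate \<open>d\<close> removes from the sum the indices \<open>m\<close> with \<open>m d < n d\<close>.  With all
coordinates this is Moebius inversion: differences undo summation.\<close>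
lemma pdiff_partial_sums:
  fixes S :: "'d::finite set"
  assumes "finite S"
  shows "pdiff S (\<lambda>n x. \<Sum>m | m \<le> n. a m x) n x = (\<Sum>m | m \<le> n \<and> (\<forall>d\<in>S. m d = n d). a m x)"
  using assms
proof (induction S arbitrary: n)
  case empty
  then show ?case by (simp add: pdiff_empty)
next
  case (insert d S)
  let ?A = "\<lambda>n. {m. m \<le> n \<and> (\<forall>i\<in>S. m i = n i)}" and ?n = "n(d := n d - 1)"
  have fin: "finite (?A k)" for k :: "'d \<Rightarrow> nat" by (rule finite_subset[OF _ finite_le_multi[of k]]) auto
  have same: "?n i = n i" if "i \<in> S" for i using that insert.hyps by auto
  show ?case
  proof (cases "n d = 0")
    case True
    then have "m d = n d" if "m \<le> n" for m using le_funD[OF that, of d] by simp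
    then have "?A n = {m. m \<le> n \<and> (\<forall>i\<in>insert d S. m i = n i)}" by auto
    then show ?thesis using True by (simp add: pdiff_insert[OF insert.hyps(2)] insert.IH)
  next
    case False
    have le: "m \<le> ?n \<longleftrightarrow> m \<le> n \<and> m d < n d" for m
    proof -
      have "m i \<le> ?n i \<longleftrightarrow> m i \<le> n i \<and> (i = d \<longrightarrow> m d < n d)" for i
        using False by (cases "i = d") auto
      then show ?thesis unfolding le_fun_def by blast
    qed
    \<comment> \<open>on \<open>S\<close> the two conditions agree, because \<open>d\<close> is not in \<open>S\<close>\<close>
    have lower: "?A ?n = {m \<in> ?A n. m d < n d}" unfolding le using same by auto
    then have sub: "?A ?n \<subseteq> ?A n" by blast
    have eq: "{m. m \<le> n \<and> (\<forall>i\<in>insert d S. m i = n i)} = ?A n - ?A ?n"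
    proof -
      have "m d = n d \<longleftrightarrow> \<not> m d < n d" if "m \<le> n" for m using le_funD[OF that, of d] by auto
      then show ?thesis unfolding lower by blast
    qed
    show ?thesis
      unfolding pdiff_insert[OF insert.hyps(2)] insert.IH eq sum_diff[OF fin sub] using False by (simp only: if_False)
  qed
qed

lemma mdiff_partial_sums: "mdiff (\<lambda>n x. \<Sum>m | m \<le> n. a m x) n x = a n x"
proof -
  have "{m. m \<le> n \<and> (\<forall>d\<in>UNIV. m d = n d)} = {n}" by auto
  then show ?thesis by (simp only: mdiff_eq_pdiff pdiff_partial_sums[OF finite]) simp
qed

lemma mdiff_diff:
  "mdiff (\<lambda>n x. f n x - g n x) n x = mdiff f n x - mdiff g n x"
  unfolding mdiff_def by (subst sum_subtractf[symmetric]) (auto intro!: sum.cong simp: algebra_simps)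

lemma mdiff_0: "mdiff f (\<lambda>_. 0) x = f (\<lambda>_. 0) x"
proof -
  have "pdiff S f (\<lambda>_. 0) x = f (\<lambda>_. 0) x" if "finite S" for S
    using that by induction (simp_all add: pdiff_empty pdiff_insert)
  then show ?thesis by (simp add: mdiff_eq_pdiff)
qed

section \<open>Vilenkin martingales and their transforms\<close>

context vilenkin_system begin

lemma vfiltration_generators: "{rectangle p n l | l. \<forall>d. l d < pprod (p d) (n d)} = rectangle p n ` grid n"
  by (auto simp: grid_def)

lemma rectangles_in_cube: "rectangle p n ` grid n \<subseteq> Pow unit_cube"
  using rectangle_eq by blast

lemma vfiltration_space [simp]: "space (vfiltration p n) = unit_cube"
  unfolding vfiltration_def vfiltration_generators by (rule space_measure_of[OF rectangles_in_cube])

lemma vfiltration_sets: "sets (vfiltration p n) = sigma_sets unit_cube (rectangle p n ` grid n)"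
  unfolding vfiltration_def vfiltration_generators by (rule sets_measure_of[OF rectangles_in_cube])

lemma avg_absorb:
  fixes g :: "real^'d \<Rightarrow> 'b::{banach, second_countable_topology}"
  assumes "step m g"
  shows "avg n (avg m g) = avg n g"
  by (rule avg_cong) (rule avg_step[OF assms])

lemma avg_zero: "(\<And>y. y \<in> unit_cube \<Longrightarrow> g y = 0) \<Longrightarrow> avg n g x = 0"
  using avg_cong[of g "\<lambda>_. 0" n] by (simp add: avg_def)

lemma step_indicator: "step n (\<lambda>x. x \<in> A) \<Longrightarrow> step n (\<lambda>x. indicator A x :: 'b::zero_neq_one)"
  unfolding indicator_def by (rule step_comp[of n "\<lambda>x. x \<in> A" "of_bool"])

text \<open>The generating rectangles form a finite partition of the cube.  So the generated sets are the
unions of cells.\<close>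
lemma vfiltration_sets_iff:
  "A \<in> sets (vfiltration p n) \<longleftrightarrow> A \<subseteq> unit_cube \<and> step n (\<lambda>x. x \<in> A)"
proof
  assume "A \<in> sets (vfiltration p n)"
  then have "A \<in> sigma_sets unit_cube (rectangle p n ` grid n)"
    by (simp only: vfiltration_sets)
  then show "A \<subseteq> unit_cube \<and> step n (\<lambda>x. x \<in> A)"
  proof induction
    case (Basic a)
    then show ?case using rectangle_eq by (auto intro!: stepI)
  next
    case Empty
    then show ?case by (simp add: step_const)
  next
    case (Compl a)
    then show ?case by (auto intro!: stepI dest: stepD)
  next
    case (Union a)
    have "step n (\<lambda>x. \<exists>i. x \<in> a i)" using Union by (intro stepI) (metis stepD)
    then show ?case using Union by auto
  qed
next
  assume A: "A \<subseteq> unit_cube \<and> step n (\<lambda>x. x \<in> A)"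
  have "A = (\<Union>l\<in>{l \<in> grid n. cell_point n l \<in> A}. rectangle p n l)"
  proof (intro equalityI subsetI)
    fix x assume x: "x \<in> A"
    then have c: "x \<in> unit_cube" using A by blast
    have "cell_point n (cell n x) \<in> A"
      using stepD[OF conjunct2[OF A] cell_point(1)[OF cell_in_grid[OF c]] c] cell_point(2)[OF cell_in_grid[OF c]] x by simp
    then show "x \<in> (\<Union>l\<in>{l \<in> grid n. cell_point n l \<in> A}. rectangle p n l)"
      using cell_in_grid[OF c] rectangle_eq[OF cell_in_grid[OF c]] c by auto
  next
    fix x assume "x \<in> (\<Union>l\<in>{l \<in> grid n. cell_point n l \<in> A}. rectangle p n l)"
    then obtain l where l: "l \<in> grid n" "cell_point n l \<in> A" "x \<in> rectangle p n l" by blast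
    then have "x \<in> unit_cube" "cell n x = cell n (cell_point n l)"
      using cell_point[OF l(1)] rectangle_eq[OF l(1)] by auto
    then show "x \<in> A" using stepD[OF conjunct2[OF A] _ cell_point(1)[OF l(1)]] l(2) by simp
  qed
  also have "\<dots> \<in> sets (vfiltration p n)"
  proof (intro sets.finite_UN)
    show "finite {l \<in> grid n. cell_point n l \<in> A}" using finite_grid by simp
    fix l assume "l \<in> {l \<in> grid n. cell_point n l \<in> A}"
    then have "rectangle p n l \<in> rectangle p n ` grid n" by blast
    then show "rectangle p n l \<in> sets (vfiltration p n)"
      unfolding vfiltration_sets by (rule sigma_sets.Basic)
  qed
  finally show "A \<in> sets (vfiltration p n)" .
qed

text \<open>Points are closed in a \<open>t1_space\<close>; hence the level sets of a measurable function are unions of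
cells.\<close>
lemma measurable_vfiltration_iff:
  fixes g :: "real^'d \<Rightarrow> 'b::{t1_space}"
  shows "g \<in> borel_measurable (vfiltration p n) \<longleftrightarrow> step n g"
proof
  assume g: "g \<in> borel_measurable (vfiltration p n)"
  show "step n g"
  proof (rule stepI)
    fix x y :: "real^'d" assume xy: "x \<in> unit_cube" "y \<in> unit_cube" "cell n x = cell n y"
    have "g -` {g x} \<inter> unit_cube \<in> sets (vfiltration p n)"
      using measurable_sets[OF g, of "{g x}"] by simp
    then have "step n (\<lambda>z. z \<in> g -` {g x} \<inter> unit_cube)" by (simp only: vfiltration_sets_iff)
    from stepD[OF this xy] show "g x = g y" using xy by auto
  qed
next
  assume g: "step n g"
  show "g \<in> borel_measurable (vfiltration p n)"
  proof (rule measurableI)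
    fix B :: "'b set"
    show "g -` B \<inter> space (vfiltration p n) \<in> sets (vfiltration p n)"
      unfolding vfiltration_sets_iff vfiltration_space
    proof (intro conjI stepI)
      fix x y :: "real^'d" assume xy: "x \<in> unit_cube" "y \<in> unit_cube" "cell n x = cell n y"
      then show "(x \<in> g -` B \<inter> unit_cube) = (y \<in> g -` B \<inter> unit_cube)"
        using stepD[OF g xy] by simp
    qed simp
  qed simp
qed

lemma sets_vfiltration_subset: "A \<in> sets (vfiltration p n) \<Longrightarrow> A \<in> sets \<mu>"
proof -
  assume A: "A \<in> sets (vfiltration p n)"
  then have "step n (\<lambda>x. indicator A x :: real)"
    unfolding vfiltration_sets_iff by (intro step_indicator) simp
  then have "(\<lambda>x. indicator A x :: real) \<in> borel_measurable \<mu>"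
    using step_integrable by blast
  then have "A \<inter> space \<mu> \<in> sets \<mu>"
    by (simp only: borel_measurable_indicator_iff)
  moreover have "A \<inter> space \<mu> = A" using A by (simp add: vfiltration_sets_iff) blast
  ultimately show ?thesis by simp
qed

lemma finite_subalgebra: "finite_measure_subalgebra \<mu> (vfiltration p n)"
  by standard (auto simp: subalgebra_def intro: sets_vfiltration_subset)

text \<open>By self-adjointness, \<open>h\<close> and \<open>avg n h\<close> have the same integral over each set of the filtration.\<close>
lemma cond_exp_eq_avg:
  fixes h :: "real^'d \<Rightarrow> real"
  assumes "integrable \<mu> h"
  shows "AE x in \<mu>. real_cond_exp \<mu> (vfiltration p n) h x = avg n h x"
proof -
  interpret F: finite_measure_subalgebra \<mu> "vfiltration p n"
    by (rule finite_subalgebra)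
  show ?thesis
  proof (rule F.real_cond_exp_charact)
    fix A assume A: "A \<in> sets (vfiltration p n)"
    then have s: "step n (\<lambda>x. indicator A x :: real)"
      unfolding vfiltration_sets_iff by (intro step_indicator) simp
    have "(LINT x|\<mu>. indicator A x *\<^sub>R avg n h x) = (LINT x|\<mu>. avg n (indicator A) x *\<^sub>R h x)"
      by (rule avg_self_adjoint[OF s assms])
    also have "\<dots> = (LINT x|\<mu>. indicator A x *\<^sub>R h x)"
      by (rule integral_cube_cong) (simp add: avg_step[OF s])
    finally show "(LINT x:A|\<mu>. h x) = (LINT x:A|\<mu>. avg n h x)"
      by (simp add: set_lebesgue_integral_def)
  qed (auto simp: assms measurable_vfiltration_iff step_avg intro: step_integrable[OF step_avg])
qed

text \<open>Every cell has positive measure.\<close>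
lemma AE_atom:
  assumes "x \<in> unit_cube" "AE y in \<mu>. P y"
  obtains y where "y \<in> atom n x" "P y"
proof -
  have "\<exists>y\<in>atom n x. P y"
  proof (rule ccontr)
    assume neg: "\<not> (\<exists>y\<in>atom n x. P y)"
    have "AE y in \<mu>. y \<notin> atom n x" using assms(2) by (rule AE_mp) (use neg in auto)
    then have "emeasure \<mu> (atom n x) = 0"
      using AE_iff_measurable[OF atom_cube(1)[OF assms(1), of n], of "\<lambda>y. y \<notin> atom n x"] by (auto simp: atom_def)
    then show False using atom_cube(3)[OF assms(1), of n] ncells_pos[of n] by simp
  qed
  then show ?thesis using that by blast
qed

lemma step_AE_eq:
  assumes "step n f" "step n g" "AE x in \<mu>. f x = g x" "x \<in> unit_cube"
  shows "f x = g x"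
proof -
  obtain y where "y \<in> atom n x" "f y = g y" using AE_atom[OF assms(4,3)] by blast
  then show ?thesis using step_atomD[OF assms(1,4)] step_atomD[OF assms(2,4)] by metis
qed

lemma complex_cond_exp_eq_avg:
  fixes h :: "real^'d \<Rightarrow> complex"
  assumes h: "integrable \<mu> h"
  shows "AE x in \<mu>. complex_cond_exp \<mu> (vfiltration p n) h x = avg n h x"
proof -
  have RI: "integrable \<mu> (\<lambda>x. Re (h x))" "integrable \<mu> (\<lambda>x. Im (h x))"
    using h by auto
  have *: "Re (avg n h x) = avg n (\<lambda>y. Re (h y)) x" "Im (avg n h x) = avg n (\<lambda>y. Im (h y)) x"
    if "x \<in> unit_cube" for x
  proof -
    have i: "integrable \<mu> (\<lambda>y. indicator (atom n x) y *\<^sub>R h y)" by (rule integrable_atom[OF that h])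
    have "(LINT y|\<mu>. indicator (atom n x) y *\<^sub>R Re (h y)) = Re (LINT y|\<mu>. indicator (atom n x) y *\<^sub>R h y)"
      using integral_Re[OF i] by simp
    then show "Re (avg n h x) = avg n (\<lambda>y. Re (h y)) x" by (simp add: avg_def)
    have "(LINT y|\<mu>. indicator (atom n x) y *\<^sub>R Im (h y)) = Im (LINT y|\<mu>. indicator (atom n x) y *\<^sub>R h y)"
      using integral_Im[OF i] by simp
    then show "Im (avg n h x) = avg n (\<lambda>y. Im (h y)) x" by (simp add: avg_def)
  qed
  show ?thesis
    using cond_exp_eq_avg[OF RI(1), of n] cond_exp_eq_avg[OF RI(2), of n] AE_space
    by eventually_elim (simp add: complex_cond_exp_def complex_eq_iff *)
qed

text \<open>A family of step functions that satisfies the martingale condition almost everywhere satisfies it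
at every point, since two step functions which agree almost everywhere agree on the cube.\<close>
theorem vmartingale_iff:
  "vmartingale p f \<longleftrightarrow> (\<forall>n x. x \<notin> unit_cube \<longrightarrow> f n x = 0) \<and> (\<forall>n. step n (f n)) \<and>
     (\<forall>n m. n \<le> m \<longrightarrow> (\<forall>x\<in>unit_cube. avg n (f m) x = f n x))"
proof
  assume v: "vmartingale p f"
  then have s: "step n (f n)" for n by (simp add: vmartingale_def measurable_vfiltration_iff)
  have "avg n (f m) x = f n x" if "n \<le> m" "x \<in> unit_cube" for n m x
  proof (rule step_AE_eq[OF step_avg s _ that(2)])
    have "AE x in \<mu>. complex_cond_exp \<mu> (vfiltration p n) (f m) x = f n x"
      using v that(1) unfolding vmartingale_def by blast
    then show "AE x in \<mu>. avg n (f m) x = f n x"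
      using complex_cond_exp_eq_avg[OF step_integrable[OF s], of n m] by eventually_elim simp
  qed
  moreover have "f n x = 0" if "x \<notin> unit_cube" for n x using v that by (simp add: vmartingale_def)
  ultimately show "(\<forall>n x. x \<notin> unit_cube \<longrightarrow> f n x = 0) \<and> (\<forall>n. step n (f n)) \<and>
     (\<forall>n m. n \<le> m \<longrightarrow> (\<forall>x\<in>unit_cube. avg n (f m) x = f n x))"
    by (intro conjI allI impI ballI s)
next
  assume r: "(\<forall>n x. x \<notin> unit_cube \<longrightarrow> f n x = 0) \<and> (\<forall>n. step n (f n)) \<and>
     (\<forall>n m. n \<le> m \<longrightarrow> (\<forall>x\<in>unit_cube. avg n (f m) x = f n x))"
  have "AE x in \<mu>. complex_cond_exp \<mu> (vfiltration p n) (f m) x = f n x" if "n \<le> m" for n m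
  proof -
    have "integrable \<mu> (f m)" using r by (intro step_integrable[of m]) simp
    from complex_cond_exp_eq_avg[OF this, of n] AE_space[of \<mu>]
    show ?thesis by eventually_elim (use r that in simp)
  qed
  moreover have "integrable \<mu> (f n)" for n using r step_integrable[of n "f n"] by simp
  ultimately show "vmartingale p f"
    using r by (simp add: vmartingale_def measurable_vfiltration_iff)
qed

lemma vmart_zero: "vmartingale p f \<Longrightarrow> x \<notin> unit_cube \<Longrightarrow> f n x = 0"
  and vmart_step: "vmartingale p f \<Longrightarrow> step n (f n)"
  by (simp_all add: vmartingale_iff)

lemma vmart_avg:
  assumes f: "vmartingale p f" and x: "x \<in> unit_cube"
  shows "avg n (f m) x = f (inf n m) x"
proof -
  have "avg n (f m) x = avg n (avg m (f m)) x"
    by (simp only: avg_absorb[OF vmart_step[OF f]])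
  also have "\<dots> = avg (inf n m) (f m) x"
    by (rule avg_avg[OF step_integrable[OF vmart_step[OF f]] x])
  also have "\<dots> = f (inf n m) x" using f x by (simp add: vmartingale_iff)
  finally show ?thesis .
qed

lemma vmart_diff:
  assumes f: "vmartingale p f" and g: "vmartingale p g"
  shows "vmartingale p (\<lambda>n x. f n x - g n x)"
  unfolding vmartingale_iff
proof (intro conjI allI impI ballI)
  fix n :: "'d \<Rightarrow> nat" and x :: "real^'d"
  show "x \<notin> unit_cube \<Longrightarrow> f n x - g n x = 0" using vmart_zero[OF f] vmart_zero[OF g] by simp
  show "step n (\<lambda>x. f n x - g n x)"
    by (rule step_comp2[of _ _ _ "(-)"]) (rule vmart_step[OF f] vmart_step[OF g])+
next
  fix n m :: "'d \<Rightarrow> nat" and x :: "real^'d" assume nm: "n \<le> m" and x: "x \<in> unit_cube"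
  then show "avg n (\<lambda>x. f m x - g m x) x = f n x - g n x"
    using avg_diff[OF x step_integrable[OF vmart_step[OF f]] step_integrable[OF vmart_step[OF g]]]
      vmart_avg[OF f x, of n m] vmart_avg[OF g x, of n m] by (simp add: inf_absorb1)
qed

lemma mdiff_zero:
  assumes f: "vmartingale p f" and x: "x \<notin> unit_cube"
  shows "mdiff f n x = 0"
proof -
  have "f k x = 0" for k by (rule vmart_zero[OF f x])
  then show ?thesis unfolding mdiff_def by (intro sum.neutral ballI) simp
qed

lemma shift_step:
  assumes f: "vmartingale p f"
  shows "step n (shift f n \<epsilon>)"
proof -
  have "step n (f (\<lambda>d. n d - \<epsilon> d))" by (rule step_mono[OF vmart_step[OF f]]) (simp add: le_fun_def)
  then show ?thesis by (cases "\<exists>d. n d < \<epsilon> d") (simp_all add: shift_def step_const)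
qed

lemma pdiff_step:
  assumes f: "vmartingale p f"
  shows "step n (pdiff S f n)"
proof -
  have "step n (\<lambda>x. \<Sum>\<epsilon>\<in>bits S. bsign \<epsilon> * shift f n \<epsilon> x)"
    by (intro step_sum step_comp[OF shift_step[OF f], where F = "(*) (bsign _)"])
  then show ?thesis by (simp only: pdiff_def[abs_def])
qed

lemma mdiff_step: "vmartingale p f \<Longrightarrow> step n (mdiff f n)"
  using pdiff_step[of f n UNIV] by (simp only: mdiff_eq_pdiff[abs_def])

text \<open>Averaging at \<open>N(d := j)\<close> touches only the coordinate \<open>d\<close>, in which no difference is taken: it merely
lowers the index in this coordinate to \<open>j\<close>.\<close>
lemma avg_pdiff:
  assumes f: "vmartingale p f" and x: "x \<in> unit_cube" and d: "d \<notin> S"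
    and n: "n \<le> N" "n d = N d" and j: "j \<le> N d"
  shows "avg (N(d := j)) (pdiff S f n) x = pdiff S f (n(d := j)) x"
proof -
  have "avg (N(d := j)) (pdiff S f n) x = (\<Sum>\<epsilon>\<in>bits S. avg (N(d := j)) (\<lambda>y. bsign \<epsilon> * shift f n \<epsilon> y) x)"
    unfolding pdiff_def[abs_def]
    by (rule avg_sum[OF x integrable_mult_right[OF step_integrable[OF shift_step[OF f]]]])
  also have "\<dots> = (\<Sum>\<epsilon>\<in>bits S. bsign \<epsilon> * shift f (n(d := j)) \<epsilon> x)"
  proof (intro sum.cong refl)
    fix \<epsilon> assume "\<epsilon> \<in> bits S"
    then have e: "\<epsilon> d = 0" by (rule bits_0[OF _ d])
    have lt: "n i < \<epsilon> i \<longleftrightarrow> (n(d := j)) i < \<epsilon> i" for i using e by (cases "i = d") auto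
    have "inf (N(d := j)) (\<lambda>i. n i - \<epsilon> i) = (\<lambda>i. (n(d := j)) i - \<epsilon> i)"
    proof
      fix i
      have "n i \<le> N i" using n(1) by (simp add: le_fun_def)
      then show "inf (N(d := j)) (\<lambda>i. n i - \<epsilon> i) i = (n(d := j)) i - \<epsilon> i"
        using e j n(2) by (cases "i = d") (simp_all add: inf_min)
    qed
    then have "avg (N(d := j)) (shift f n \<epsilon>) x = shift f (n(d := j)) \<epsilon> x"
      unfolding shift_def lt using vmart_avg[OF f x, of "N(d := j)" "\<lambda>i. n i - \<epsilon> i"]
      by (simp add: avg_zero)
    then show "avg (N(d := j)) (\<lambda>y. bsign \<epsilon> * shift f n \<epsilon> y) x = bsign \<epsilon> * shift f (n(d := j)) \<epsilon> x"
      by (simp only: avg_mult_left)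
  qed
  finally show ?thesis by (simp only: pdiff_def)
qed

text \<open>A difference in the coordinate \<open>d\<close> is annihilated by averaging one generation coarser in \<open>d\<close>.\<close>
lemma avg_mdiff_eq_0:
  assumes f: "vmartingale p f" and x: "x \<in> unit_cube" and d: "n d \<ge> 1"
  shows "avg (n(d := n d - 1)) (mdiff f n) x = 0"
proof -
  let ?k = "n(d := n d - 1)" and ?S = "UNIV - {d}"
  have i: "integrable \<mu> (pdiff ?S f m)" for m by (rule step_integrable[OF pdiff_step[OF f]])
  have "insert d ?S = UNIV" by blast
  then have "mdiff f n = (\<lambda>x. pdiff ?S f n x - pdiff ?S f ?k x)"
    using pdiff_insert[of d ?S f n] d by (auto simp: mdiff_eq_pdiff)
  then have "avg ?k (mdiff f n) x = avg ?k (pdiff ?S f n) x - avg ?k (pdiff ?S f ?k) x"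
    by (simp only: avg_diff[OF x i i])
  also have "avg ?k (pdiff ?S f n) x = pdiff ?S f ?k x" by (rule avg_pdiff[OF f x]) simp_all
  also have "avg ?k (pdiff ?S f ?k) x = pdiff ?S f ?k x" by (rule avg_step[OF pdiff_step[OF f] x])
  finally show ?thesis by (simp only: diff_self)
qed

text \<open>Martingale transforms are defined by their differences, so that \<open>mdiff_transform\<close> holds for all
coefficients.  Predictability of the coefficients makes the transform a martingale again and keeps
its differences orthogonal.\<close>
definition transform :: "(('d \<Rightarrow> nat) \<Rightarrow> real^'d \<Rightarrow> complex) \<Rightarrow> 'd family \<Rightarrow> 'd family" where
  "transform a f n x = (\<Sum>m | m \<le> n. a m x * mdiff f m x)"

lemma mdiff_transform: "mdiff (transform a f) n x = a n x * mdiff f n x"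
  unfolding transform_def[abs_def] by (rule mdiff_partial_sums)

definition predictable :: "(('d \<Rightarrow> nat) \<Rightarrow> real^'d \<Rightarrow> 'b) \<Rightarrow> bool" where
  "predictable a \<longleftrightarrow> (\<forall>n. step (pred_index n) (a n))"

lemma transform_term_step:
  assumes f: "vmartingale p f" and a: "predictable a"
  shows "step n (\<lambda>x. a n x * mdiff f n x)"
proof -
  have "step (pred_index n) (a n)" using a by (simp add: predictable_def)
  then have "step n (a n)" by (rule step_mono) (simp add: pred_index_def le_fun_def)
  then show ?thesis by (rule step_comp2[of n "a n" "mdiff f n" "(*)"]) (rule mdiff_step[OF f])
qed

text \<open>For \<open>n d < m d\<close> the average at \<open>n\<close> factors through the average at \<open>m(d := m d - 1)\<close>.  The coefficient
\<open>a m\<close> may be pulled out of the latter, which annihilates \<open>mdiff f m\<close>.\<close>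
lemma avg_transform_term:
  assumes f: "vmartingale p f" and a: "predictable a" and x: "x \<in> unit_cube" and n: "\<not> m \<le> n"
  shows "avg n (\<lambda>y. a m y * mdiff f m y) x = 0"
proof -
  obtain d where d: "n d < m d" using n by (auto simp: le_fun_def not_le)
  let ?k = "m(d := m d - 1)" and ?h = "\<lambda>y. a m y * mdiff f m y"
  have h: "step m ?h" by (rule transform_term_step[OF f a])
  have ih: "integrable \<mu> ?h" by (rule step_integrable[OF h])
  have z: "avg ?k ?h y = 0" if y: "y \<in> unit_cube" for y
  proof -
    have "step (pred_index m) (a m)" using a by (simp add: predictable_def)
    then have "step ?k (a m)" by (rule step_mono) (simp add: pred_index_def le_fun_def)
    then have "avg ?k ?h y = a m y * avg ?k (mdiff f m) y" by (rule avg_pull_out[OF _ y])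
    then show ?thesis using avg_mdiff_eq_0[OF f y] d by simp
  qed
  have "avg n ?h x = avg n (avg m ?h) x"
    by (simp only: avg_absorb[OF h])
  also have "\<dots> = avg (inf n m) ?h x" by (rule avg_avg[OF ih x])
  also have "inf n m = inf (inf n m) ?k" using d by (auto simp: fun_eq_iff inf_min)
  also have "avg \<dots> ?h x = avg (inf n m) (avg ?k ?h) x" by (rule avg_avg[OF ih x, symmetric])
  also have "\<dots> = 0" by (rule avg_zero) (rule z)
  finally show ?thesis .
qed

lemma vmart_transform:
  assumes f: "vmartingale p f" and a: "predictable a"
  shows "vmartingale p (transform a f)"
  unfolding vmartingale_iff
proof (intro conjI allI impI ballI)
  fix n :: "'d \<Rightarrow> nat" and x :: "real^'d"
  show "x \<notin> unit_cube \<Longrightarrow> transform a f n x = 0" by (simp add: transform_def mdiff_zero[OF f])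
  show "step n (transform a f n)"
    unfolding transform_def[abs_def] by (intro step_sum step_mono[OF transform_term_step[OF f a]]) simp
next
  fix n m :: "'d \<Rightarrow> nat" and x :: "real^'d" assume nm: "n \<le> m" and x: "x \<in> unit_cube"
  have "avg n (transform a f m) x = (\<Sum>k | k \<le> m. avg n (\<lambda>y. a k y * mdiff f k y) x)"
    unfolding transform_def[abs_def] by (rule avg_sum[OF x step_integrable[OF transform_term_step[OF f a]]])
  also have "\<dots> = (\<Sum>k | k \<le> n. a k x * mdiff f k x)"
  proof (rule sum.mono_neutral_cong_right)
    show "{k. k \<le> n} \<subseteq> {k. k \<le> m}" using nm by auto
    show "\<forall>i\<in>{k. k \<le> m} - {k. k \<le> n}. avg n (\<lambda>y. a i y * mdiff f i y) x = 0"
      using avg_transform_term[OF f a x] by simp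
    show "\<And>k. k \<in> {k. k \<le> n} \<Longrightarrow> avg n (\<lambda>y. a k y * mdiff f k y) x = a k x * mdiff f k x"
      using avg_step[OF step_mono[OF transform_term_step[OF f a]] x] by simp
  qed simp
  finally show "avg n (transform a f m) x = transform a f n x" by (simp add: transform_def)
qed

lemma integral_step_mult_avg:
  fixes u g :: "real^'d \<Rightarrow> 'b::{banach, second_countable_topology, real_normed_field}"
  assumes u: "step n u" and ug: "integrable \<mu> (\<lambda>x. u x * g x)"
  shows "(LINT x|\<mu>. u x * avg n g x) = (LINT x|\<mu>. u x * g x)"
proof -
  have "(LINT x|\<mu>. u x * avg n g x) = (LINT x|\<mu>. avg n (\<lambda>y. u y * g y) x)"
    by (rule integral_cube_cong) (simp add: avg_pull_out[OF u])
  also have "\<dots> = (LINT x|\<mu>. u x * g x)" by (rule integral_avg[OF ug])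
  finally show ?thesis .
qed

text \<open>Of two different indices one is not below the other; averaging at the other one annihilates its
term.\<close>
lemma transform_orthogonal:
  assumes f: "vmartingale p f" and a: "predictable a" and mk: "m \<noteq> k"
  shows "(LINT x|\<mu>. cnj (a m x * mdiff f m x) * (a k x * mdiff f k x)) = 0"
proof -
  have main: "(LINT x|\<mu>. cnj (a m x * mdiff f m x) * (a k x * mdiff f k x)) = 0" if "\<not> k \<le> m" for m k
  proof -
    let ?h = "\<lambda>x. a k x * mdiff f k x" and ?u = "\<lambda>x. cnj (a m x * mdiff f m x)"
    have u: "step m ?u" by (rule step_comp[OF transform_term_step[OF f a], where F = cnj])
    have h: "step k ?h" by (rule transform_term_step[OF f a])
    have "step (sup m k) (\<lambda>x. ?u x * ?h x)"
      by (rule step_comp2[of _ ?u ?h "(*)"]) (rule step_mono[OF u] step_mono[OF h], simp)+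
    then have "(LINT x|\<mu>. ?u x * ?h x) = (LINT x|\<mu>. ?u x * avg m ?h x)"
      by (intro integral_step_mult_avg[OF u, symmetric] step_integrable)
    also have "\<dots> = 0"
    proof (rule integral_eq_zero_AE, rule AE_I2)
      fix x :: "real^'d" assume "x \<in> space \<mu>"
      then have "x \<in> unit_cube" by simp
      from avg_transform_term[OF f a this that] show "?u x * avg m ?h x = 0" by simp
    qed
    finally show ?thesis .
  qed
  show ?thesis
  proof (cases "k \<le> m")
    case False then show ?thesis by (rule main)
  next
    case True
    then have "\<not> m \<le> k" using mk by (simp add: order_antisym_conv)
    from main[OF this] have "cnj (LINT x|\<mu>. cnj (a k x * mdiff f k x) * (a m x * mdiff f m x)) = 0" by simp
    then show ?thesis by (simp add: mult_ac flip: Bochner_Integration.integral_cnj)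
  qed
qed

lemma transform_L2:
  assumes f: "vmartingale p f" and a: "predictable a"
  shows "(LINT x|\<mu>. (norm (transform a f n x))\<^sup>2) = (\<Sum>m | m \<le> n. LINT x|\<mu>. (norm (a m x * mdiff f m x))\<^sup>2)"
proof -
  let ?h = "\<lambda>m x. a m x * mdiff f m x"
  have st: "step n (?h m)" if "m \<le> n" for m by (rule step_mono[OF transform_term_step[OF f a] that])
  have i: "integrable \<mu> (\<lambda>x. cnj (?h m x) * ?h k x)" if "m \<le> n" "k \<le> n" for m k
    by (rule step_integrable[OF step_comp2[OF st[OF that(1)] st[OF that(2)], of "\<lambda>u v. cnj u * v"]])
  have orth: "(LINT x|\<mu>. cnj (?h m x) * ?h k x) = (if k = m then LINT x|\<mu>. cnj (?h m x) * ?h m x else 0)" for m k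
  proof (cases "k = m")
    case False
    then have "m \<noteq> k" by simp
    from transform_orthogonal[OF f a this] show ?thesis using False by (simp only: if_False)
  qed simp
  have sq: "complex_of_real ((norm z)\<^sup>2) = cnj z * z" for z by (subst mult.commute) (rule complex_norm_square)
  have "complex_of_real (LINT x|\<mu>. (norm (transform a f n x))\<^sup>2)
      = (LINT x|\<mu>. cnj (transform a f n x) * transform a f n x)"
    by (simp only: sq flip: integral_complex_of_real)
  also have "\<dots> = (LINT x|\<mu>. (\<Sum>m | m \<le> n. \<Sum>k | k \<le> n. cnj (?h m x) * ?h k x))"
    by (simp only: transform_def cnj_sum sum_product)
  also have "\<dots> = (\<Sum>m | m \<le> n. \<Sum>k | k \<le> n. LINT x|\<mu>. cnj (?h m x) * ?h k x)"
    by (subst Bochner_Integration.integral_sum, use i in force, intro sum.cong refl Bochner_Integration.integral_sum i) auto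
  also have "\<dots> = (\<Sum>m | m \<le> n. \<Sum>k | k \<le> n. if k = m then LINT x|\<mu>. cnj (?h m x) * ?h m x else 0)"
    by (intro sum.cong refl orth)
  also have "\<dots> = (\<Sum>m | m \<le> n. LINT x|\<mu>. cnj (?h m x) * ?h m x)"
    by (intro sum.cong refl) simp
  also have "\<dots> = complex_of_real (\<Sum>m | m \<le> n. LINT x|\<mu>. (norm (?h m x))\<^sup>2)"
    by (simp only: of_real_sum sq flip: integral_complex_of_real)
  finally show ?thesis by (simp only: of_real_eq_iff)
qed

end

section \<open>The strong maximal inequality\<close>

primrec runmax :: "(nat \<Rightarrow> real) \<Rightarrow> nat \<Rightarrow> real" where
  "runmax x 0 = x 0"
| "runmax x (Suc n) = max (runmax x n) (x (Suc n))"

lemma runmax_ge: "j \<le> n \<Longrightarrow> x j \<le> runmax x n"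
  by (induction n) (auto simp: le_Suc_eq max_def intro: order_trans)

lemma runmax_nonneg: "0 \<le> x 0 \<Longrightarrow> 0 \<le> runmax x n"
  using runmax_ge[of 0 n x] by simp

text \<open>Young's inequality with exponents \<open>r / (r - 1)\<close> and \<open>r\<close>.  The weight \<open>c\<close> allows the first term to be
absorbed.\<close>
lemma young_powr:
  fixes s y r :: real
  assumes r: "1 < r" and s: "0 \<le> s" and y: "0 \<le> y" and c: "0 < c"
  shows "s powr (r - 1) * y \<le> (r - 1) / r * (c * s powr r) + c powr (1 - r) / r * y powr r"
proof (cases "s = 0 \<or> y = 0")
  case True
  then have "s powr (r - 1) * y = 0" by auto
  moreover have "0 \<le> (r - 1) / r * (c * s powr r) + c powr (1 - r) / r * y powr r"
    using r c by (intro add_nonneg_nonneg mult_nonneg_nonneg) auto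
  ultimately show ?thesis by (simp only:)
next
  case False
  then have pos: "0 < s" "0 < y" using s y by auto
  have r1: "r * ((r - 1) / r) = r - 1" and r2: "r * (1 / r) = 1" using r by auto
  have e: "(c * s powr r) powr ((r - 1) / r) = c powr ((r - 1) / r) * s powr (r - 1)"
    using c by (simp only: powr_mult powr_powr r1)
  have e': "(c powr (1 - r) * y powr r) powr (1 / r) = c powr ((1 - r) * (1 / r)) * y"
  proof -
    have "(c powr (1 - r) * y powr r) powr (1 / r) = c powr ((1 - r) * (1 / r)) * y powr (r * (1 / r))"
      by (simp only: powr_mult powr_powr)
    then show ?thesis using pos unfolding r2 by simp
  qed
  have "(c * s powr r) powr ((r - 1) / r) * (c powr (1 - r) * y powr r) powr (1 / r)
      \<le> (r - 1) / r * (c * s powr r) + 1 / r * (c powr (1 - r) * y powr r)"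
    by (rule Youngs_inequality_0) (use r c pos in \<open>auto simp: diff_divide_distrib\<close>)
  moreover have "(r - 1) / r + (1 - r) * (1 / r) = 0" by (simp add: diff_divide_distrib)
  then have "c powr ((r - 1) / r) * c powr ((1 - r) * (1 / r)) = 1"
    using c by (simp only: powr_add[symmetric]) simp
  then have "c powr ((r - 1) / r) * s powr (r - 1) * (c powr ((1 - r) * (1 / r)) * y) = s powr (r - 1) * y"
  proof -
    have "c powr ((r - 1) / r) * s powr (r - 1) * (c powr ((1 - r) * (1 / r)) * y)
      = (c powr ((r - 1) / r) * c powr ((1 - r) * (1 / r))) * (s powr (r - 1) * y)"
      by (simp only: mult_ac)
    then show ?thesis using \<open>c powr ((r - 1) / r) * c powr ((1 - r) * (1 / r)) = 1\<close> by (simp only: mult_1)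
  qed
  ultimately have "s powr (r - 1) * y \<le> (r - 1) / r * (c * s powr r) + 1 / r * (c powr (1 - r) * y powr r)"
    by (simp only: e e')
  moreover have "1 / r * (c powr (1 - r) * y powr r) = c powr (1 - r) / r * y powr r" by simp
  ultimately show ?thesis by (simp only:)
qed

text \<open>The pathwise form of Doob's maximal inequality: summation by parts, together with the fact that
the running maximum increases only at times at which it coincides with the path.  For a martingale
the left-hand side has mean zero.\<close>
lemma doob_pathwise:
  fixes x :: "nat \<Rightarrow> real"
  assumes r: "1 < r" and x: "\<And>k. 0 \<le> x k"
  shows "(\<Sum>k<n. runmax x k powr (r - 1) * (x (Suc k) - x k))
     \<le> runmax x n powr (r - 1) * x n - (r - 1) / r * runmax x n powr r"
proof (induction n)
  case 0
  have "x 0 powr (r - 1) * x 0 = x 0 powr r"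
    using x[of 0] r powr_mult_base[of "x 0" "r - 1"] by (simp add: mult.commute)
  moreover have "(r - 1) / r * x 0 powr r \<le> x 0 powr r"
    using r by (intro mult_left_le_one_le) (auto simp: field_simps)
  ultimately show ?case by simp
next
  case (Suc n)
  let ?s = "runmax x n" and ?y = "x (Suc n)"
  have s: "0 \<le> ?s" by (rule runmax_nonneg) (rule x)
  have "(\<Sum>k<Suc n. runmax x k powr (r - 1) * (x (Suc k) - x k))
      \<le> ?s powr (r - 1) * ?y - (r - 1) / r * ?s powr r"
    using Suc by (simp add: algebra_simps)
  also have "\<dots> \<le> max ?s ?y powr (r - 1) * ?y - (r - 1) / r * max ?s ?y powr r"
  proof (cases "?y \<le> ?s")
    case False
    have "?s powr (r - 1) * ?y \<le> (r - 1) / r * ?s powr r + 1 / r * ?y powr r"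
      using young_powr[OF r s x, of 1 "Suc n"] by simp
    moreover have "?y powr (r - 1) * ?y = ?y powr r"
      using x[of "Suc n"] r powr_mult_base[of "?y" "r - 1"] by (simp add: mult.commute)
    moreover have "?y powr r - (r - 1) / r * ?y powr r = 1 / r * ?y powr r"
      using r by (simp add: field_simps)
    ultimately show ?thesis using False by (simp add: max_def)
  qed (simp add: max_def)
  finally show ?case by simp
qed

text \<open>The value at \<open>r = 2\<close> is the classical constant \<open>4\<close>.\<close>
definition doob_const :: "real \<Rightarrow> real" where "doob_const r = 2 powr r / (r - 1)"

lemma doob_const_nonneg: "1 < r \<Longrightarrow> 0 \<le> doob_const r" by (simp add: doob_const_def)

context vilenkin_system begin

lemma step_runmax:
  assumes "\<And>j. j \<le> k \<Longrightarrow> step n (x j)"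
  shows "step n (\<lambda>y. runmax (\<lambda>j. x j y) k)"
  using assms
proof (induction k)
  case 0 then show ?case by simp
next
  case (Suc k)
  have "step n (\<lambda>y. runmax (\<lambda>j. x j y) k)" using Suc by simp
  from step_comp2[OF this Suc.prems[OF order_refl], of max] show ?case by simp
qed

text \<open>For a chain of indices the averages of \<open>g\<close> form a martingale in one parameter.  Integration of the
pathwise inequality leaves \<open>(r - 1) / r * \<integral>s^r \<le> \<integral>s^(r - 1) * g\<close> for the maximal function \<open>s\<close>, and
Young's inequality with weight \<open>1 / 2\<close> absorbs half of the left-hand side.\<close>
lemma doob:
  assumes r: "1 < r" and \<kappa>: "\<And>j. \<kappa> j \<le> \<kappa> (Suc j)"
    and g: "step (\<kappa> J) g" "\<And>y. y \<in> unit_cube \<Longrightarrow> 0 \<le> (g y :: real)"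
  shows "(LINT y|\<mu>. runmax (\<lambda>j. avg (\<kappa> j) g y) J powr r)
     \<le> doob_const r * (LINT y|\<mu>. g y powr r)"
proof -
  define x where "x = (\<lambda>j y. avg (\<kappa> j) g y)"
  define s where "s = (\<lambda>k y. runmax (\<lambda>j. x j y) k)"
  have mono: "\<kappa> i \<le> \<kappa> j" if "i \<le> j" for i j using \<kappa> that by (rule lift_Suc_mono_le)
  have x0: "0 \<le> x j y" for j y unfolding x_def by (rule avg_nonneg) (rule g(2))
  have stx: "step (\<kappa> k) (x j)" if "j \<le> k" for j k
    unfolding x_def by (rule step_mono[OF step_avg mono[OF that]])
  have sts: "step (\<kappa> k) (s k)" for k unfolding s_def by (rule step_runmax) (rule stx)
  have s0: "0 \<le> s k y" for k y unfolding s_def by (rule runmax_nonneg) (rule x0)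
  define u where "u = (\<lambda>k y. s k y powr (r - 1))"
  have stu: "step (\<kappa> k) (u k)" for k unfolding u_def by (rule step_comp[OF sts])
  have iu: "integrable \<mu> (\<lambda>y. u k y * x j y)" for k j
  proof -
    have "step (\<kappa> (max j k)) (\<lambda>y. u k y * x j y)"
      by (rule step_comp2[where F = "(*)"]) (rule step_mono[OF stu mono] stx; simp)+
    then show ?thesis by (rule step_integrable)
  qed
  have iug: "integrable \<mu> (\<lambda>y. u k y * g y)" if "k \<le> J" for k
  proof -
    have "step (\<kappa> J) (\<lambda>y. u k y * g y)"
      by (rule step_comp2[where F = "(*)"]) (rule step_mono[OF stu mono[OF that]] g(1))+
    then show ?thesis by (rule step_integrable)
  qed
  have zero: "(LINT y|\<mu>. u k y * (x (Suc k) y - x k y)) = 0" if k: "k < J" for k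
  proof -
    have "(LINT y|\<mu>. u k y * x (Suc k) y) = (LINT y|\<mu>. u k y * g y)"
      unfolding x_def using k
      by (intro integral_step_mult_avg step_mono[OF stu mono] iug) auto
    moreover have "(LINT y|\<mu>. u k y * x k y) = (LINT y|\<mu>. u k y * g y)"
      unfolding x_def using k by (intro integral_step_mult_avg stu iug) auto
    ultimately show ?thesis using iu[of k "Suc k"] iu[of k k] by (simp add: right_diff_distrib)
  qed
  have isr: "integrable \<mu> (\<lambda>y. s J y powr r)"
    by (rule step_integrable[OF step_comp[OF sts]])
  have igr: "integrable \<mu> (\<lambda>y. g y powr r)"
    by (rule step_integrable[OF step_comp[OF g(1)]])
  have id: "integrable \<mu> (\<lambda>y. u k y * (x (Suc k) y - x k y))" for k
    using iu[of k "Suc k"] iu[of k k] by (simp add: right_diff_distrib)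
  have "0 = (\<Sum>k<J. LINT y|\<mu>. u k y * (x (Suc k) y - x k y))" using zero by simp
  also have "\<dots> = (LINT y|\<mu>. (\<Sum>k<J. u k y * (x (Suc k) y - x k y)))"
    by (rule Bochner_Integration.integral_sum[symmetric]) (rule id)
  also have "\<dots> \<le> (LINT y|\<mu>. 2 powr (r - 1) / r * g y powr r - (r - 1) / (2 * r) * s J y powr r)"
  proof (rule integral_cube_mono)
    fix y :: "real^'d" assume y: "y \<in> unit_cube"
    have xJ: "x J y = g y" unfolding x_def by (rule avg_step[OF g(1) y])
    have "(\<Sum>k<J. u k y * (x (Suc k) y - x k y)) \<le> s J y powr (r - 1) * g y - (r - 1) / r * s J y powr r"
      using doob_pathwise[OF r, of "\<lambda>j. x j y" J] x0 by (simp add: u_def s_def xJ)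
    \<comment> \<open>the weight \<open>1 / 2\<close> lets the left-hand side absorb half of the maximal function\<close>
    also have "s J y powr (r - 1) * g y \<le> (r - 1) / r * (1 / 2 * s J y powr r) + (1 / 2) powr (1 - r) / r * g y powr r"
      by (rule young_powr[OF r s0 g(2)[OF y]]) simp
    also have "(1 / 2 :: real) powr (1 - r) = 2 powr (r - 1)" by (simp add: powr_divide powr_diff field_simps)
    finally show "(\<Sum>k<J. u k y * (x (Suc k) y - x k y)) \<le> 2 powr (r - 1) / r * g y powr r - (r - 1) / (2 * r) * s J y powr r"
      by (simp add: field_simps)
  qed (intro Bochner_Integration.integrable_sum Bochner_Integration.integrable_diff integrable_mult_right id isr igr)+
  also have "\<dots> = 2 powr (r - 1) / r * (LINT y|\<mu>. g y powr r) - (r - 1) / (2 * r) * (LINT y|\<mu>. s J y powr r)"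
    using isr igr by simp
  finally have "(r - 1) / (2 * r) * (LINT y|\<mu>. s J y powr r) \<le> 2 powr (r - 1) / r * (LINT y|\<mu>. g y powr r)"
    by simp
  then have "(2 * r / (r - 1)) * ((r - 1) / (2 * r) * (LINT y|\<mu>. s J y powr r))
      \<le> (2 * r / (r - 1)) * (2 powr (r - 1) / r * (LINT y|\<mu>. g y powr r))"
    using r by (intro mult_left_mono) auto
  then have "(LINT y|\<mu>. s J y powr r) \<le> 2 * 2 powr (r - 1) / (r - 1) * (LINT y|\<mu>. g y powr r)"
    using r by simp
  also have "2 * 2 powr (r - 1) = 2 powr r" using powr_mult_base[of 2 "r - 1"] by simp
  finally show ?thesis by (simp add: doob_const_def s_def x_def)
qed

text \<open>The indices below \<open>N\<close> that differ from \<open>N\<close> in the coordinates of \<open>S\<close> only.  The inductions over the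
coordinates start from \<open>below {} N = {N}\<close> and end with \<open>below UNIV N = {n. n \<le> N}\<close>.\<close>
definition below :: "'d set \<Rightarrow> ('d \<Rightarrow> nat) \<Rightarrow> ('d \<Rightarrow> nat) set" where
  "below S N = {n. n \<le> N \<and> (\<forall>d. d \<notin> S \<longrightarrow> n d = N d)}"

lemma finite_below: "finite (below S N)"
  by (rule finite_subset[OF _ finite_le_multi[of N]]) (auto simp: below_def)

lemma below_self: "N \<in> below S N"
  by (simp add: below_def)

lemma below_empty: "below {} N = {N}"
  by (auto simp: below_def)

lemma below_UNIV: "below UNIV N = {n. n \<le> N}"
  by (auto simp: below_def)

lemma below_insert:
  assumes "d \<notin> S"
  shows "below (insert d S) N = (\<lambda>(j, n). n(d := j)) ` ({..N d} \<times> below S N)"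
    and "inj_on (\<lambda>(j, n). n(d := j)) ({..N d} \<times> below S N)"
proof -
  show "below (insert d S) N = (\<lambda>(j, n). n(d := j)) ` ({..N d} \<times> below S N)"
  proof (intro equalityI subsetI)
    fix n assume n: "n \<in> below (insert d S) N"
    then have "n d \<le> N d" "n(d := N d) \<in> below S N"
      by (auto simp: below_def le_fun_def)
    moreover have "n = (\<lambda>(j, n). n(d := j)) (n d, n(d := N d))" by simp
    ultimately show "n \<in> (\<lambda>(j, n). n(d := j)) ` ({..N d} \<times> below S N)" by blast
  next
    fix n assume "n \<in> (\<lambda>(j, n). n(d := j)) ` ({..N d} \<times> below S N)"
    then obtain j m where "j \<le> N d" "m \<in> below S N" "n = m(d := j)" by auto
    then show "n \<in> below (insert d S) N" by (auto simp: below_def le_fun_def)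
  qed
  have top: "n d = N d" if "n \<in> below S N" for n using that assms by (simp add: below_def)
  show "inj_on (\<lambda>(j, n). n(d := j)) ({..N d} \<times> below S N)"
  proof (rule inj_onI, clarsimp)
    fix i j :: nat and m n :: "'d \<Rightarrow> nat"
    assume mn: "m \<in> below S N" "n \<in> below S N" and eq: "m(d := i) = n(d := j)"
    have "i = j" using fun_cong[OF eq, of d] by simp
    moreover have "m k = n k" for k
      using fun_cong[OF eq, of k] top[OF mn(1)] top[OF mn(2)] by (cases "k = d") simp_all
    ultimately show "i = j \<and> m = n" by blast
  qed
qed

lemma avg_chain:
  fixes g :: "real^'d \<Rightarrow> 'b::{banach, second_countable_topology}"
  assumes g: "integrable \<mu> g" and x: "x \<in> unit_cube"
    and n: "n \<le> N" "n d = N d" and j: "j \<le> N d"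
  shows "avg (N(d := j)) (avg n g) x = avg (n(d := j)) g x"
proof -
  have "inf (N(d := j)) n = n(d := j)"
    using n j by (auto simp: fun_eq_iff le_fun_def inf_min)
  then show ?thesis using avg_avg[OF g x, of "N(d := j)" n] by simp
qed

definition max_avg :: "'d set \<Rightarrow> ('d \<Rightarrow> nat) \<Rightarrow> (real^'d \<Rightarrow> real) \<Rightarrow> real^'d \<Rightarrow> real" where
  "max_avg S N g x = Max ((\<lambda>n. avg n g x) ` below S N)"

lemma max_avg_ge: "n \<in> below S N \<Longrightarrow> avg n g x \<le> max_avg S N g x"
  unfolding max_avg_def using finite_below by (intro Max_ge) auto

lemma step_max_avg: "step N (max_avg S N g)"
proof (rule stepI)
  fix x y :: "real^'d" assume xy: "x \<in> unit_cube" "y \<in> unit_cube" "cell N x = cell N y"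
  have "avg n g x = avg n g y" if "n \<in> below S N" for n
    using stepD[OF step_mono[OF step_avg, of n N g] xy] that by (simp add: below_def)
  then show "max_avg S N g x = max_avg S N g y" unfolding max_avg_def
    by (intro arg_cong[of _ _ Max] image_cong refl) simp
qed

text \<open>The maximal function over the coordinates of \<open>insert d S\<close> is bounded by the one-parameter maximal
function in the coordinate \<open>d\<close> of the maximal function over \<open>S\<close>; each coordinate costs one
application of Doob's inequality.\<close>
lemma strong_maximal:
  assumes r: "1 < r" and g: "step N g" "\<And>y. y \<in> unit_cube \<Longrightarrow> 0 \<le> g y" and S: "finite S"
  shows "(LINT y|\<mu>. max_avg S N g y powr r) \<le> doob_const r ^ card S * (LINT y|\<mu>. g y powr r)"
  using S
proof induction
  case empty
  have "(LINT y|\<mu>. max_avg {} N g y powr r) = (LINT y|\<mu>. g y powr r)"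
    by (rule integral_cube_cong) (simp_all add: max_avg_def below_empty avg_step[OF g(1)])
  then show ?case by simp
next
  case (insert d S)
  let ?M = "max_avg S N g" and ?\<kappa> = "\<lambda>j. N(d := j)"
  have M0: "0 \<le> ?M y" for y
    using order_trans[OF avg_nonneg[OF g(2)] max_avg_ge[OF below_self]] by simp
  have ig: "integrable \<mu> g" by (rule step_integrable[OF g(1)])
  have le: "max_avg (insert d S) N g y \<le> runmax (\<lambda>j. avg (?\<kappa> j) ?M y) (N d)" if y: "y \<in> unit_cube" for y
    unfolding max_avg_def[of "insert d S"]
  proof (rule Max.boundedI)
    show "finite ((\<lambda>n. avg n g y) ` below (insert d S) N)" using finite_below by blast
    show "(\<lambda>n. avg n g y) ` below (insert d S) N \<noteq> {}" using below_self by blast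
    fix a assume "a \<in> (\<lambda>n. avg n g y) ` below (insert d S) N"
    then obtain j n where j: "j \<le> N d" and n: "n \<in> below S N" and a: "a = avg (n(d := j)) g y"
      unfolding below_insert(1)[OF insert.hyps(2)] by auto
    have "a = avg (?\<kappa> j) (avg n g) y"
      unfolding a using n insert.hyps(2) by (intro avg_chain[symmetric] ig y j) (auto simp: below_def)
    also have "\<dots> \<le> avg (?\<kappa> j) ?M y"
      by (intro avg_mono y step_integrable[OF step_avg] step_integrable[OF step_max_avg] max_avg_ge n)
    also have "\<dots> \<le> runmax (\<lambda>j. avg (?\<kappa> j) ?M y) (N d)" by (rule runmax_ge[OF j])
    finally show "a \<le> runmax (\<lambda>j. avg (?\<kappa> j) ?M y) (N d)" .
  qed
  have "(LINT y|\<mu>. max_avg (insert d S) N g y powr r)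
     \<le> (LINT y|\<mu>. runmax (\<lambda>j. avg (?\<kappa> j) ?M y) (N d) powr r)"
  proof (rule integral_cube_mono)
    show "integrable \<mu> (\<lambda>y. max_avg (insert d S) N g y powr r)"
      by (rule step_integrable[OF step_comp[OF step_max_avg]])
    have "step N (\<lambda>y. runmax (\<lambda>j. avg (?\<kappa> j) ?M y) (N d))"
      by (rule step_runmax, rule step_mono[OF step_avg]) (simp add: le_fun_def)
    then show "integrable \<mu> (\<lambda>y. runmax (\<lambda>j. avg (?\<kappa> j) ?M y) (N d) powr r)"
      by (rule step_integrable[OF step_comp])
    fix y :: "real^'d" assume "y \<in> unit_cube"
    moreover have "0 \<le> max_avg (insert d S) N g y"
      using order_trans[OF avg_nonneg[OF g(2)] max_avg_ge[OF below_self]] by simp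
    ultimately show "max_avg (insert d S) N g y powr r \<le> runmax (\<lambda>j. avg (?\<kappa> j) ?M y) (N d) powr r"
      using le r by (intro powr_mono2) auto
  qed
  also have "\<dots> \<le> doob_const r * (LINT y|\<mu>. ?M y powr r)"
    by (rule doob[OF r]) (auto simp: le_fun_def step_max_avg M0)
  also have "\<dots> \<le> doob_const r * (doob_const r ^ card S * (LINT y|\<mu>. g y powr r))"
    by (intro mult_left_mono insert.IH doob_const_nonneg r)
  finally show ?case using insert.hyps by (simp add: mult_ac)
qed

text \<open>Chebyshev's inequality for the strong maximal function of the indicator of \<open>A\<close>.  For the averages
with indices below the constant index \<open>k\<close>, the indicator may be replaced by its average at \<open>k\<close>,
which is a step function; then \<open>k\<close> tends to infinity.\<close>
lemma maximal_measure:
  assumes A: "A \<in> sets \<mu>" and c: "0 < c"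
  shows "(\<Union>n. {x \<in> unit_cube. avg n (indicator A) x > c}) \<in> sets \<mu>"
    and "measure \<mu> (\<Union>n. {x \<in> unit_cube. avg n (indicator A) x > c}) \<le> 4 ^ CARD('d) / c\<^sup>2 * measure \<mu> A"
proof -
  let ?I = "indicator A :: real^'d \<Rightarrow> real"
  have iI: "integrable \<mu> ?I"
    using A by (intro integrable_real_indicator) (auto simp: cube.emeasure_eq_measure)
  have sub: "A \<subseteq> unit_cube" using sets.sets_into_space[OF A] by simp
  \<comment> \<open>the constant indices are cofinal\<close>
  define K :: "nat \<Rightarrow> 'd \<Rightarrow> nat" where "K = (\<lambda>k d. k)"
  define B where "B k = {x \<in> unit_cube. c < max_avg UNIV (K k) (avg (K k) ?I) x}" for k
  have Bs: "B k \<in> sets \<mu>" for k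
  proof -
    have "step (K k) (\<lambda>x. x \<in> {x \<in> unit_cube. c < max_avg UNIV (K k) (avg (K k) ?I) x})"
    proof (rule stepI)
      fix x y :: "real^'d" assume xy: "x \<in> unit_cube" "y \<in> unit_cube" "cell (K k) x = cell (K k) y"
      show "(x \<in> {x \<in> unit_cube. c < max_avg UNIV (K k) (avg (K k) ?I) x})
          = (y \<in> {x \<in> unit_cube. c < max_avg UNIV (K k) (avg (K k) ?I) x})"
        using stepD[OF step_max_avg xy] xy by simp
    qed
    then show ?thesis unfolding B_def by (intro sets_vfiltration_subset) (auto simp: vfiltration_sets_iff)
  qed
  have Beq: "B k = (\<Union>n\<in>{n. n \<le> K k}. {x \<in> unit_cube. avg n ?I x > c})" for k
  proof -
    have "c < max_avg UNIV (K k) (avg (K k) ?I) x \<longleftrightarrow> (\<exists>n\<le>K k. avg n ?I x > c)" if x: "x \<in> unit_cube" for x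
    proof -
      have "avg n (avg (K k) ?I) x = avg n ?I x" if "n \<le> K k" for n
        using avg_avg[OF iI x, of n "K k"] that by (simp add: inf_absorb1)
      moreover have "c < max_avg UNIV (K k) (avg (K k) ?I) x \<longleftrightarrow> (\<exists>n\<in>below UNIV (K k). c < avg n (avg (K k) ?I) x)"
        unfolding max_avg_def using finite_below[of UNIV "K k"] below_self[of "K k" UNIV]
        by (subst Max_gr_iff) auto
      ultimately show ?thesis unfolding below_UNIV by auto
    qed
    then show ?thesis unfolding B_def by blast
  qed
  have U: "(\<Union>n. {x \<in> unit_cube. avg n ?I x > c}) = (\<Union>k. B k)"
  proof -
    have "\<exists>k. n \<le> K k" for n :: "'d \<Rightarrow> nat"
      by (rule exI[of _ "Max (range n)"]) (auto simp: le_fun_def K_def)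
    then show ?thesis unfolding Beq by blast
  qed
  show "(\<Union>n. {x \<in> unit_cube. avg n ?I x > c}) \<in> sets \<mu>" unfolding U using Bs by blast
  have bound: "measure \<mu> (B k) \<le> 4 ^ CARD('d) / c\<^sup>2 * measure \<mu> A" for k
  proof -
    let ?g = "avg (K k) ?I"
    have g01: "0 \<le> ?g y" "?g y \<le> 1" if y: "y \<in> unit_cube" for y
    proof -
      show "0 \<le> ?g y" by (rule avg_nonneg) simp
      have "?g y \<le> avg (K k) (\<lambda>_. 1) y" by (rule avg_mono[OF y iI]) (auto simp: indicator_def)
      then show "?g y \<le> 1" using avg_step[OF step_const y, of "K k" "1::real"] by simp
    qed
    let ?M = "max_avg UNIV (K k) ?g"
    have M0: "0 \<le> ?M y" for y
      using order_trans[OF avg_nonneg[of ?g] max_avg_ge[OF below_self]] g01 by blast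
    have iM: "integrable \<mu> (\<lambda>y. ?M y powr 2)" by (rule step_integrable[OF step_comp[OF step_max_avg]])
    have "c\<^sup>2 * measure \<mu> (B k) = (LINT y|\<mu>. c\<^sup>2 * indicator (B k) y)"
    proof -
      have "B k \<inter> unit_cube = B k" unfolding B_def by blast
      then show ?thesis using Bs by simp
    qed
    also have "\<dots> \<le> (LINT y|\<mu>. ?M y powr 2)"
    proof (rule integral_cube_mono[OF _ iM])
      show "integrable \<mu> (\<lambda>y. c\<^sup>2 * indicator (B k) y)"
        using Bs by (intro integrable_mult_right integrable_real_indicator) (auto simp: cube.emeasure_eq_measure)
      fix y
      show "c\<^sup>2 * indicator (B k) y \<le> ?M y powr 2"
        using c M0[of y] by (auto simp: indicator_def B_def power2_eq_square intro!: mult_mono)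
    qed
    also have "\<dots> \<le> doob_const 2 ^ card (UNIV :: 'd set) * (LINT y|\<mu>. ?g y powr 2)"
      by (rule strong_maximal) (auto simp: step_avg g01)
    also have "\<dots> \<le> 4 ^ CARD('d) * (LINT y|\<mu>. ?g y)"
    proof -
      have "(LINT y|\<mu>. ?g y powr 2) \<le> (LINT y|\<mu>. ?g y)"
      proof (rule integral_cube_mono[OF step_integrable[OF step_comp[OF step_avg]] step_integrable[OF step_avg]])
        fix y :: "real^'d" assume "y \<in> unit_cube"
        from g01[OF this] show "?g y powr 2 \<le> ?g y" by (simp add: power2_eq_square mult_left_le)
      qed
      then show ?thesis by (simp add: doob_const_def)
    qed
    also have "(LINT y|\<mu>. ?g y) = measure \<mu> A"
      unfolding integral_avg[OF iI] using sub by (simp add: Int_absorb2)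
    finally show ?thesis using c by (simp add: field_simps)
  qed
  have "B i \<subseteq> B j" if "i \<le> j" for i j
  proof -
    have "n \<le> K j" if "n \<le> K i" for n
      using that \<open>i \<le> j\<close> by (auto simp: K_def le_fun_def intro: order_trans)
    then show ?thesis unfolding Beq by blast
  qed
  then have "incseq B" by (simp add: incseq_def)
  then have "(\<lambda>k. measure \<mu> (B k)) \<longlonglongrightarrow> measure \<mu> (\<Union>k. B k)"
    using Bs by (intro cube.finite_Lim_measure_incseq) auto
  then show "measure \<mu> (\<Union>n. {x \<in> unit_cube. avg n ?I x > c}) \<le> 4 ^ CARD('d) / c\<^sup>2 * measure \<mu> A"
    unfolding U by (rule LIMSEQ_le_const2) (use bound in auto)
qed

end

section \<open>The multi-parameter square function\<close>

text \<open>Taylor's formula for \<open>t powr r\<close>.  The second derivative is decreasing in \<open>t\<close> because of \<open>r \<le> 2\<close>, so that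
its value at the larger endpoint is a lower bound.  The endpoint \<open>0\<close>, at which it is singular, is
treated separately.\<close>
lemma powr_second_order:
  fixes a b r :: real
  assumes r: "1 < r" "r \<le> 2" and a: "0 \<le> a" and b: "0 \<le> b"
  shows "a powr r + r * a powr (r - 1) * (b - a) + r * (r - 1) / 2 * ((b - a)\<^sup>2 * max a b powr (r - 2)) \<le> b powr r"
proof -
  have sq: "t\<^sup>2 * t powr (r - 2) = t powr r" if "0 \<le> t" for t :: real
    using that by (cases "t = 0") (simp_all flip: powr_numeral powr_add)
  have "r * (r - 1) \<le> 2 * (r - 1)" using r by (intro mult_right_mono) auto
  then have c1: "r * (r - 1) / 2 \<le> r - 1" by simp
  have c2: "r - 1 \<le> 1" "0 \<le> r * (r - 1) / 2" using r by auto
  \<comment> \<open>Taylor's formula needs the powers to be smooth between the endpoints\<close>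
  consider "a = 0" | "b = 0" | "a = b" | "0 < a" "0 < b" "a \<noteq> b" using a b by force
  then show ?thesis
  proof cases
    case 1
    have "r * (r - 1) / 2 * b powr r \<le> 1 * b powr r" using c1 c2 by (intro mult_right_mono) auto
    then show ?thesis using 1 b sq[OF b] by (simp add: max_def)
  next
    case 2
    have "r * (r - 1) / 2 * a powr r \<le> (r - 1) * a powr r" using c1 by (intro mult_right_mono) auto
    moreover have "a powr (r - 1) * a = a powr r"
      using a r powr_mult_base[of a "r - 1"] by (simp add: mult.commute)
    ultimately show ?thesis using 2 a sq[OF a] r by (simp add: max_def algebra_simps)
  next
    case 3 then show ?thesis by simp
  next
    case 4
    define diff :: "nat \<Rightarrow> real \<Rightarrow> real" where
      "diff = (\<lambda>m t. if m = 0 then t powr r else if m = 1 then r * t powr (r - 1) else r * (r - 1) * t powr (r - 2))"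
    have "\<exists>t. (if b < a then b < t \<and> t < a else a < t \<and> t < b) \<and>
      b powr r = (\<Sum>m<2. diff m a / fact m * (b - a) ^ m) + diff 2 t / fact 2 * (b - a) ^ 2"
    proof (rule Taylor[where a = "min a b" and b = "max a b"])
      show "diff 0 = (\<lambda>t. t powr r)" by (simp add: diff_def fun_eq_iff)
      show "\<forall>m t. m < 2 \<and> min a b \<le> t \<and> t \<le> max a b \<longrightarrow> (diff m has_real_derivative diff (Suc m) t) (at t)"
      proof (intro allI impI)
        fix m :: nat and t assume mt: "m < 2 \<and> min a b \<le> t \<and> t \<le> max a b"
        then have t: "0 < t" using 4 by auto
        consider "m = 0" | "m = 1" using mt by linarith
        then show "(diff m has_real_derivative diff (Suc m) t) (at t)"
        proof cases
          case 1
          then show ?thesis using t unfolding diff_def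
            by (auto intro!: derivative_eq_intros has_real_derivative_powr)
        next
          case 2
          have "((\<lambda>t. r * t powr (r - 1)) has_real_derivative r * ((r - 1) * t powr (r - 1 - 1))) (at t)"
            by (intro DERIV_cmult has_real_derivative_powr t)
          moreover have "r - 1 - 1 = r - 2" by simp
          ultimately show ?thesis using 2 unfolding diff_def by (simp add: mult.assoc)
        qed
      qed
    qed (use 4 in auto)
    then obtain t where t: "if b < a then b < t \<and> t < a else a < t \<and> t < b"
      and eq: "b powr r = (\<Sum>m<2. diff m a / fact m * (b - a) ^ m) + diff 2 t / fact 2 * (b - a) ^ 2" by blast
    have tm: "0 < t" "t \<le> max a b" using t 4 by (auto split: if_splits)
    have "max a b powr (r - 2) \<le> t powr (r - 2)" using tm r by (intro powr_mono2') auto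
    then have "r * (r - 1) / 2 * ((b - a)\<^sup>2 * max a b powr (r - 2)) \<le> r * (r - 1) / 2 * ((b - a)\<^sup>2 * t powr (r - 2))"
      using c2 by (intro mult_left_mono) auto
    moreover have "b powr r = a powr r + r * a powr (r - 1) * (b - a) + r * (r - 1) / 2 * ((b - a)\<^sup>2 * t powr (r - 2))"
      using eq by (simp add: diff_def numeral_2_eq_2 mult_ac)
    ultimately show ?thesis by simp
  qed
qed

text \<open>The same for norms \<open>a = \<bar>x\<bar>\<close> and \<open>b = \<bar>x + d\<bar>\<close> of vectors in a Hilbert space, where \<open>D = \<bar>d\<bar>\<^sup>2\<close> and
\<open>(b\<^sup>2 - a\<^sup>2 - D) / 2\<close> is the inner product of \<open>x\<close> and \<open>d\<close>.  For given \<open>a\<close> and \<open>b\<close>, the left-hand side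
decreases in \<open>D\<close>, so that the extreme case \<open>D = (b - a)\<^sup>2\<close> of collinear vectors is decisive.  For \<open>a = 0\<close>
the second summand vanishes, since \<open>0 powr (r - 2) = 0\<close>.\<close>
lemma powr_second_order_vec:
  fixes a b r D w :: real
  assumes r: "1 < r" "r \<le> 2" and a: "0 \<le> a" and b: "0 \<le> b" and D: "(b - a)\<^sup>2 \<le> D" "a = 0 \<Longrightarrow> D = b\<^sup>2"
    and w: "a \<le> w" "b \<le> w"
  shows "a powr r + r * (a powr (r - 2) * ((b\<^sup>2 - a\<^sup>2 - D) / 2)) + r * (r - 1) / 2 * (D * w powr (r - 2)) \<le> b powr r"
proof -
  let ?c = "r * (r - 1) / 2" and ?M = "max a b powr (r - 2)"
  have "r * (r - 1) \<le> r * 1" using r by (intro mult_left_mono) auto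
  then have c: "0 \<le> ?c" "?c \<le> r / 2" using r by auto
  have D0: "0 \<le> D" using D(1) order_trans[OF zero_le_power2] by blast
  have base: "a powr r + r * (a powr (r - 2) * ((b\<^sup>2 - a\<^sup>2 - D) / 2)) + ?c * (D * ?M) \<le> b powr r"
  proof (cases "a = 0")
    case True
    then show ?thesis using powr_second_order[OF r a b] D(2) r by simp
  next
    case False
    then have a0: "0 < a" using a by simp
    have "?M \<le> a powr (r - 2)" using a0 r by (intro powr_mono2') auto
    then have "?c * ?M \<le> r / 2 * a powr (r - 2)" using c by (intro mult_mono) auto
    then have "(?c * ?M - r / 2 * a powr (r - 2)) * (D - (b - a)\<^sup>2) \<le> 0"
      using D(1) by (intro mult_nonpos_nonneg) auto
    moreover have "a powr (r - 1) = a powr (r - 2) * a"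
      using powr_mult_base[of a "r - 2"] a by (simp add: mult.commute)
    then have "a powr r + r * (a powr (r - 2) * a) * (b - a) + ?c * ((b - a)\<^sup>2 * ?M) \<le> b powr r"
      using powr_second_order[OF r a b] by simp
    moreover have "a powr r + r * (A * ((b\<^sup>2 - a\<^sup>2 - D) / 2)) + ?c * (D * m)
      = (a powr r + r * (A * a) * (b - a) + ?c * ((b - a)\<^sup>2 * m)) + (?c * m - r / 2 * A) * (D - (b - a)\<^sup>2)" for A m
      by (simp add: power2_eq_square field_simps)
    ultimately show ?thesis by (smt (verit, best))
  qed
  have "D * w powr (r - 2) \<le> D * ?M"
  proof (cases "max a b = 0")
    case True
    then have "a = 0" "b = 0" using a b by (auto simp: max_def split: if_splits)
    then show ?thesis using D(2) by simp
  next
    case False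
    then have "w powr (r - 2) \<le> ?M" using w a b r by (intro powr_mono2') (auto simp: max_def split: if_splits)
    then show ?thesis using D0 by (intro mult_left_mono)
  qed
  then have "?c * (D * w powr (r - 2)) \<le> ?c * (D * ?M)" by (rule mult_left_mono[OF _ c(1)])
  then show ?thesis using base by linarith
qed

text \<open>Young's inequality for the factorization
\<open>Q powr (r / 2) = (Q * w powr (r - 2)) powr (r / 2) * (w powr r) powr (1 - r / 2)\<close>.\<close>
lemma square_weight_young:
  fixes Q w r :: real
  assumes r: "1 < r" "r < 2" and Q: "0 \<le> Q" and w: "0 \<le> w" and z: "w = 0 \<Longrightarrow> Q = 0"
  shows "Q powr (r / 2) \<le> r / 2 * (Q * w powr (r - 2)) + w powr r"
proof (cases "Q = 0")
  case True
  then show ?thesis using r w by simp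
next
  case False
  then have pos: "0 < Q" "0 < w" using Q w z by force+
  have "(Q * w powr (r - 2)) powr (r / 2) * (w powr r) powr (1 - r / 2)
      \<le> r / 2 * (Q * w powr (r - 2)) + (1 - r / 2) * w powr r"
    by (rule Youngs_inequality_0) (use r pos in auto)
  moreover have "(Q * w powr (r - 2)) powr (r / 2) * (w powr r) powr (1 - r / 2) = Q powr (r / 2)"
  proof -
    have "(r - 2) * (r / 2) + r * (1 - r / 2) = 0" by (simp add: field_simps)
    then have "w powr ((r - 2) * (r / 2)) * w powr (r * (1 - r / 2)) = 1"
      using pos by (simp flip: powr_add)
    then show ?thesis by (simp add: powr_mult powr_powr mult.assoc)
  qed
  moreover have "(1 - r / 2) * w powr r \<le> 1 * w powr r" using r by (intro mult_right_mono) auto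
  ultimately show ?thesis by linarith
qed

text \<open>The first summand comes from the second-order term, whose coefficient is \<open>r * (r - 1) / 2\<close>, the
second one from Doob's inequality for the weight.\<close>
definition square_const :: "real \<Rightarrow> real" where "square_const r = 1 / (r - 1) + doob_const r"

lemma square_const_nonneg: "1 < r \<Longrightarrow> 0 \<le> square_const r"
  by (simp add: square_const_def doob_const_nonneg)

context vilenkin_system begin

text \<open>Jensen's inequality for the Euclidean norm: the average \<open>v\<close> is tested against itself, and the
Cauchy-Schwarz inequality is used under the average.\<close>
lemma avg_vector_norm:
  fixes F :: "'i \<Rightarrow> real^'d \<Rightarrow> complex"
  assumes I: "finite I" and F: "\<And>i. i \<in> I \<Longrightarrow> step N (F i)" and x: "x \<in> unit_cube"
  shows "sqrt (\<Sum>i\<in>I. (norm (avg n (F i) x))\<^sup>2) \<le> avg n (\<lambda>y. sqrt (\<Sum>i\<in>I. (norm (F i y))\<^sup>2)) x"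
proof -
  define v where "v i = avg n (F i) x" for i
  \<comment> \<open>to be shown: \<open>V * V \<le> V * avg n ?G x\<close>\<close>
  define V where "V = sqrt (\<Sum>i\<in>I. (norm (v i))\<^sup>2)"
  let ?G = "\<lambda>y. sqrt (\<Sum>i\<in>I. (norm (F i y))\<^sup>2)"
  have V0: "0 \<le> V" by (simp add: V_def sum_nonneg)
  have stG: "step N ?G" by (rule step_comp[OF step_sum[OF step_comp[OF F]]])
  have stH: "step N (\<lambda>y. norm (\<Sum>i\<in>I. cnj (v i) * F i y))"
    by (rule step_comp[OF step_sum[OF step_comp[OF F]]])
  have iF: "integrable \<mu> (\<lambda>y. cnj (v i) * F i y)" if "i \<in> I" for i
    using step_integrable[OF F[OF that]] by simp
  have "complex_of_real (V\<^sup>2) = (\<Sum>i\<in>I. cnj (v i) * v i)"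
    unfolding V_def by (simp add: sum_nonneg complex_norm_square mult.commute flip: of_real_power)
  also have "\<dots> = avg n (\<lambda>y. \<Sum>i\<in>I. cnj (v i) * F i y) x"
    unfolding v_def by (subst avg_sum[OF x iF[unfolded v_def]]) (simp_all add: avg_mult_left)
  finally have "V\<^sup>2 = norm (avg n (\<lambda>y. \<Sum>i\<in>I. cnj (v i) * F i y) x)"
    by (metis norm_of_real abs_of_nonneg zero_le_power2)
  also have "\<dots> \<le> avg n (\<lambda>y. norm (\<Sum>i\<in>I. cnj (v i) * F i y)) x" by (rule norm_avg_le)
  also have "\<dots> \<le> avg n (\<lambda>y. V * ?G y) x"
  proof (rule avg_mono[OF x step_integrable[OF stH]])
    show "integrable \<mu> (\<lambda>y. V * ?G y)" using step_integrable[OF stG] by simp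
    fix y :: "real^'d"
    have "norm (\<Sum>i\<in>I. cnj (v i) * F i y) \<le> (\<Sum>i\<in>I. \<bar>norm (v i)\<bar> * \<bar>norm (F i y)\<bar>)"
      by (rule sum_norm_le) (simp add: norm_mult)
    also have "\<dots> \<le> L2_set (\<lambda>i. norm (v i)) I * L2_set (\<lambda>i. norm (F i y)) I"
      by (rule L2_set_mult_ineq)
    finally show "norm (\<Sum>i\<in>I. cnj (v i) * F i y) \<le> V * ?G y"
      by (simp add: V_def L2_set_def)
  qed
  also have "\<dots> = V * avg n ?G x" by (rule avg_mult_left)
  finally have le: "V * V \<le> V * avg n ?G x" by (simp add: power2_eq_square)
  show ?thesis
  proof (cases "V = 0")
    case True
    then show ?thesis using avg_nonneg[of ?G n x] by (simp add: V_def v_def sum_nonneg)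
  next
    case False
    then have "0 < V" using V0 by simp
    with le have "V \<le> avg n ?G x" by (rule mult_left_le_imp_le)
    then show ?thesis by (simp only: V_def v_def)
  qed
qed

text \<open>The square function of a one-parameter martingale with values in a finite-dimensional Hilbert
space, for \<open>1 < r < 2\<close>.  Let \<open>w\<close> be the maximal function of the norm of the last term.  The
second-order inequality, summed along the path, bounds the integral of \<open>Q * w powr (r - 2)\<close> by the
\<open>r\<close>-th moment of the last term, where \<open>Q\<close> is the sum of the squares: the first-order terms \<open>e j\<close> have
mean zero.  Young's inequality and Doob's inequality for \<open>w\<close> remove the weight.  The values are vectors
indexed by \<open>I\<close> because the argument is iterated over the coordinates, and each step turns the
differences in one coordinate into components of the vector for the next one.\<close>
lemma square_function_chain:
  fixes F :: "'i \<Rightarrow> real^'d \<Rightarrow> complex"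
  assumes r: "1 < r" "r < 2" and \<kappa>: "\<And>j. \<kappa> j \<le> \<kappa> (Suc j)"
    and I: "finite I" and F: "\<And>i. i \<in> I \<Longrightarrow> step (\<kappa> J) (F i)"
  shows "(LINT y|\<mu>. ((\<Sum>i\<in>I. (norm (avg (\<kappa> 0) (F i) y))\<^sup>2) +
       (\<Sum>j<J. \<Sum>i\<in>I. (norm (avg (\<kappa> (Suc j)) (F i) y - avg (\<kappa> j) (F i) y))\<^sup>2)) powr (r / 2))
    \<le> square_const r * (LINT y|\<mu>. (\<Sum>i\<in>I. (norm (F i y))\<^sup>2) powr (r / 2))"
proof -
  define X where "X = (\<lambda>j i y. avg (\<kappa> j) (F i) y)"
  define a where "a = (\<lambda>j y. sqrt (\<Sum>i\<in>I. (norm (X j i y))\<^sup>2))"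
  define D where "D = (\<lambda>j y. \<Sum>i\<in>I. (norm (X (Suc j) i y - X j i y))\<^sup>2)"
  define Q where "Q = (\<lambda>y. (a 0 y)\<^sup>2 + (\<Sum>j<J. D j y))"
  define G where "G = (\<lambda>y. sqrt (\<Sum>i\<in>I. (norm (F i y))\<^sup>2))"
  define w where "w = (\<lambda>y. runmax (\<lambda>j. avg (\<kappa> j) G y) J)"
  \<comment> \<open>the first-order terms: \<open>a j powr (r - 2)\<close> times the inner product of the value \<open>X j\<close> and its increment\<close>
  define e where "e = (\<lambda>j y. a j y powr (r - 2) * (((a (Suc j) y)\<^sup>2 - (a j y)\<^sup>2 - D j y) / 2))"
  let ?c = "r * (r - 1) / 2"
  have c0: "0 < ?c" "?c \<le> 1"
  proof -
    show "0 < ?c" using r by simp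
    have "r * (r - 1) \<le> 2 * 1" using r by (intro mult_mono) auto
    then show "?c \<le> 1" by simp
  qed
  have mono: "\<kappa> i \<le> \<kappa> j" if "i \<le> j" for i j using \<kappa> that by (rule lift_Suc_mono_le)
  have stX: "step (\<kappa> k) (X j i)" if "j \<le> k" for j k i
    unfolding X_def by (rule step_mono[OF step_avg mono[OF that]])
  have sta: "step (\<kappa> k) (a j)" if "j \<le> k" for j k
    unfolding a_def by (rule step_comp[OF step_sum[OF step_comp[OF stX[OF that]]]])
  have stD: "step (\<kappa> k) (D j)" if "j < k" for j k
    unfolding D_def
    by (rule step_sum, rule step_comp2[where F = "\<lambda>u v. (norm (u - v))\<^sup>2"]) (rule stX, use that in simp)+
  have stQ: "step (\<kappa> J) Q"
    unfolding Q_def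
    by (rule step_comp2[where F = "(+)"], rule step_comp[OF sta], simp, rule step_sum, rule stD) simp
  have stG: "step (\<kappa> J) G" unfolding G_def by (rule step_comp[OF step_sum[OF step_comp[OF F]]])
  have stw: "step (\<kappa> J) w" unfolding w_def by (rule step_runmax, rule step_mono[OF step_avg mono])
  have ste: "step (\<kappa> (Suc j)) (e j)" for j
  proof -
    have "step (\<kappa> (Suc j)) (\<lambda>y. ((a (Suc j) y)\<^sup>2 - (a j y)\<^sup>2))"
      by (rule step_comp2[where F = "\<lambda>u v. u\<^sup>2 - v\<^sup>2"]) (rule sta, simp)+
    from step_comp2[OF this stD[OF lessI], of "\<lambda>u v. (u - v) / 2"]
    show ?thesis unfolding e_def
      by (rule step_comp2[where F = "\<lambda>u v. u powr (r - 2) * v", OF sta, rotated]) simp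
  qed
  have ie: "integrable \<mu> (e j)" for j by (rule step_integrable[OF ste])
  have G0: "0 \<le> G y" and a0: "0 \<le> a j y" and D0: "0 \<le> D j y" for y j
    by (simp_all add: G_def a_def D_def sum_nonneg)
  have asq: "(a j y)\<^sup>2 = (\<Sum>i\<in>I. (norm (X j i y))\<^sup>2)" for j y by (simp add: a_def sum_nonneg)
  have inner: "((a (Suc j) y)\<^sup>2 - (a j y)\<^sup>2 - D j y) / 2 = (\<Sum>i\<in>I. Re (cnj (X j i y) * (X (Suc j) i y - X j i y)))" for j y
  proof -
    have "((norm u)\<^sup>2 - (norm v)\<^sup>2 - (norm (u - v))\<^sup>2) / 2 = Re (cnj v * (u - v))" for u v :: complex
      unfolding cmod_power2 by (simp add: power2_eq_square field_simps)
    then show ?thesis unfolding asq D_def sum_subtractf[symmetric] sum_divide_distrib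
      by (intro sum.cong refl)
  qed
  have zero: "(LINT y|\<mu>. e j y) = 0" if j: "j < J" for j
  proof -
    define u where "u = (\<lambda>i y. complex_of_real (a j y powr (r - 2)) * cnj (X j i y))"
    have stu: "step (\<kappa> k) (u i)" if "j \<le> k" for i k
      unfolding u_def by (rule step_comp2[where F = "\<lambda>s t. complex_of_real (s powr (r - 2)) * cnj t"])
        (rule sta[OF that] stX[OF that])+
    have iuF: "integrable \<mu> (\<lambda>y. u i y * F i y)" if "i \<in> I" for i
      by (rule step_integrable[of "\<kappa> J"], rule step_comp2[where F = "(*)"]) (use j in \<open>simp_all add: stu F that\<close>)
    have iuX: "integrable \<mu> (\<lambda>y. u i y * X k i y)" for i k
      by (rule step_integrable[of "\<kappa> (max j k)"], rule step_comp2[where F = "(*)"]) (simp_all add: stu stX)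
    have z: "(LINT y|\<mu>. u i y * (X (Suc j) i y - X j i y)) = 0" if i: "i \<in> I" for i
    proof -
      have "(LINT y|\<mu>. u i y * X k i y) = (LINT y|\<mu>. u i y * F i y)" if "j \<le> k" for k
        unfolding X_def by (rule integral_step_mult_avg[OF stu[OF that] iuF[OF i]])
      from this[of "Suc j"] this[of j] show ?thesis using iuX by (simp add: right_diff_distrib)
    qed
    have iu: "integrable \<mu> (\<lambda>y. u i y * (X (Suc j) i y - X j i y))" for i
      using iuX[of i "Suc j"] iuX[of i j] by (simp add: right_diff_distrib)
    have "e j y = (\<Sum>i\<in>I. Re (u i y * (X (Suc j) i y - X j i y)))" for y
      unfolding e_def inner u_def sum_distrib_left
      by (intro sum.cong refl) (simp only: mult.assoc Re_complex_of_real times_complex.sel, simp)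
    then have "(LINT y|\<mu>. e j y) = (LINT y|\<mu>. (\<Sum>i\<in>I. Re (u i y * (X (Suc j) i y - X j i y))))"
      by simp
    also have "\<dots> = (\<Sum>i\<in>I. LINT y|\<mu>. Re (u i y * (X (Suc j) i y - X j i y)))"
      by (rule Bochner_Integration.integral_sum) (rule integrable_Re[OF iu])
    also have "\<dots> = 0"
      by (rule sum.neutral, rule ballI, subst integral_Re[OF iu]) (simp only: z zero_complex.sel)
    finally show ?thesis .
  qed
  have point: "?c * (Q y * w y powr (r - 2)) + (\<Sum>j<J. r * e j y) \<le> G y powr r"
    and wz: "w y = 0 \<Longrightarrow> Q y = 0" and w0: "0 \<le> w y" if y: "y \<in> unit_cube" for y
  proof -
    have aw: "a j y \<le> w y" if "j \<le> J" for j
    proof -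
      have "a j y \<le> avg (\<kappa> j) G y" unfolding a_def X_def G_def by (rule avg_vector_norm[OF I F y])
      also have "\<dots> \<le> w y" unfolding w_def by (rule runmax_ge[OF that])
      finally show ?thesis .
    qed
    show w0: "0 \<le> w y" using order_trans[OF a0 aw[OF order_refl]] .
    have Dsmall: "(a (Suc j) y - a j y)\<^sup>2 \<le> D j y" for j
    proof -
      \<comment> \<open>the reverse triangle inequality in the two directions\<close>
      have "L2_set (\<lambda>i. norm (X (Suc j) i y)) I \<le> L2_set (\<lambda>i. norm (X (Suc j) i y - X j i y) + norm (X j i y)) I"
        by (rule L2_set_mono) (auto intro: norm_triangle_sub[THEN order_trans] simp: add.commute)
      also have "\<dots> \<le> L2_set (\<lambda>i. norm (X (Suc j) i y - X j i y)) I + L2_set (\<lambda>i. norm (X j i y)) I"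
        by (rule L2_set_triangle_ineq)
      finally have 1: "a (Suc j) y - a j y \<le> sqrt (D j y)" by (simp add: a_def D_def L2_set_def)
      have "L2_set (\<lambda>i. norm (X j i y)) I \<le> L2_set (\<lambda>i. norm (X (Suc j) i y - X j i y) + norm (X (Suc j) i y)) I"
        by (rule L2_set_mono) (auto intro: norm_triangle_sub[THEN order_trans] simp: add.commute norm_minus_commute)
      also have "\<dots> \<le> L2_set (\<lambda>i. norm (X (Suc j) i y - X j i y)) I + L2_set (\<lambda>i. norm (X (Suc j) i y)) I"
        by (rule L2_set_triangle_ineq)
      finally have 2: "a j y - a (Suc j) y \<le> sqrt (D j y)" by (simp add: a_def D_def L2_set_def)
      have "\<bar>a (Suc j) y - a j y\<bar> \<le> sqrt (D j y)" using 1 2 by linarith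
      then have "\<bar>a (Suc j) y - a j y\<bar>\<^sup>2 \<le> (sqrt (D j y))\<^sup>2" by (rule power_mono) simp
      then show ?thesis using D0 by simp
    qed
    have Dzero: "D j y = (a (Suc j) y)\<^sup>2" if "a j y = 0" for j
    proof -
      have "\<forall>i\<in>I. X j i y = 0" using that I unfolding a_def by (simp add: sum_nonneg_eq_0_iff)
      then show ?thesis unfolding asq D_def by simp
    qed
    have stepj: "a j y powr r + r * e j y + ?c * (D j y * w y powr (r - 2)) \<le> a (Suc j) y powr r" if "j < J" for j
      unfolding e_def
    proof (rule powr_second_order_vec[OF r(1) less_imp_le[OF r(2)] a0 a0 Dsmall])
      show "a j y = 0 \<Longrightarrow> D j y = (a (Suc j) y)\<^sup>2" by (rule Dzero)
      show "a j y \<le> w y" "a (Suc j) y \<le> w y" using aw that by simp_all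
    qed
    have "a 0 y powr r + (\<Sum>j<k. r * e j y + ?c * (D j y * w y powr (r - 2))) \<le> a k y powr r" if "k \<le> J" for k
      using that
    proof (induction k)
      case (Suc k)
      then have "a 0 y powr r + (\<Sum>j<k. r * e j y + ?c * (D j y * w y powr (r - 2))) \<le> a k y powr r" by simp
      moreover have "a k y powr r + r * e k y + ?c * (D k y * w y powr (r - 2)) \<le> a (Suc k) y powr r"
        using Suc.prems by (intro stepj) simp
      ultimately show ?case unfolding sum.lessThan_Suc by linarith
    qed simp
    from this[OF order_refl]
    have "a 0 y powr r + (\<Sum>j<J. r * e j y) + ?c * ((\<Sum>j<J. D j y) * w y powr (r - 2)) \<le> a J y powr r"
      by (simp add: sum.distrib sum_distrib_left sum_distrib_right add.assoc)
    moreover have "?c * ((a 0 y)\<^sup>2 * w y powr (r - 2)) \<le> a 0 y powr r"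
    proof (cases "a 0 y = 0")
      case False
      then have p: "0 < a 0 y" using a0[of 0 y] by simp
      have "w y powr (r - 2) \<le> a 0 y powr (r - 2)" using aw[of 0] p r by (intro powr_mono2') auto
      then have "(a 0 y)\<^sup>2 * w y powr (r - 2) \<le> (a 0 y)\<^sup>2 * a 0 y powr (r - 2)" by (intro mult_left_mono) auto
      also have "\<dots> = a 0 y powr r" using p by (simp flip: powr_numeral powr_add)
      finally have "?c * ((a 0 y)\<^sup>2 * w y powr (r - 2)) \<le> 1 * a 0 y powr r" using c0 by (intro mult_mono) auto
      then show ?thesis by simp
    qed simp
    moreover have "a J y = G y" unfolding a_def G_def X_def using avg_step[OF F y] by simp
    ultimately show "?c * (Q y * w y powr (r - 2)) + (\<Sum>j<J. r * e j y) \<le> G y powr r"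
      by (simp add: Q_def distrib_right distrib_left)
    show "Q y = 0" if "w y = 0"
    proof -
      have az: "a j y = 0" if "j \<le> J" for j using aw[OF that] a0[of j y] \<open>w y = 0\<close> by simp
      have "D j y = 0" if "j < J" for j using Dzero[OF az] az[of "Suc j"] that by simp
      then show ?thesis using az[of 0] by (simp add: Q_def)
    qed
  qed
  have iG: "integrable \<mu> (\<lambda>y. G y powr r)" by (rule step_integrable[OF step_comp[OF stG]])
  have iw: "integrable \<mu> (\<lambda>y. w y powr r)" by (rule step_integrable[OF step_comp[OF stw]])
  have iQw: "integrable \<mu> (\<lambda>y. Q y * w y powr (r - 2))"
    by (rule step_integrable[OF step_comp2[OF stQ stw]])
  have iQ: "integrable \<mu> (\<lambda>y. Q y powr (r / 2))" by (rule step_integrable[OF step_comp[OF stQ]])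
  have "?c * (LINT y|\<mu>. Q y * w y powr (r - 2))
      = (LINT y|\<mu>. ?c * (Q y * w y powr (r - 2)) + (\<Sum>j<J. r * e j y))"
  proof -
    have "(LINT y|\<mu>. (\<Sum>j<J. r * e j y)) = (\<Sum>j<J. LINT y|\<mu>. r * e j y)"
      by (rule Bochner_Integration.integral_sum) (simp add: ie)
    also have "\<dots> = 0" using zero by simp
    finally have "(LINT y|\<mu>. (\<Sum>j<J. r * e j y)) = 0" .
    moreover have "integrable \<mu> (\<lambda>y. \<Sum>j<J. r * e j y)"
      by (rule Bochner_Integration.integrable_sum) (simp add: ie)
    moreover have "integrable \<mu> (\<lambda>y. ?c * (Q y * w y powr (r - 2)))"
      by (rule integrable_mult_right[OF iQw])
    ultimately have "(LINT y|\<mu>. ?c * (Q y * w y powr (r - 2)) + (\<Sum>j<J. r * e j y))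
        = (LINT y|\<mu>. ?c * (Q y * w y powr (r - 2)))"
      by (subst Bochner_Integration.integral_add) auto
    then show ?thesis by (simp only: integral_mult_right_zero)
  qed
  also have "\<dots> \<le> (LINT y|\<mu>. G y powr r)"
  proof (rule integral_cube_mono[OF _ iG])
    show "integrable \<mu> (\<lambda>y. ?c * (Q y * w y powr (r - 2)) + (\<Sum>j<J. r * e j y))"
      by (intro Bochner_Integration.integrable_add Bochner_Integration.integrable_sum integrable_mult_right iQw ie)
    fix y :: "real^'d" assume y: "y \<in> unit_cube"
    show "?c * (Q y * w y powr (r - 2)) + (\<Sum>j<J. r * e j y) \<le> G y powr r" by (rule point[OF y])
  qed
  finally have 1: "?c * (LINT y|\<mu>. Q y * w y powr (r - 2)) \<le> (LINT y|\<mu>. G y powr r)" .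
  have "(LINT y|\<mu>. Q y powr (r / 2)) \<le> (LINT y|\<mu>. r / 2 * (Q y * w y powr (r - 2)) + w y powr r)"
  proof (rule integral_cube_mono[OF iQ])
    show "integrable \<mu> (\<lambda>y. r / 2 * (Q y * w y powr (r - 2)) + w y powr r)"
      by (intro Bochner_Integration.integrable_add integrable_mult_right iQw iw)
    fix y :: "real^'d" assume y: "y \<in> unit_cube"
    have "0 \<le> Q y" by (simp add: Q_def D0 sum_nonneg)
    then show "Q y powr (r / 2) \<le> r / 2 * (Q y * w y powr (r - 2)) + w y powr r"
      using wz[OF y] w0[OF y] by (intro square_weight_young r)
  qed
  also have "\<dots> = r / 2 * (LINT y|\<mu>. Q y * w y powr (r - 2)) + (LINT y|\<mu>. w y powr r)"
    using iQw iw by (subst Bochner_Integration.integral_add) auto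
  also have "r / 2 * (LINT y|\<mu>. Q y * w y powr (r - 2)) = 1 / (r - 1) * (?c * (LINT y|\<mu>. Q y * w y powr (r - 2)))"
    using r by (simp add: field_simps)
  also have "\<dots> \<le> 1 / (r - 1) * (LINT y|\<mu>. G y powr r)"
    using 1 r by (intro mult_left_mono) auto
  also have "(LINT y|\<mu>. w y powr r) \<le> doob_const r * (LINT y|\<mu>. G y powr r)"
    unfolding w_def by (rule doob[OF r(1) \<kappa> stG]) (rule G0)
  finally have "(LINT y|\<mu>. Q y powr (r / 2)) \<le> 1 / (r - 1) * (LINT y|\<mu>. G y powr r) + doob_const r * (LINT y|\<mu>. G y powr r)"
    by simp
  then have "(LINT y|\<mu>. Q y powr (r / 2)) \<le> square_const r * (LINT y|\<mu>. G y powr r)"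
    by (simp only: square_const_def distrib_right)
  moreover have "G y powr r = (\<Sum>i\<in>I. (norm (F i y))\<^sup>2) powr (r / 2)" for y
    unfolding G_def by (simp add: sum_nonneg powr_powr flip: powr_half_sqrt)
  ultimately show ?thesis by (simp add: Q_def asq D_def X_def)
qed

text \<open>In each step, the differences in the coordinates of \<open>S\<close> are the components of a vector-valued
martingale in the parameter of the coordinate \<open>d\<close>.\<close>
lemma multi_square_function:
  assumes r: "1 < r" "r < 2" and f: "vmartingale p f" and S: "finite S"
  shows "(LINT y|\<mu>. (\<Sum>n\<in>below S N. (norm (pdiff S f n y))\<^sup>2) powr (r / 2))
    \<le> square_const r ^ card S * (LINT y|\<mu>. norm (f N y) powr r)"
  using S
proof induction
  case empty
  have "(norm z)\<^sup>2 powr (r / 2) = norm z powr r" for z :: complex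
    by (simp add: powr_powr flip: powr_numeral)
  then show ?case by (simp add: below_empty pdiff_empty)
next
  case (insert d S)
  let ?\<kappa> = "\<lambda>j. N(d := j)" and ?F = "pdiff S f"
  note d = insert.hyps(2)
  have eq: "(\<Sum>n\<in>below (insert d S) N. (norm (pdiff (insert d S) f n y))\<^sup>2)
    = (\<Sum>n\<in>below S N. (norm (avg (?\<kappa> 0) (?F n) y))\<^sup>2) +
       (\<Sum>j<N d. \<Sum>n\<in>below S N. (norm (avg (?\<kappa> (Suc j)) (?F n) y - avg (?\<kappa> j) (?F n) y))\<^sup>2)"
    if y: "y \<in> unit_cube" for y
  proof -
    let ?D = "\<lambda>j n. (norm (pdiff (insert d S) f (n(d := j)) y))\<^sup>2"
    have A: "avg (?\<kappa> j) (?F n) y = ?F (n(d := j)) y" if "n \<in> below S N" "j \<le> N d" for n j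
      using that d by (intro avg_pdiff[OF f y]) (auto simp: below_def)
    have "(\<Sum>n\<in>below (insert d S) N. (norm (pdiff (insert d S) f n y))\<^sup>2) = (\<Sum>(j, n)\<in>{..N d} \<times> below S N. ?D j n)"
      unfolding below_insert(1)[OF d] sum.reindex[OF below_insert(2)[OF d]]
      by (intro sum.cong refl) auto
    also have "\<dots> = (\<Sum>j\<le>N d. \<Sum>n\<in>below S N. ?D j n)"
      by (rule sum.cartesian_product[symmetric])
    also have "\<dots> = (\<Sum>n\<in>below S N. ?D 0 n) + (\<Sum>j<N d. \<Sum>n\<in>below S N. ?D (Suc j) n)"
      by (rule sum.atMost_shift)
    also have "(\<Sum>n\<in>below S N. ?D 0 n) = (\<Sum>n\<in>below S N. (norm (avg (?\<kappa> 0) (?F n) y))\<^sup>2)"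
      by (intro sum.cong refl) (simp add: A pdiff_insert[OF d])
    also have "(\<Sum>j<N d. \<Sum>n\<in>below S N. ?D (Suc j) n)
       = (\<Sum>j<N d. \<Sum>n\<in>below S N. (norm (avg (?\<kappa> (Suc j)) (?F n) y - avg (?\<kappa> j) (?F n) y))\<^sup>2)"
    proof (intro sum.cong refl)
      fix j n assume "j \<in> {..<N d}" "n \<in> below S N"
      then show "?D (Suc j) n = (norm (avg (?\<kappa> (Suc j)) (?F n) y - avg (?\<kappa> j) (?F n) y))\<^sup>2"
        using A[of n j] A[of n "Suc j"] by (simp add: pdiff_insert[OF d])
    qed
    finally show ?thesis .
  qed
  have "(LINT y|\<mu>. (\<Sum>n\<in>below (insert d S) N. (norm (pdiff (insert d S) f n y))\<^sup>2) powr (r / 2))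
    = (LINT y|\<mu>. ((\<Sum>n\<in>below S N. (norm (avg (?\<kappa> 0) (?F n) y))\<^sup>2) +
       (\<Sum>j<N d. \<Sum>n\<in>below S N. (norm (avg (?\<kappa> (Suc j)) (?F n) y - avg (?\<kappa> j) (?F n) y))\<^sup>2)) powr (r / 2))"
    by (rule integral_cube_cong) (simp add: eq)
  also have "\<dots> \<le> square_const r * (LINT y|\<mu>. (\<Sum>n\<in>below S N. (norm (?F n y))\<^sup>2) powr (r / 2))"
  proof (rule square_function_chain[OF r _ finite_below])
    show "?\<kappa> j \<le> ?\<kappa> (Suc j)" for j by (simp add: le_fun_def)
    show "step (?\<kappa> (N d)) (?F n)" if "n \<in> below S N" for n
      using that by (intro step_mono[OF pdiff_step[OF f]]) (simp add: below_def)
  qed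
  also have "\<dots> \<le> square_const r * (square_const r ^ card S * (LINT y|\<mu>. norm (f N y) powr r))"
    by (rule mult_left_mono[OF insert.IH square_const_nonneg[OF r(1)]])
  finally show ?case using insert.hyps by (simp add: mult_ac)
qed

lemma martingale_square_function:
  assumes r: "1 < r" "r < 2" and f: "vmartingale p f"
  shows "(LINT y|\<mu>. (\<Sum>n | n \<le> N. (norm (mdiff f n y))\<^sup>2) powr (r / 2))
    \<le> square_const r ^ CARD('d) * (LINT y|\<mu>. norm (f N y) powr r)"
  using multi_square_function[OF r f finite, of UNIV N] by (simp only: below_UNIV mdiff_eq_pdiff)

end

section \<open>Modified martingale differences\<close>

definition unity :: "nat \<Rightarrow> nat \<Rightarrow> complex" where
  "unity q a = exp (2 * of_real pi * \<i> * of_nat a / of_nat q)"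

lemma norm_unity: "norm (unity q a) = 1"
proof -
  have "unity q a = exp (\<i> * of_real (2 * pi * a / q))" by (simp add: unity_def mult_ac)
  then show ?thesis by (simp only: norm_exp_i_times)
qed

lemma unity_eq_iff: "1 \<le> q \<Longrightarrow> a < q \<Longrightarrow> b < q \<Longrightarrow> unity q a = unity q b \<longleftrightarrow> a = b"
  unfolding unity_def by (subst complex_root_unity_eq) auto

lemma unity_cnj: "unity q a * cnj (unity q a) = 1"
  using norm_unity[of q a] by (simp flip: complex_norm_square)

lemma unity_power_q: "1 \<le> q \<Longrightarrow> unity q a ^ q = 1"
  unfolding unity_def by (rule complex_root_unity) simp

lemma unity_power: "unity q a ^ l = unity q l ^ a"
  unfolding unity_def by (simp flip: exp_of_nat_mult add: mult_ac)

lemma unity_0: "unity q 0 = 1"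
  by (simp add: unity_def)

lemma geometric_sum_root:
  fixes z :: complex
  assumes "z ^ q = 1" "z \<noteq> 1"
  shows "(\<Sum>j<q. z ^ j) = 0"
  using assms by (simp add: geometric_sum)

text \<open>A geometric sum whose ratio is a \<open>q\<close>-th root of unity.\<close>
lemma unity_orthogonal:
  assumes q: "1 \<le> q" and ab: "a < q" "b < q"
  shows "(\<Sum>j<q. (unity q a * cnj (unity q b)) ^ j) = (if a = b then of_nat q else 0)"
proof (cases "a = b")
  case True
  then show ?thesis by (simp add: unity_cnj)
next
  case False
  have "unity q a * cnj (unity q b) \<noteq> 1"
  proof
    assume "unity q a * cnj (unity q b) = 1"
    then have "unity q a * (cnj (unity q b) * unity q b) = unity q b" by (simp add: mult.assoc[symmetric])
    then have "unity q a = unity q b" using unity_cnj[of q b] by (simp add: mult.commute)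
    then show False using unity_eq_iff[OF q ab] False by simp
  qed
  moreover have "(unity q a * cnj (unity q b)) ^ q = 1"
    using unity_power_q[OF q] by (simp add: power_mult_distrib flip: complex_cnj_power)
  ultimately show ?thesis using False by (simp add: geometric_sum_root)
qed

lemma unity_sum_zero:
  assumes q: "1 \<le> q" and l: "1 \<le> l" "l < q"
  shows "(\<Sum>a<q. unity q a ^ l) = 0"
proof -
  have "unity q l \<noteq> unity q 0" using unity_eq_iff[OF q l(2), of 0] l by simp
  then show ?thesis unfolding unity_power[of q _ l]
    by (intro geometric_sum_root unity_power_q q) (simp add: unity_0)
qed

text \<open>The generalized Rademacher function of generation \<open>i\<close>.\<close>
definition character :: "(nat \<Rightarrow> nat) \<Rightarrow> nat \<Rightarrow> real \<Rightarrow> complex" where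
  "character q i t = unity (q i) (floor_digit q t i)"

context
  fixes q :: "nat \<Rightarrow> nat"
  assumes q2: "\<And>k. k \<ge> 1 \<Longrightarrow> q k \<ge> 2"
begin

lemma nat_digit_formula: "nat_digit q m = (\<lambda>k. if k = 0 then 0 else m div pprod q (k - 1) mod q k)"
  by (rule nat_digit_eq) (rule q2)

lemma icell_Suc_iff:
  "0 \<le> t \<Longrightarrow> 0 \<le> u \<Longrightarrow> icell q (Suc n) t = icell q (Suc n) u \<longleftrightarrow>
    icell q n t = icell q n u \<and> floor_digit q t (Suc n) = floor_digit q u (Suc n)"
  by (rule icell_Suc_eq_iff) (use q2 in auto)

lemma pprod_gt_0: "0 < pprod q n"
  by (rule pprod_pos) (rule q2)

lemma pprod_dvd: "n \<le> i \<Longrightarrow> pprod q n dvd pprod q i"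
  unfolding pprod_def by (rule prod_dvd_prod_subset) auto

lemma pprod_mono: "n \<le> i \<Longrightarrow> pprod q n \<le> pprod q i"
  by (rule dvd_imp_le[OF pprod_dvd]) (simp_all add: pprod_pos[OF q2])

text \<open>The product may be taken over a fixed range of digits, because the digits of \<open>k\<close> beyond \<open>M\<close>
vanish.\<close>
lemma vilenkin1_prod:
  assumes t: "0 \<le> t" "t < 1" and k: "k < pprod q M"
  shows "vilenkin1 q k t = (\<Prod>i\<in>{1..M}. character q i t ^ (k div pprod q (i - 1) mod q i))"
proof -
  have z: "nat_digit q k i = 0" if "i > M" for i
  proof -
    have "pprod q M \<le> pprod q (i - 1)" using that by (intro pprod_mono) simp
    then have "k div pprod q (i - 1) = 0" using k by simp
    then show ?thesis unfolding nat_digit_formula by simp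
  qed
  have z0: "nat_digit q k 0 = 0" unfolding nat_digit_formula by simp
  have "vilenkin1 q k t = (\<Prod>i | nat_digit q k i \<noteq> 0. character q i t ^ nat_digit q k i)"
    unfolding vilenkin1_def character_def unity_def by (simp add: digit_eq[OF q2 t])
  also have "\<dots> = (\<Prod>i\<in>{1..M}. character q i t ^ nat_digit q k i)"
  proof (rule prod.mono_neutral_left)
    show "{i. nat_digit q k i \<noteq> 0} \<subseteq> {1..M}"
    proof
      fix i assume "i \<in> {i. nat_digit q k i \<noteq> 0}"
      then have "nat_digit q k i \<noteq> 0" by simp
      then have "\<not> i > M" "i \<noteq> 0" using z[of i] z0 by (metis, metis)
      then show "i \<in> {1..M}" by simp
    qed
  qed auto
  also have "\<dots> = (\<Prod>i\<in>{1..M}. character q i t ^ (k div pprod q (i - 1) mod q i))"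
    unfolding nat_digit_formula by (intro prod.cong refl) auto
  finally show ?thesis .
qed

text \<open>The leading digit \<open>j\<close> of the frequency contributes the factor of generation \<open>Suc m\<close>, and the other
digits are those of \<open>k\<close>.\<close>
lemma vilenkin1_block:
  assumes t: "0 \<le> t" "t < 1" and k: "k < pprod q m" and j: "j < q (Suc m)"
  shows "vilenkin1 q (j * pprod q m + k) t = character q (Suc m) t ^ j * vilenkin1 q k t"
proof -
  let ?K = "j * pprod q m + k"
  have "Suc j \<le> q (Suc m)" using j by simp
  then have "Suc j * pprod q m \<le> q (Suc m) * pprod q m" by (rule mult_right_mono) simp
  then have "?K < pprod q (Suc m)" using k by (simp add: pprod_Suc[OF q2])
  from vilenkin1_prod[OF t this]
  have "vilenkin1 q ?K t = (\<Prod>i\<in>{1..m}. character q i t ^ (?K div pprod q (i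
      - 1) mod q i)) * character q (Suc m) t ^ (?K div pprod q m mod q (Suc m))"
    by simp
  also have "?K div pprod q m mod q (Suc m) = j" using k j by simp
  also have "(\<Prod>i\<in>{1..m}. character q i t ^ (?K div pprod q (i - 1) mod q i)) = vilenkin1 q k t"
    unfolding vilenkin1_prod[OF t k]
  proof (intro prod.cong refl arg_cong2[of _ _ _ _ "(^)"])
    fix i assume i: "i \<in> {1..m}"
    then obtain i' where i': "i = Suc i'" by (cases i) auto
    obtain c where "pprod q m = pprod q i * c" using pprod_dvd[of i m] i by (auto simp: dvd_def)
    then have "?K = q i * (c * j) * pprod q i' + k" by (simp add: i' pprod_Suc[OF q2] mult_ac)
    then have "?K div pprod q i' = q i * (c * j) + k div pprod q i'"
    proof (simp only:)
      show "(q i * (c * j) * pprod q i' + k) div pprod q i' = q i * (c * j) + k div pprod q i'"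
        using pprod_gt_0[of i'] by simp
    qed
    then show "?K div pprod q (i - 1) mod q i = k div pprod q (i - 1) mod q i" by (simp add: i')
  qed
  finally show ?thesis by (simp add: mult.commute)
qed

lemma sum_blocks:
  fixes F :: "nat \<Rightarrow> complex"
  shows "sum F {j * P..<(j + 1) * P} = (\<Sum>k<P. F (j * P + k))"
  using sum.shift_bounds_nat_ivl[of F 0 "j * P" P] by (simp add: add.commute atLeast0LessThan)

text \<open>The Dirichlet kernel of order \<open>pprod q m\<close> is the kernel of the average of generation \<open>m\<close>.  It is a
product over the digits, and each factor is an orthogonality relation for roots of unity.\<close>
lemma dirichlet_kernel1:
  assumes t: "0 \<le> t" "t < 1" and u: "0 \<le> u" "u < 1"
  shows "(\<Sum>k<pprod q m. vilenkin1 q k t * cnj (vilenkin1 q k u)) = (if icell q m t = icell q m u then of_nat (pprod q m) else 0)"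
proof (induction m)
  case 0
  have "vilenkin1 q 0 s = 1" if "0 \<le> s" "s < 1" for s
    using vilenkin1_prod[OF that, of 0 0] by (simp add: pprod_0[OF q2])
  then show ?case using t u by (simp add: pprod_0[OF q2] icell_0)
next
  case (Suc m)
  let ?P = "pprod q m" and ?q = "q (Suc m)" and ?F = "\<lambda>k. vilenkin1 q k t * cnj (vilenkin1 q k u)"
  let ?a = "floor_digit q t (Suc m)" and ?b = "floor_digit q u (Suc m)"
  have q1: "1 \<le> ?q" using q2[of "Suc m"] by simp
  have "(\<Sum>k<pprod q (Suc m). ?F k) = (\<Sum>j<?q. sum ?F {j * ?P..<j * ?P + ?P})"
    unfolding sum.nat_group by (simp add: pprod_Suc[OF q2])
  also have "\<dots> = (\<Sum>j<?q. \<Sum>k<?P. ?F (j * ?P + k))"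
    using sum_blocks[of ?F _ ?P] by (simp add: add.commute)
  also have "\<dots> = (\<Sum>j<?q. \<Sum>k<?P. (unity ?q ?a * cnj (unity ?q ?b)) ^ j * ?F k)"
    by (intro sum.cong refl) (simp add: vilenkin1_block[OF t] vilenkin1_block[OF u] character_def power_mult_distrib mult_ac)
  also have "\<dots> = (\<Sum>j<?q. (unity ?q ?a * cnj (unity ?q ?b)) ^ j) * (\<Sum>k<?P. ?F k)"
    by (simp add: sum_product)
  also have "(\<Sum>j<?q. (unity ?q ?a * cnj (unity ?q ?b)) ^ j) = (if ?a = ?b then of_nat ?q else 0)"
    by (rule unity_orthogonal[OF q1]) (rule floor_digit_less[OF q2], simp)+
  finally show ?case
    unfolding Suc.IH icell_Suc_iff[OF t(1) u(1)] by (simp add: pprod_Suc[OF q2])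
qed

text \<open>A modified block of frequencies is a translate of the frequencies below \<open>pprod q (n - 1)\<close>; on the side
of the functions, translation is multiplication by a power of the character.\<close>
lemma block_kernel1:
  assumes t: "0 \<le> t" "t < 1" and u: "0 \<le> u" "u < 1" and j: "j \<in> L1 q n"
  shows "(\<Sum>k\<in>delta1 q n j. vilenkin1 q k t * cnj (vilenkin1 q k u)) =
    (if n = 0 then 1 else character q n t ^ j) * cnj (if n = 0 then 1 else character q n u ^ j) *
    (if icell q (n - 1) t = icell q (n - 1) u then of_nat (pprod q (n - 1)) else 0)"
proof (cases n)
  case 0
  then show ?thesis using dirichlet_kernel1[OF t u, of 0] by (simp add: delta1_def pprod_0[OF q2])
next
  case (Suc m)
  have jq: "j < q (Suc m)" using j q2[of "Suc m"] by (auto simp: L1_def Suc)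
  have "(\<Sum>k\<in>delta1 q n j. vilenkin1 q k t * cnj (vilenkin1 q k u))
     = (\<Sum>k<pprod q m. vilenkin1 q (j * pprod q m + k) t * cnj (vilenkin1 q (j * pprod q m + k) u))"
    using sum_blocks[of "\<lambda>k. vilenkin1 q k t * cnj (vilenkin1 q k u)" j "pprod q m"] by (simp add: delta1_def Suc)
  also have "\<dots> = (\<Sum>k<pprod q m. (character q n t ^ j * cnj (character q n u ^ j)) * (vilenkin1 q k t * cnj (vilenkin1 q k u)))"
    by (intro sum.cong refl) (simp add: vilenkin1_block[OF t _ jq] vilenkin1_block[OF u _ jq] Suc mult_ac)
  also have "\<dots> = (character q n t ^ j * cnj (character q n u ^ j)) * (\<Sum>k<pprod q m. vilenkin1 q k t * cnj (vilenkin1 q k u))"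
    by (rule sum_distrib_left[symmetric])
  finally show ?thesis unfolding dirichlet_kernel1[OF t u] by (simp add: Suc)
qed

lemma delta1_less: "j \<in> L1 q n \<Longrightarrow> k \<in> delta1 q n j \<Longrightarrow> k < pprod q n"
proof (cases n)
  case (Suc m)
  assume j: "j \<in> L1 q n" and k: "k \<in> delta1 q n j"
  have "j + 1 \<le> q (Suc m)" using j q2[of "Suc m"] by (auto simp: L1_def Suc)
  then have "(j + 1) * pprod q m \<le> q (Suc m) * pprod q m" by (rule mult_right_mono) simp
  then show ?thesis using k by (simp add: delta1_def Suc pprod_Suc[OF q2])
qed (simp add: delta1_def pprod_0[OF q2])

lemma floor_digit_cong:
  assumes "0 \<le> t" "0 \<le> u" "icell q n t = icell q n u" "i \<in> {1..n}"
  shows "floor_digit q t i = floor_digit q u i"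
proof -
  obtain m where i: "i = Suc m" using assms(4) by (cases i) auto
  have "icell q (Suc m) t = icell q (Suc m) u"
    using icell_mono_eq[of q t u "Suc m" n, OF q2 assms(1,2) _ assms(3)] assms(4) i by simp
  then show ?thesis using icell_Suc_eq_iff[of q t u m, OF q2 assms(1,2)] i by simp
qed

lemma vilenkin1_cong:
  assumes "0 \<le> t" "t < 1" "0 \<le> u" "u < 1" "icell q n t = icell q n u" "k < pprod q n"
  shows "vilenkin1 q k t = vilenkin1 q k u"
  unfolding vilenkin1_prod[OF assms(1,2,6)] vilenkin1_prod[OF assms(3,4,6)] character_def
  using floor_digit_cong[OF assms(1,3,5)] by (intro prod.cong refl) simp

end

context vilenkin_system begin

text \<open>The factor that is common to the Vilenkin functions with frequencies in \<open>delta p n l\<close>: the powers of characters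
that belong to their leading digits.\<close>
definition rademacher :: "('d \<Rightarrow> nat) \<Rightarrow> ('d \<Rightarrow> nat) \<Rightarrow> real^'d \<Rightarrow> complex" where
  "rademacher n l x = (\<Prod>d\<in>UNIV. if n d = 0 then 1 else character (p d) (n d) (x $ d) ^ l d)"

lemma delta_PiE: "delta p n l = PiE UNIV (\<lambda>d. delta1 (p d) (n d) (l d))"
  by (auto simp: delta_def PiE_def)

lemma finite_delta1: "finite (delta1 q n j)" by (simp add: delta1_def)

lemma cellD: "cell n x = cell n y \<Longrightarrow> icell (p d) (n d) (x $ d) = icell (p d) (n d) (y $ d)"
  by (drule fun_cong[of _ _ d]) (simp add: cell_def)

lemma block_kernel:
  assumes x: "x \<in> unit_cube" and y: "y \<in> unit_cube" and l: "l \<in> L_index p n"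
  shows "(\<Sum>k\<in>delta p n l. vilenkin p k x * cnj (vilenkin p k y)) =
    rademacher n l x * cnj (rademacher n l y) * (if cell (pred_index n) x = cell (pred_index n) y then of_real (ncells (pred_index n)) else 0)"
proof -
  have "(\<Sum>k\<in>delta p n l. vilenkin p k x * cnj (vilenkin p k y))
     = (\<Sum>k\<in>PiE UNIV (\<lambda>d. delta1 (p d) (n d) (l d)). \<Prod>d\<in>UNIV. vilenkin1 (p d) (k d) (x $ d) * cnj (vilenkin1 (p d) (k d) (y $ d)))"
    unfolding delta_PiE vilenkin_def by (simp add: prod.distrib)
  also have "\<dots> = (\<Prod>d\<in>UNIV. \<Sum>k\<in>delta1 (p d) (n d) (l d). vilenkin1 (p d) k (x $ d) * cnj (vilenkin1 (p d) k (y $ d)))"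
    by (rule prod_sum_PiE[symmetric]) (auto simp: finite_delta1)
  also have "\<dots> = (\<Prod>d\<in>UNIV. (if n d = 0 then 1 else character (p d) (n d) (x $ d) ^ l d) *
      cnj (if n d = 0 then 1 else character (p d) (n d) (y $ d) ^ l d) *
      (if icell (p d) (n d - 1) (x $ d) = icell (p d) (n d - 1) (y $ d) then of_nat (pprod (p d) (n d - 1)) else 0))"
    by (intro prod.cong refl block_kernel1 p_ge cube_nonneg x y) (use l in \<open>simp_all add: L_index_def\<close>)
  also have "\<dots> = rademacher n l x * cnj (rademacher n l y) *
     (\<Prod>d\<in>UNIV. if icell (p d) (n d - 1) (x $ d) = icell (p d) (n d - 1) (y $ d) then of_nat (pprod (p d) (n d - 1)) else 0)"
    by (simp only: rademacher_def prod.distrib cnj_prod)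
  also have "(\<Prod>d\<in>UNIV. if icell (p d) (n d - 1) (x $ d) = icell (p d) (n d - 1) (y $ d) then of_nat (pprod (p d) (n d - 1)) else 0)
     = (if cell (pred_index n) x = cell (pred_index n) y then complex_of_real (ncells (pred_index n)) else 0)"
  proof (cases "cell (pred_index n) x = cell (pred_index n) y")
    case True
    then have "icell (p d) (n d - 1) (x $ d) = icell (p d) (n d - 1) (y $ d)" for d
      using cellD[OF True, of d] by (simp add: pred_index_def)
    then show ?thesis using True by (simp add: ncells_def pred_index_def)
  next
    case False
    then obtain d where "icell (p d) (n d - 1) (x $ d) \<noteq> icell (p d) (n d - 1) (y $ d)"
      by (auto simp: cell_def pred_index_def fun_eq_iff)
    then have "\<exists>d\<in>UNIV. (if icell (p d) (n d - 1) (x $ d) = icell (p d) (n d - 1) (y $ d) then of_nat (pprod (p d) (n d - 1))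
        else 0) = (0::complex)"
      by (intro bexI[of _ d]) auto
    then show ?thesis using False by (subst prod_zero) auto
  qed
  finally show ?thesis .
qed

lemma step_vilenkin:
  assumes l: "l \<in> L_index p n" and k: "k \<in> delta p n l"
  shows "step n (vilenkin p k)"
proof (rule stepI)
  fix x y :: "real^'d" assume x: "x \<in> unit_cube" and y: "y \<in> unit_cube" and c: "cell n x = cell n y"
  have "k d < pprod (p d) (n d)" for d
    using l k by (intro delta1_less[of "p d" "l d"] p_ge) (simp_all add: L_index_def delta_def)
  then show "vilenkin p k x = vilenkin p k y"
    unfolding vilenkin_def by (intro prod.cong refl vilenkin1_cong[OF p_ge _ _ _ _ cellD[OF c]] cube_nonneg x y)
qed

lemma character_cong:
  assumes x: "x \<in> unit_cube" and y: "y \<in> unit_cube" and c: "cell n x = cell n y" and "n d \<noteq> 0"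
  shows "character (p d) (n d) (x $ d) = character (p d) (n d) (y $ d)"
  unfolding character_def
  using floor_digit_cong[of "p d" "x $ d" "y $ d" "n d" "n d", OF p_ge cube_nonneg(1)[OF x] cube_nonneg(1)[OF y] cellD[OF c]] assms(4) by simp

lemma step_rademacher: "step n (rademacher n l)"
proof (rule stepI)
  fix x y :: "real^'d" assume x: "x \<in> unit_cube" and y: "y \<in> unit_cube" and c: "cell n x = cell n y"
  show "rademacher n l x = rademacher n l y"
    unfolding rademacher_def using character_cong[OF x y c] by (intro prod.cong refl) simp
qed

text \<open>Each cell that is coarser by one generation in the coordinate \<open>d\<close> splits into \<open>p d (n d)\<close> cells of
equal measure, one for each value of the digit, and the \<open>l\<close>-th powers of the roots of unity add up to
zero.\<close>
lemma avg_character_power: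
  assumes x: "x \<in> unit_cube" and n: "n d \<noteq> 0" and l: "1 \<le> l" "l < p d (n d)"
  shows "avg (n(d := n d - 1)) (\<lambda>y. character (p d) (n d) (y $ d) ^ l) x = 0"
proof -
  let ?k = "n(d := n d - 1)" and ?q = "p d (n d)"
  obtain m where m: "n d = Suc m" using n by (cases "n d") auto
  \<comment> \<open>the cells of generation \<open>n\<close> into which the coarser cell of \<open>x\<close> splits, numbered by the digit\<close>
  define c where "c a = (cell n x)(d := ?q * icell (p d) m (x $ d) + a)" for a
  let ?\<phi> = "\<lambda>y::real^'d. character (p d) (n d) (y $ d) ^ l"
  have q: "1 \<le> ?q" using p_ge[of "n d" d] n by simp
  have dl: "floor_digit (p d) t (n d) < ?q" for t unfolding m by (rule floor_digit_less) (rule p_ge)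
  have split: "cell n y = c a \<longleftrightarrow> cell ?k y = cell ?k x \<and> floor_digit (p d) (y $ d) (n d) = a"
    if y: "y \<in> unit_cube" and a: "a < ?q" for y a
  proof -
    have d: "icell (p d) (n d) (y $ d) = ?q * icell (p d) m (x $ d) + a \<longleftrightarrow>
       icell (p d) m (y $ d) = icell (p d) m (x $ d) \<and> floor_digit (p d) (y $ d) (n d) = a"
    proof -
      have e: "icell (p d) (n d) (y $ d) = ?q * icell (p d) m (y $ d) + floor_digit (p d) (y $ d) (n d)"
        unfolding m by (rule icell_Suc[of "p d", OF p_ge cube_nonneg(1)[OF y]])
      have "?q * u + v = ?q * w + a \<longleftrightarrow> u = w \<and> v = a" if v: "v < ?q" for u v w
      proof
        assume h: "?q * u + v = ?q * w + a"
        have "(?q * u + v) div ?q = u" "(?q * w + a) div ?q = w" using v a by simp_all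
        then show "u = w \<and> v = a" using h by auto
      qed simp
      then show ?thesis unfolding e using dl by blast
    qed
    have "cell n y = c a \<longleftrightarrow> (\<forall>i. i \<noteq> d \<longrightarrow> cell n y i = cell n x i) \<and> cell n y d
        = ?q * icell (p d) m (x $ d) + a"
      unfolding c_def fun_eq_iff by auto
    also have "\<dots> \<longleftrightarrow> (\<forall>i. i \<noteq> d \<longrightarrow> cell ?k y i = cell ?k x i) \<and> cell ?k y d
        = cell ?k x d \<and> floor_digit (p d) (y $ d) (n d) = a"
      using d by (simp add: cell_def m)
    also have "\<dots> \<longleftrightarrow> cell ?k y = cell ?k x \<and> floor_digit (p d) (y $ d) (n d) = a"
    proof -
      have "(\<forall>i. P i) \<longleftrightarrow> (\<forall>i. i \<noteq> d
          \<longrightarrow> P i) \<and> P d" for P :: "'d \<Rightarrow> bool" by metis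
      from this[of "\<lambda>i. cell ?k y i = cell ?k x i"] show ?thesis unfolding fun_eq_iff by blast
    qed
    finally show ?thesis .
  qed
  have grid: "c a \<in> grid n" if a: "a < ?q" for a
  proof -
    have "cell n x i < pprod (p i) (n i)" for i using cell_in_grid[OF x, of n] by (simp add: grid_def)
    moreover have "?q * icell (p d) m (x $ d) + a < pprod (p d) (n d)"
    proof -
      have "cell ?k x d < pprod (p d) (?k d)" using cell_in_grid[OF x, of ?k] unfolding grid_def by blast
      then have "icell (p d) m (x $ d) + 1 \<le> pprod (p d) m" by (simp add: cell_def m)
      then have "?q * (icell (p d) m (x $ d) + 1) \<le> ?q * pprod (p d) m" by (rule mult_left_mono) simp
      then show ?thesis using a by (simp add: m pprod_Suc[OF p_ge])
    qed
    ultimately show ?thesis by (simp add: grid_def c_def)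
  qed
  have "(LINT y|\<mu>. indicator (atom ?k x) y *\<^sub>R ?\<phi> y)
     = (LINT y|\<mu>. (\<Sum>a<?q. indicator (rectangle p n (c a)) y *\<^sub>R unity ?q a ^ l))"
  proof (rule integral_cube_cong)
    fix y :: "real^'d" assume y: "y \<in> unit_cube"
    let ?b = "floor_digit (p d) (y $ d) (n d)"
    have ind: "indicator (rectangle p n (c a)) y = (if a = ?b then indicator (atom ?k x) y else (0::real))" if a: "a < ?q" for a
      using split[OF y a] y unfolding rectangle_eq[OF grid[OF a]] atom_def by (auto simp: indicator_def)
    have "(\<Sum>a<?q. indicator (rectangle p n (c a)) y *\<^sub>R unity ?q a ^ l) = (\<Sum>a<?q. if a
        = ?b then indicator (atom ?k x) y *\<^sub>R unity ?q a ^ l else 0)"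
      by (intro sum.cong refl) (simp add: ind)
    also have "\<dots> = indicator (atom ?k x) y *\<^sub>R unity ?q ?b ^ l" using dl by simp
    finally show "indicator (atom ?k x) y *\<^sub>R ?\<phi> y = (\<Sum>a<?q. indicator (rectangle p n (c a)) y *\<^sub>R unity ?q a ^ l)"
      by (simp add: character_def)
  qed
  also have "\<dots> = (\<Sum>a<?q. LINT y|\<mu>. indicator (rectangle p n (c a)) y *\<^sub>R unity ?q a ^ l)"
    by (rule Bochner_Integration.integral_sum) (simp add: integrable_rect grid)
  also have "\<dots> = (\<Sum>a<?q. (1 / ncells n) *\<^sub>R unity ?q a ^ l)"
  proof (intro sum.cong refl)
    fix a assume "a \<in> {..<?q}"
    then have a: "a < ?q" by simp
    have "rectangle p n (c a) \<inter> unit_cube = rectangle p n (c a)" unfolding rectangle_eq[OF grid[OF a]] by blast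
    then show "(LINT y|\<mu>. indicator (rectangle p n (c a)) y *\<^sub>R unity ?q a ^ l) = (1 / ncells n) *\<^sub>R unity ?q a ^ l"
      using rectangle_cube[OF grid[OF a]] by (subst integral_scaleR_left) (auto intro!: integrable_real_indicator)
  qed
  also have "\<dots> = (1 / ncells n) *\<^sub>R (\<Sum>a<?q. unity ?q a ^ l)" by (rule scaleR_sum_right[symmetric])
  also have "\<dots> = 0" using unity_sum_zero[OF q l] by simp
  finally show ?thesis unfolding avg_def by simp
qed

lemma avg_cnj: "avg n (\<lambda>y. cnj (g y)) x = cnj (avg n g x)"
proof -
  have "(LINT y|\<mu>. indicator (atom n x) y *\<^sub>R cnj (g y)) = (LINT y|\<mu>. cnj (indicator (atom n x) y *\<^sub>R g y))"
    by simp
  also have "\<dots> = cnj (LINT y|\<mu>. indicator (atom n x) y *\<^sub>R g y)" by (rule Bochner_Integration.integral_cnj)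
  finally show ?thesis by (simp add: avg_def)
qed

lemma avg_rademacher:
  assumes x: "x \<in> unit_cube" and n: "n d \<noteq> 0" and l: "l \<in> L_index p n"
  shows "avg (n(d := n d - 1)) (\<lambda>y. cnj (rademacher n l y)) x = 0"
proof -
  let ?k = "n(d := n d - 1)"
  define R where "R y = (\<Prod>i\<in>UNIV - {d}. if n i = 0 then 1 else character (p i) (n i) (y $ i) ^ l i)" for y :: "real^'d"
  have r: "rademacher n l y = R y * character (p d) (n d) (y $ d) ^ l d" for y
    unfolding rademacher_def R_def using n by (subst prod.remove[of UNIV d]) (simp_all add: mult.commute)
  have stR: "step ?k R"
  proof (rule stepI)
    fix x y :: "real^'d" assume xy: "x \<in> unit_cube" "y \<in> unit_cube" "cell ?k x = cell ?k y"
    show "R x = R y" unfolding R_def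
    proof (intro prod.cong refl)
      fix i assume "i \<in> UNIV - {d}"
      then have "?k i = n i" by simp
      then show "(if n i = 0 then 1 else character (p i) (n i) (x $ i) ^ l i) = (if n i = 0 then 1 else character (p i) (n i) (y $ i) ^ l i)"
        using character_cong[OF xy, of i] by simp
    qed
  qed
  have "l d \<in> L1 (p d) (n d)" using l by (simp add: L_index_def)
  then have ld: "1 \<le> l d" "l d < p d (n d)" using n p_ge[of "n d" d] by (auto simp: L1_def)
  have "avg ?k (rademacher n l) x = R x * avg ?k (\<lambda>y. character (p d) (n d) (y $ d) ^ l d) x"
    unfolding r[abs_def] by (rule avg_pull_out[OF stR x])
  also have "\<dots> = 0" using avg_character_power[of x n d "l d", OF x n ld] by simp
  finally show ?thesis by (simp add: avg_cnj)
qed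

text \<open>The modified difference is the average of generation \<open>pred_index n\<close>, conjugated with a function of
modulus one.  Its value at \<open>x\<close> therefore depends only on \<open>f n\<close> on the cell of \<open>x\<close> in this generation.\<close>
lemma mod_mdiff_eq_avg:
  assumes f: "vmartingale p f" and x: "x \<in> unit_cube" and l: "l \<in> L_index p n"
  shows "mod_mdiff p f n l x = rademacher n l x * avg (pred_index n) (\<lambda>y. f n y * cnj (rademacher n l y)) x"
proof -
  let ?m = "pred_index n"
  have i: "integrable \<mu> (\<lambda>y. f n y * cnj (vilenkin p k y))" if "k \<in> delta p n l" for k
    by (rule step_integrable[OF step_comp2[OF vmart_step[OF f] step_vilenkin[OF l that], where F = "\<lambda>u v. u * cnj v"]])
  have "mod_mdiff p f n l x = (\<Sum>k\<in>delta p n l. LINT y|\<mu>. f n y * cnj (vilenkin p k y) * vilenkin p k x)"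
    unfolding mod_mdiff_def pairing_def by (simp only: integral_mult_left_zero)
  also have "\<dots> = (LINT y|\<mu>. (\<Sum>k\<in>delta p n l. f n y * cnj (vilenkin p k y) * vilenkin p k x))"
    by (rule Bochner_Integration.integral_sum[symmetric]) (rule integrable_mult_left[OF i])
  also have "\<dots> = (LINT y|\<mu>. (rademacher n l x * of_real (ncells ?m)) * (indicator (atom ?m x) y *\<^sub>R (f n y
      * cnj (rademacher n l y))))"
  proof (rule integral_cube_cong)
    fix y :: "real^'d" assume y: "y \<in> unit_cube"
    have "(\<Sum>k\<in>delta p n l. f n y * cnj (vilenkin p k y) * vilenkin p k x)
        = f n y * (\<Sum>k\<in>delta p n l. vilenkin p k x * cnj (vilenkin p k y))"
      by (simp add: sum_distrib_left mult_ac)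
    then show "(\<Sum>k\<in>delta p n l. f n y * cnj (vilenkin p k y) * vilenkin p k x)
        = (rademacher n l x * of_real (ncells ?m)) * (indicator (atom ?m x) y *\<^sub>R (f n y * cnj (rademacher n l y)))"
      unfolding block_kernel[OF x y l] using y by (auto simp: atom_def indicator_def)
  qed
  also have "\<dots> = (rademacher n l x * of_real (ncells ?m)) * (LINT y|\<mu>. indicator (atom ?m x) y *\<^sub>R (f n y * cnj (rademacher n l y)))"
    by (rule integral_mult_right_zero)
  finally show ?thesis unfolding avg_def scaleR_conv_of_real[of "ncells ?m"] by (simp only: mult.assoc)
qed

text \<open>On a cell of generation \<open>pred_index n\<close>, the modified difference does not distinguish \<open>f n\<close> from
\<open>mdiff f n\<close>: the other terms of \<open>mdiff f n\<close> are coarser in some coordinate, and there the conjugate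
Rademacher product has average zero.  So the support of \<open>mdiff f n\<close>, which is controlled by the
choice of a martingale transform, controls the modified differences.\<close>
theorem mod_mdiff_eq_0:
  assumes f: "vmartingale p f" and x: "x \<in> unit_cube" and l: "l \<in> L_index p n"
    and z: "\<And>y. y \<in> atom (pred_index n) x \<Longrightarrow> mdiff f n y = 0"
  shows "mod_mdiff p f n l x = 0"
proof -
  let ?m = "pred_index n" and ?r = "\<lambda>y. cnj (rademacher n l y)"
  have st: "step n (\<lambda>y. g y * ?r y)" if "step n g" for g
    by (rule step_comp2[OF that step_rademacher, where F = "\<lambda>u v. u * cnj v"])
  have coarse: "avg ?m (\<lambda>y. g y * ?r y) x = 0" if n: "n d \<noteq> 0" and g: "step (n(d := n d - 1)) g" for d g
  proof -
    let ?k = "n(d := n d - 1)" and ?h = "\<lambda>y. g y * ?r y"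
    have "step n g" by (rule step_mono[OF g]) (simp add: le_fun_def)
    note ih = step_integrable[OF st[OF this]]
    have "avg ?k ?h y = 0" if "y \<in> unit_cube" for y
      using avg_pull_out[OF g that, of ?r] avg_rademacher[OF that n l] by simp
    then have "avg ?m (avg ?k ?h) x = 0" by (rule avg_zero)
    moreover have "inf ?m ?k = ?m" by (rule inf_absorb1) (simp add: le_fun_def pred_index_def)
    ultimately show ?thesis using avg_avg[OF ih x, of ?m ?k] by simp
  qed
  have "avg ?m (\<lambda>y. pdiff S f n y * ?r y) x = avg ?m (\<lambda>y. f n y * ?r y) x" if "finite S" for S
    using that
  proof induction
    case empty
    then show ?case by (simp add: pdiff_empty)
  next
    case (insert d S)
    let ?k = "n(d := n d - 1)"
    show ?case
    proof (cases "n d = 0")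
      case True
      then show ?thesis using insert.IH by (simp add: pdiff_insert[OF insert.hyps(2)])
    next
      case False
      have k: "step ?k (pdiff S f ?k)" by (rule pdiff_step[OF f])
      have "step n (pdiff S f ?k)" by (rule step_mono[OF k]) (simp add: le_fun_def)
      note i = step_integrable[OF st[OF this]] step_integrable[OF st[OF pdiff_step[OF f]]]
      have "avg ?m (\<lambda>y. pdiff (insert d S) f n y * ?r y) x
          = avg ?m (\<lambda>y. pdiff S f n y * ?r y - pdiff S f ?k y * ?r y) x"
        using False by (simp add: pdiff_insert[OF insert.hyps(2)] left_diff_distrib)
      also have "\<dots> = avg ?m (\<lambda>y. pdiff S f n y * ?r y) x - avg ?m (\<lambda>y. pdiff S f ?k y * ?r y) x"
        by (rule avg_diff[OF x i(2) i(1)])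
      finally show ?thesis using insert.IH coarse[OF False k] by simp
    qed
  qed
  from this[of UNIV] have "avg ?m (\<lambda>y. f n y * ?r y) x = avg ?m (\<lambda>y. mdiff f n y * ?r y) x"
    by (simp only: mdiff_eq_pdiff finite)
  also have "\<dots> = 0"
  proof -
    have "(\<lambda>y. indicator (atom ?m x) y *\<^sub>R (mdiff f n y * ?r y)) = (\<lambda>y. 0)"
      using z by (auto simp: indicator_def)
    then show ?thesis unfolding avg_def by simp
  qed
  finally show ?thesis unfolding mod_mdiff_eq_avg[OF f x l] by simp
qed

end

section \<open>From distributional to strong estimates\<close>

lemma nn_integral_powr_from_0:
  assumes "0 < s" "0 \<le> (u::real)"
  shows "(\<integral>\<^sup>+ t. ennreal (s * t powr (s - 1)) * indicator {0..u} t \<partial>lborel) = ennreal (u powr s)"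
proof -
  have "((\<lambda>t. s * t powr (s - 1)) has_integral (s * (u powr (s - 1 + 1) / (s - 1 + 1)))) {0..u}"
    by (intro has_integral_mult_right has_integral_powr_from_0) (use assms in auto)
  then have "((\<lambda>t. s * t powr (s - 1)) has_integral (u powr s)) {0..u}" using assms by simp
  then show ?thesis by (rule nn_integral_has_integral_lebesgue'[rotated]) (use assms in auto)
qed

lemma nn_integral_powr_to_inf:
  assumes "0 < s" "s < 2" "0 < (w::real)"
  shows "(\<integral>\<^sup>+ t. ennreal (s * t powr (s - 3)) * indicator {w..} t \<partial>lborel) = ennreal (s / (2 - s) * w powr (s - 2))"
proof -
  have "((\<lambda>t. s * t powr (s - 3)) has_integral (s * (- (w powr (s - 3 + 1)) / (s - 3 + 1)))) {w..}"
    by (intro has_integral_mult_right has_integral_powr_to_inf) (use assms in auto)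
  moreover have "s - 3 + 1 = s - 2" "- (w powr (s - 2)) / (s - 2) = w powr (s - 2) / (2 - s)"
    using assms by (simp_all add: divide_simps) (simp add: algebra_simps)
  ultimately have "((\<lambda>t. s * t powr (s - 3)) has_integral (s / (2 - s) * w powr (s - 2))) {w..}"
    by (simp only:) (simp add: mult.commute)
  then show ?thesis by (rule nn_integral_has_integral_lebesgue'[rotated]) (use assms in auto)
qed

text \<open>Integration of \<open>u powr s = \<integral> s * t powr (s - 1) dt\<close> over \<open>0 \<le> t \<le> u\<close>, and Tonelli's theorem.\<close>
lemma layer_cake:
  fixes u :: "'a \<Rightarrow> real"
  assumes "sigma_finite_measure M" and [measurable]: "u \<in> borel_measurable M"
    and u: "\<And>x. 0 \<le> u x" and s: "0 < s"
  shows "(\<integral>\<^sup>+ x. ennreal (u x powr s) \<partial>M)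
    = (\<integral>\<^sup>+ t. ennreal (s * t powr (s - 1)) * indicator {0..} t * emeasure M {x \<in> space M. t \<le> u x} \<partial>lborel)"
proof -
  interpret M: sigma_finite_measure M by fact
  interpret P: pair_sigma_finite M lborel by standard
  let ?K = "\<lambda>x t. ennreal (s * t powr (s - 1)) * (if 0 \<le> t \<and> t \<le> u x then 1 else 0)"
  have "(\<integral>\<^sup>+ x. ennreal (u x powr s) \<partial>M) = (\<integral>\<^sup>+ x. \<integral>\<^sup>+ t. ?K x t \<partial>lborel \<partial>M)"
  proof (rule nn_integral_cong)
    fix x
    have "(\<integral>\<^sup>+ t. ?K x t \<partial>lborel) = (\<integral>\<^sup>+ t. ennreal (s * t powr (s
        - 1)) * indicator {0..u x} t \<partial>lborel)"
      by (intro nn_integral_cong arg_cong2[of _ _ _ _ "(*)"] refl) (auto simp: indicator_def)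
    then show "ennreal (u x powr s) = (\<integral>\<^sup>+ t. ?K x t \<partial>lborel)"
      by (simp only: nn_integral_powr_from_0[OF s u])
  qed
  also have "\<dots> = (\<integral>\<^sup>+ t. \<integral>\<^sup>+ x. ?K x t \<partial>M \<partial>lborel)"
    by (rule P.Fubini'[symmetric]) measurable
  also have "\<dots> = (\<integral>\<^sup>+ t. ennreal (s * t powr (s - 1)) * indicator {0..} t * emeasure M {x \<in> space M. t
      \<le> u x} \<partial>lborel)"
  proof (rule nn_integral_cong)
    fix t :: real
    have "(\<integral>\<^sup>+ x. ?K x t \<partial>M) = (\<integral>\<^sup>+ x. (ennreal (s * t powr (s
        - 1)) * indicator {0..} t) * indicator {x \<in> space M. t \<le> u x} x \<partial>M)"
      by (intro nn_integral_cong) (auto simp: indicator_def)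
    then show "(\<integral>\<^sup>+ x. ?K x t \<partial>M) = ennreal (s * t powr (s
        - 1)) * indicator {0..} t * emeasure M {x \<in> space M. t \<le> u x}"
      by (simp add: nn_integral_cmult_indicator)
  qed
  finally show ?thesis .
qed

text \<open>The condition \<open>s < 2\<close> makes \<open>t powr (s - 3)\<close> integrable over \<open>t \<ge> w\<close>.  Where \<open>w\<close> vanishes the inner integral
diverges, but there it is multiplied by zero.\<close>
lemma truncated_square_layer_cake:
  fixes w :: "'a \<Rightarrow> real"
  assumes "sigma_finite_measure M" and [measurable]: "w \<in> borel_measurable M"
    and w: "\<And>x. 0 \<le> w x" and s: "0 < s" "s < 2"
  shows "(\<integral>\<^sup>+ t. ennreal (s * t powr (s - 3)) * indicator {0<..} t * (\<integral>\<^sup>+ x. ennreal ((w x)\<^sup>2)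
      * indicator {x. w x \<le> t} x \<partial>M) \<partial>lborel)
    = ennreal (s / (2 - s)) * (\<integral>\<^sup>+ x. ennreal (w x powr s) \<partial>M)"
proof -
  interpret M: sigma_finite_measure M by fact
  interpret P: pair_sigma_finite M lborel by standard
  let ?K = "\<lambda>x t. ennreal (s * t powr (s - 3)) * (if 0 < t \<and> w x \<le> t then 1 else 0) * ennreal ((w x)\<^sup>2)"
  have "(\<integral>\<^sup>+ t. ennreal (s * t powr (s - 3)) * indicator {0<..} t * (\<integral>\<^sup>+ x. ennreal ((w x)\<^sup>2)
      * indicator {x. w x \<le> t} x \<partial>M) \<partial>lborel)
    = (\<integral>\<^sup>+ t. \<integral>\<^sup>+ x. ?K x t \<partial>M \<partial>lborel)"
  proof (rule nn_integral_cong)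
    fix t :: real
    have "(\<integral>\<^sup>+ x. ?K x t \<partial>M) = (\<integral>\<^sup>+ x. (ennreal (s * t powr (s
        - 3)) * indicator {0<..} t) * (ennreal ((w x)\<^sup>2) * (if w x \<le> t then 1 else 0)) \<partial>M)"
      by (intro nn_integral_cong) (auto simp: indicator_def)
    also have "\<dots> = (ennreal (s * t powr (s - 3)) * indicator {0<..} t) * (\<integral>\<^sup>+ x. ennreal ((w x)\<^sup>2) * (if w x
        \<le> t then 1 else 0) \<partial>M)"
      by (rule nn_integral_cmult) measurable
    also have "(\<integral>\<^sup>+ x. ennreal ((w x)\<^sup>2) * (if w x \<le> t then 1 else 0) \<partial>M)
        = (\<integral>\<^sup>+ x. ennreal ((w x)\<^sup>2) * indicator {x. w x \<le> t} x \<partial>M)"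
      by (intro nn_integral_cong) (auto simp: indicator_def)
    finally show "ennreal (s * t powr (s - 3)) * indicator {0<..} t * (\<integral>\<^sup>+ x. ennreal ((w x)\<^sup>2) * indicator {x. w x
        \<le> t} x \<partial>M) = (\<integral>\<^sup>+ x. ?K x t \<partial>M)" ..
  qed
  also have "\<dots> = (\<integral>\<^sup>+ x. \<integral>\<^sup>+ t. ?K x t \<partial>lborel \<partial>M)"
    by (rule P.Fubini') measurable
  also have "\<dots> = (\<integral>\<^sup>+ x. ennreal (s / (2 - s)) * ennreal (w x powr s) \<partial>M)"
  proof (rule nn_integral_cong)
    fix x
    show "(\<integral>\<^sup>+ t. ?K x t \<partial>lborel) = ennreal (s / (2 - s)) * ennreal (w x powr s)"
    proof (cases "w x = 0")
      case True
      then show ?thesis by simp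
    next
      case False
      then have wx: "0 < w x" using w[of x] by simp
      have "(\<integral>\<^sup>+ t. ?K x t \<partial>lborel) = (\<integral>\<^sup>+ t. ennreal (s * t powr (s
          - 3)) * indicator {w x..} t * ennreal ((w x)\<^sup>2) \<partial>lborel)"
        using wx by (intro nn_integral_cong arg_cong2[of _ _ _ _ "(*)"] refl) (auto simp: indicator_def)
      also have "\<dots> = (\<integral>\<^sup>+ t. ennreal (s * t powr (s - 3)) * indicator {w x..} t \<partial>lborel) * ennreal ((w x)\<^sup>2)"
        by (rule nn_integral_multc) measurable
      also have "\<dots> = ennreal (s / (2 - s) * w x powr (s - 2)) * ennreal ((w x)\<^sup>2)"
        by (simp only: nn_integral_powr_to_inf[OF s wx])
      also have "\<dots> = ennreal (s / (2 - s) * (w x powr (s - 2) * (w x)\<^sup>2))"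
        using s by (simp add: ennreal_mult[symmetric] mult.assoc)
      also have "w x powr (s - 2) * (w x)\<^sup>2 = w x powr s"
        using wx by (simp flip: powr_numeral powr_add)
      finally show ?thesis using s by (simp only: ennreal_mult' divide_nonneg_nonneg less_imp_le diff_ge_0_iff_ge)
    qed
  qed
  also have "\<dots> = ennreal (s / (2 - s)) * (\<integral>\<^sup>+ x. ennreal (w x powr s) \<partial>M)"
    by (rule nn_integral_cmult) measurable
  finally show ?thesis .
qed

text \<open>The interpolation step: a distributional inequality that compares \<open>u\<close> with both the level sets of \<open>w\<close>
and its truncated second moments implies strong bounds for all exponents below \<open>2\<close>.\<close>
lemma strong_from_distribution:
  fixes u w :: "'a \<Rightarrow> real"
  assumes sf: "sigma_finite_measure M" and um [measurable]: "u \<in> borel_measurable M" and wm [measurable]: "w \<in> borel_measurable M"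
    and u: "\<And>x. 0 \<le> u x" and w: "\<And>x. 0 \<le> w x" and s: "0 < s" "s < 2" and AB: "0 \<le> A" "0 \<le> B"
    and weak: "\<And>t. 0 < t \<Longrightarrow> emeasure M {x \<in> space M. t \<le> u x} \<le> ennreal A * emeasure M {x \<in> space M. t \<le> w x}
       + ennreal (B / t\<^sup>2) * (\<integral>\<^sup>+ x. ennreal ((w x)\<^sup>2) * indicator {x. w x \<le> t} x \<partial>M)"
  shows "(\<integral>\<^sup>+ x. ennreal (u x powr s) \<partial>M) \<le> ennreal (A + B * (s / (2
      - s))) * (\<integral>\<^sup>+ x. ennreal (w x powr s) \<partial>M)"
proof -
  interpret M: sigma_finite_measure M by fact
  interpret P: pair_sigma_finite M lborel by standard
  let ?K = "\<lambda>t::real. ennreal (s * t powr (s - 1)) * indicator {0..} t"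
  let ?E = "\<lambda>t. emeasure M {x \<in> space M. t \<le> w x}"
  let ?J = "\<lambda>t. \<integral>\<^sup>+ x. ennreal ((w x)\<^sup>2) * indicator {x. w x \<le> t} x \<partial>M"
  let ?L = "\<lambda>t::real. ennreal (s * t powr (s - 3)) * indicator {0<..} t"
  have Em [measurable]: "?E \<in> borel_measurable lborel"
  proof -
    have "?E = (\<lambda>t. \<integral>\<^sup>+ x. (if t \<le> w x then 1 else 0) \<partial>M)"
    proof
      fix t
      have "(\<integral>\<^sup>+ x. (if t \<le> w x then 1 else 0) \<partial>M) = (\<integral>\<^sup>+ x. indicator {x \<in> space M. t
          \<le> w x} x \<partial>M)"
        by (intro nn_integral_cong) (auto simp: indicator_def)
      then show "?E t = (\<integral>\<^sup>+ x. (if t \<le> w x then 1 else 0) \<partial>M)" by simp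
    qed
    also have "\<dots> \<in> borel_measurable lborel" by measurable
    finally show ?thesis .
  qed
  have Jm [measurable]: "?J \<in> borel_measurable lborel"
  proof -
    have "?J = (\<lambda>t. \<integral>\<^sup>+ x. ennreal ((w x)\<^sup>2) * (if w x \<le> t then 1 else 0) \<partial>M)"
      by (intro ext nn_integral_cong) (auto simp: indicator_def)
    also have "\<dots> \<in> borel_measurable lborel" by measurable
    finally show ?thesis .
  qed
  have "(\<integral>\<^sup>+ x. ennreal (u x powr s) \<partial>M) = (\<integral>\<^sup>+ t. ?K t * emeasure M {x \<in> space M. t
      \<le> u x} \<partial>lborel)"
    by (rule layer_cake[OF sf um u s(1)])
  also have "\<dots> \<le> (\<integral>\<^sup>+ t. ennreal A * (?K t * ?E t) + ennreal B * (?L t * ?J t) \<partial>lborel)"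
  proof (rule nn_integral_mono)
    fix t :: real
    show "?K t * emeasure M {x \<in> space M. t \<le> u x} \<le> ennreal A * (?K t * ?E t) + ennreal B * (?L t * ?J t)"
    proof (cases "0 < t")
      case True
      have "?K t * emeasure M {x \<in> space M. t \<le> u x} \<le> ?K t * (ennreal A * ?E t + ennreal (B / t\<^sup>2) * ?J t)"
        by (intro mult_left_mono weak True) simp
      also have "\<dots> = ennreal A * (?K t * ?E t) + (?K t * ennreal (B / t\<^sup>2)) * ?J t"
        by (simp only: distrib_left mult_ac)
      also have "?K t * ennreal (B / t\<^sup>2) = ennreal B * ?L t"
      proof -
        have "t powr (s - 3) * t\<^sup>2 = t powr (s - 1)" using True by (simp flip: powr_numeral powr_add)
        then have "s * t powr (s - 1) * (B / t\<^sup>2) = B * (s * t powr (s - 3))" using True by (simp add: field_simps)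
        moreover have "ennreal (s * t powr (s - 1)) * ennreal (B / t\<^sup>2) = ennreal (s * t powr (s - 1) * (B / t\<^sup>2))"
          using AB s by (intro ennreal_mult[symmetric]) auto
        moreover have "ennreal B * ennreal (s * t powr (s - 3)) = ennreal (B * (s * t powr (s - 3)))"
          using AB s by (intro ennreal_mult[symmetric]) auto
        ultimately show ?thesis using True by simp
      qed
      finally show ?thesis by (simp only: mult.assoc)
    next
      case False
      then have "?K t = 0" by (auto simp: indicator_def)
      then have "?K t * emeasure M {x \<in> space M. t \<le> u x} = 0" by (simp only: mult_zero_left)
      then show ?thesis by (simp only: zero_le)
    qed
  qed
  also have "\<dots> = ennreal A * (\<integral>\<^sup>+ t. ?K t * ?E t \<partial>lborel)
      + ennreal B * (\<integral>\<^sup>+ t. ?L t * ?J t \<partial>lborel)"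
    by (subst nn_integral_add) (auto simp: nn_integral_cmult)
  also have "\<dots> = ennreal A * (\<integral>\<^sup>+ x. ennreal (w x powr s) \<partial>M) + ennreal B * (ennreal (s / (2
      - s)) * (\<integral>\<^sup>+ x. ennreal (w x powr s) \<partial>M))"
    by (simp only: layer_cake[OF sf wm w s(1)] truncated_square_layer_cake[OF sf wm w s])
  also have "\<dots> = ennreal (A + B * (s / (2 - s))) * (\<integral>\<^sup>+ x. ennreal (w x powr s) \<partial>M)"
  proof -
    have "ennreal (A + B * (s / (2 - s))) = ennreal A + ennreal B * ennreal (s / (2 - s))"
      using AB s by (subst ennreal_plus) (auto simp: ennreal_mult simp del: times_divide_eq_right)
    then show ?thesis by (simp only: distrib_right mult.assoc)
  qed
  finally show ?thesis .
qed

section \<open>Powers of extended nonnegative reals\<close>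

lemma enn_powr_ennreal: "0 \<le> t \<Longrightarrow> enn_powr (ennreal t) s = ennreal (t powr s)"
  by (simp add: enn_powr_def)

lemma enn_powr_cases:
  obtains "a = \<top>" | t where "0 \<le> t" "a = ennreal t"
  by (cases a) auto

lemma enn_powr_top: "enn_powr \<top> s = \<top>"
  by (simp add: enn_powr_def)

lemma enn_powr_mono: "0 < s \<Longrightarrow> a \<le> b \<Longrightarrow> enn_powr a s \<le> enn_powr b s"
  by (cases a rule: enn_powr_cases; cases b rule: enn_powr_cases)
    (auto simp: enn_powr_ennreal enn_powr_top powr_mono2 top_unique)

lemma enn_powr_powr: "0 < s \<Longrightarrow> 0 < t \<Longrightarrow> enn_powr (enn_powr a s) t = enn_powr a (s * t)"
  by (cases a rule: enn_powr_cases) (auto simp: enn_powr_ennreal enn_powr_top powr_powr)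

lemma enn_powr_1: "enn_powr a 1 = a"
  by (cases a rule: enn_powr_cases) (auto simp: enn_powr_ennreal enn_powr_top)

lemma enn_powr_inverse:
  assumes "0 < s" shows "enn_powr (enn_powr a s) (1 / s) = a" "enn_powr (enn_powr a (1 / s)) s = a"
  using assms by (simp_all add: enn_powr_powr enn_powr_1)

text \<open>Raising to a positive power is an order isomorphism; this yields the compatibility with suprema.\<close>
lemma enn_powr_le_iff: "0 < s \<Longrightarrow> enn_powr a s \<le> b \<longleftrightarrow> a \<le> enn_powr b (1 / s)"
  using enn_powr_mono[of s a "enn_powr b (1 / s)"] enn_powr_mono[of "1 / s" "enn_powr a s" b]
  by (auto simp: enn_powr_inverse)

lemma enn_powr_less_top_iff: "enn_powr a s < \<infinity> \<longleftrightarrow> a < \<infinity>"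
  by (cases a rule: enn_powr_cases) (auto simp: enn_powr_ennreal enn_powr_top)

lemma enn_powr_cmult:
  assumes "0 < s" "0 \<le> C" shows "enn_powr (ennreal C * a) s \<le> ennreal (C powr s) * enn_powr a s"
proof (cases a rule: enn_powr_cases)
  case 1
  show ?thesis
  proof (cases "C = 0")
    case True then show ?thesis using 1 by (simp add: enn_powr_def)
  next
    case False
    then have "ennreal (C powr s) * enn_powr a s = \<top>" using assms by (simp add: 1 enn_powr_top ennreal_mult_top)
    then show ?thesis by simp
  qed
next
  case (2 t)
  then show ?thesis using assms by (simp add: enn_powr_ennreal powr_mult flip: ennreal_mult)
qed

lemma enn_powr_SUP:
  assumes "0 < s" shows "enn_powr (SUP k. a k) s = (SUP k. enn_powr (a k) s)"
proof (rule antisym)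
  have "a k \<le> enn_powr (SUP k. enn_powr (a k) s) (1 / s)" for k
    unfolding enn_powr_le_iff[OF assms, symmetric] by (rule SUP_upper) simp
  then show "enn_powr (SUP k. a k) s \<le> (SUP k. enn_powr (a k) s)"
    unfolding enn_powr_le_iff[OF assms] by (rule SUP_least)
  show "(SUP k. enn_powr (a k) s) \<le> enn_powr (SUP k. a k) s"
    by (intro SUP_least enn_powr_mono assms SUP_upper) simp
qed

lemma enn_powr_measurable [measurable]:
  assumes [measurable]: "f \<in> borel_measurable M" shows "(\<lambda>x. enn_powr (f x) s) \<in> borel_measurable M"
  unfolding enn_powr_def by measurable

lemma Lp_norm_eq: "Lp_norm s g = enn_powr (\<integral>\<^sup>+ x. ennreal (norm (g x) powr s) \<partial>cube_measure) (1 / s)"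
  by (simp add: Lp_norm_def Lp_norm_enn_def enn_powr_ennreal)

lemma Lp_norm_enn_powr: "0 < s \<Longrightarrow> enn_powr (Lp_norm s g) s
    = (\<integral>\<^sup>+ x. ennreal (norm (g x) powr s) \<partial>cube_measure)"
  by (simp add: Lp_norm_eq enn_powr_inverse)

text \<open>The constant indices are cofinal, so that the square function is a limit of an increasing sequence.\<close>
lemma square_sum_SUP:
  fixes c :: "('d::finite \<Rightarrow> nat) \<Rightarrow> ennreal"
  shows "(\<Sum>\<^sub>\<infinity>n\<in>UNIV. c n) = (SUP k. \<Sum>n | n \<le> (\<lambda>_. k). c n)"
proof -
  have "(\<Sum>\<^sub>\<infinity>n\<in>UNIV. c n) = (SUP F\<in>{F. finite F \<and> F \<subseteq> UNIV}. sum c F)"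
    by (rule nonneg_infsum_complete) simp
  also have "\<dots> = (SUP k. \<Sum>n | n \<le> (\<lambda>_. k). c n)"
  proof (rule antisym)
    show "(SUP F\<in>{F. finite F \<and> F \<subseteq> UNIV}. sum c F) \<le> (SUP k. \<Sum>n | n \<le> (\<lambda>_. k). c n)"
    proof (rule SUP_least)
      fix F :: "('d \<Rightarrow> nat) set" assume "F \<in> {F. finite F \<and> F \<subseteq> UNIV}"
      then have F: "finite F" by simp
      \<comment> \<open>the element \<open>0\<close> keeps the maximum defined when \<open>F\<close> is empty\<close>
      let ?k = "Max (insert 0 (\<Union>n\<in>F. range n))"
      have "F \<subseteq> {n. n \<le> (\<lambda>_. ?k)}"
      proof
        fix n assume n: "n \<in> F"
        have "n d \<le> ?k" for d using F n by (intro Max_ge) auto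
        then show "n \<in> {n. n \<le> (\<lambda>_. ?k)}" by (simp add: le_fun_def)
      qed
      then have "sum c F \<le> (\<Sum>n | n \<le> (\<lambda>_. ?k). c n)" by (intro sum_mono2) auto
      also have "\<dots> \<le> (SUP k. \<Sum>n | n \<le> (\<lambda>_. k). c n)" by (rule SUP_upper) simp
      finally show "sum c F \<le> (SUP k. \<Sum>n | n \<le> (\<lambda>_. k). c n)" .
    qed
    show "(SUP k. \<Sum>n | n \<le> (\<lambda>_. k). c n) \<le> (SUP F\<in>{F. finite F \<and> F \<subseteq> UNIV}. sum c F)"
      by (rule SUP_least) (rule SUP_upper, simp)
  qed
  finally show ?thesis .
qed

section \<open>Local operators\<close>

context vilenkin_system begin

text \<open>Regularity of the filtration: the coarser cell contains the finer one and is at most \<open>R\<close> times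
larger.\<close>
lemma avg_regular:
  fixes f :: "real^'d \<Rightarrow> real"
  assumes x: "x \<in> unit_cube" and f: "integrable \<mu> f" "\<And>y. y \<in> unit_cube \<Longrightarrow> 0 \<le> f y"
    and R: "ncells n \<le> R * ncells (pred_index n)"
  shows "avg n f x \<le> R * avg (pred_index n) f x"
proof -
  let ?m = "pred_index n"
  have sub: "atom n x \<subseteq> atom ?m x"
    unfolding atom_def using cell_mono_eq[OF _ x, of _ ?m n] by (auto simp: pred_index_def le_fun_def)
  have "(LINT y|\<mu>. indicator (atom n x) y *\<^sub>R f y) \<le> (LINT y|\<mu>. indicator (atom ?m x) y *\<^sub>R f y)"
  proof (intro integral_cube_mono integrable_atom x f)
    fix y :: "real^'d" assume "y \<in> unit_cube"
    then show "indicator (atom n x) y *\<^sub>R f y \<le> indicator (atom ?m x) y *\<^sub>R f y"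
      using sub f(2)[of y] by (auto simp: indicator_def)
  qed
  then have "avg n f x \<le> ncells n * (LINT y|\<mu>. indicator (atom ?m x) y *\<^sub>R f y)"
    using ncells_pos[of n] by (simp add: avg_def)
  also have "\<dots> \<le> (R * ncells ?m) * (LINT y|\<mu>. indicator (atom ?m x) y *\<^sub>R f y)"
    by (intro mult_right_mono R Bochner_Integration.integral_nonneg) (simp_all add: f(2))
  finally show ?thesis by (simp add: avg_def)
qed

lemma exceptional_sets_step:
  assumes e: "e = {x \<in> unit_cube. avg n g x > (c::real)}"
  shows "step n (\<lambda>x. x \<in> e)"
proof (rule stepI)
  fix x y :: "real^'d" assume xy: "x \<in> unit_cube" "y \<in> unit_cube" "cell n x = cell n y"
  then show "(x \<in> e) = (y \<in> e)" using stepD[OF step_avg xy, of g] by (simp add: e)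
qed

text \<open>Off the exceptional set \<open>e n\<close>, the set \<open>{w > t}\<close> occupies at most the fraction \<open>1 / (2 * R)\<close> of the
coarser cell, hence by regularity at most half of each cell of generation \<open>n\<close>.  So the mass of
\<open>(norm (mdiff f n x))\<^sup>2\<close> on such a cell is at most twice its mass on \<open>{w \<le> t}\<close>.  By orthogonality
these masses add up to the second moment of the transform, whereas on \<open>{w \<le> t}\<close> their sum is at most
\<open>w\<^sup>2\<close>.\<close>
lemma transform_L2_bound:
  assumes f: "vmartingale p f" and wm: "w \<in> borel_measurable \<mu>" and w0: "\<And>x. 0 \<le> w x"
    and sq: "AE x in \<mu>. \<forall>n. (\<Sum>m | m \<le> n. (norm (mdiff f m x))\<^sup>2) \<le> (w x)\<^sup>2"
    and R: "\<And>n. ncells n \<le> R * ncells (pred_index n)" and R0: "0 < R"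
    and e: "\<And>n. e n = {x \<in> unit_cube. avg (pred_index n) (indicator {x \<in> unit_cube. t < w x}) x > 1 / (2 * R)}"
  shows "predictable (\<lambda>n x. if x \<in> e n then 0 else (1::complex))"
    and "integrable \<mu> (\<lambda>x. (w x)\<^sup>2 * indicator {x. w x \<le> t} x)"
    and "(LINT x|\<mu>. (norm (transform (\<lambda>n x. if x \<in> e n then 0 else 1) f n x))\<^sup>2)
      \<le> 2 * (LINT x|\<mu>. (w x)\<^sup>2 * indicator {x. w x \<le> t} x)"
proof -
  let ?a = "\<lambda>n x. if x \<in> e n then 0 else (1::complex)"
  let ?I = "indicator {x \<in> unit_cube. t < w x} :: real^'d \<Rightarrow> real"
  let ?J = "indicator {x. w x \<le> t} :: real^'d \<Rightarrow> real"
  show a: "predictable ?a"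
    unfolding predictable_def
    by (intro allI step_comp[OF exceptional_sets_step[OF e], where F = "\<lambda>b. if b then 0 else 1"])
  have Js: "{x \<in> space \<mu>. w x \<le> t} \<in> sets \<mu>" using wm by measurable
  have Is: "{x \<in> space \<mu>. t < w x} \<in> sets \<mu>" using wm by measurable
  have iI: "integrable \<mu> ?I"
    using Is by (intro integrable_real_indicator) (auto simp: cube.emeasure_eq_measure)
  have Jm: "?J \<in> borel_measurable \<mu>"
    using Js by (subst borel_measurable_indicator_iff) (simp add: Int_def conj_commute)
  have iJ: "integrable \<mu> ?J"
    by (rule cube.integrable_const_bound[where B = 1]) (use Jm in \<open>auto simp: indicator_def\<close>)
  show iw: "integrable \<mu> (\<lambda>x. (w x)\<^sup>2 * ?J x)"
  proof (rule cube.integrable_const_bound[where B = "t\<^sup>2"])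
    show "(\<lambda>x. (w x)\<^sup>2 * ?J x) \<in> borel_measurable \<mu>"
      using wm Jm by measurable
    show "AE x in \<mu>. norm ((w x)\<^sup>2 * ?J x) \<le> t\<^sup>2"
    proof (rule AE_I2)
      fix x
      show "norm ((w x)\<^sup>2 * ?J x) \<le> t\<^sup>2"
        using power_mono[OF _ w0, of x t 2] by (auto simp: indicator_def)
    qed
  qed
  have step_sq: "step m (\<lambda>x. (norm (mdiff f m x))\<^sup>2)" for m
    by (rule step_comp[OF mdiff_step[OF f], where F = "\<lambda>z. (norm z)\<^sup>2"])
  have imJ: "integrable \<mu> (\<lambda>x. (norm (mdiff f m x))\<^sup>2 * ?J x)" for m
    using integrable_step_scale[OF step_sq iJ] by simp
  have term_le: "(LINT x|\<mu>. (norm (?a m x * mdiff f m x))\<^sup>2) \<le> 2 * (LINT x|\<mu>. (norm (mdiff f m x))\<^sup>2 * ?J x)" for m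
  proof -
    have half: "1 / 2 \<le> avg m ?J x" if x: "x \<in> unit_cube" "x \<notin> e m" for x
    proof -
      have "avg m ?I x \<le> R * avg (pred_index m) ?I x"
        by (rule avg_regular[OF x(1) iI _ R]) simp
      also have "\<dots> \<le> R * (1 / (2 * R))"
        using x R0 by (intro mult_left_mono) (auto simp: e)
      finally have "avg m ?I x \<le> 1 / 2" using R0 by simp
      moreover have "avg m ?J x = avg m (\<lambda>y. 1 - ?I y) x"
        by (intro fun_cong[OF avg_cong]) (auto simp: indicator_def)
      moreover have "\<dots> = avg m (\<lambda>_. 1) x - avg m ?I x"
        by (rule avg_diff[OF x(1) _ iI]) simp
      moreover have "avg m (\<lambda>_. 1::real) x = 1" by (rule avg_step[OF step_const x(1)])
      ultimately show ?thesis by simp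
    qed
    have "(LINT x|\<mu>. (norm (?a m x * mdiff f m x))\<^sup>2) \<le> (LINT x|\<mu>. 2 * ((norm (mdiff f m x))\<^sup>2 * avg m ?J x))"
    proof (rule integral_cube_mono)
      show "integrable \<mu> (\<lambda>x. (norm (?a m x * mdiff f m x))\<^sup>2)"
        by (rule step_integrable[OF step_comp[OF transform_term_step[OF f a], where F = "\<lambda>z. (norm z)\<^sup>2"]])
      have "step m (\<lambda>x. 2 * ((norm (mdiff f m x))\<^sup>2 * avg m ?J x))"
        by (rule step_comp2[OF step_sq step_avg, where F = "\<lambda>u v. 2 * (u * v)"])
      then show "integrable \<mu> (\<lambda>x. 2 * ((norm (mdiff f m x))\<^sup>2 * avg m ?J x))" by (rule step_integrable)
      fix x :: "real^'d" assume x: "x \<in> unit_cube"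
      show "(norm (?a m x * mdiff f m x))\<^sup>2 \<le> 2 * ((norm (mdiff f m x))\<^sup>2 * avg m ?J x)"
      proof (cases "x \<in> e m")
        case True
        then show ?thesis using avg_nonneg[of ?J m x] by simp
      next
        case False
        have "(norm (mdiff f m x))\<^sup>2 * (1 / 2) \<le> (norm (mdiff f m x))\<^sup>2 * avg m ?J x"
          by (rule mult_left_mono[OF half[OF x False]]) simp
        then show ?thesis using False by simp
      qed
    qed
    also have "\<dots> = 2 * (LINT x|\<mu>. (norm (mdiff f m x))\<^sup>2 * avg m ?J x)" by (rule integral_mult_right_zero)
    also have "(LINT x|\<mu>. (norm (mdiff f m x))\<^sup>2 * avg m ?J x) = (LINT x|\<mu>. (norm (mdiff f m x))\<^sup>2 * ?J x)"
      by (rule integral_step_mult_avg[OF step_sq imJ])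
    finally show ?thesis .
  qed
  have "(LINT x|\<mu>. (norm (transform ?a f n x))\<^sup>2) = (\<Sum>m | m \<le> n. LINT x|\<mu>. (norm (?a m x * mdiff f m x))\<^sup>2)"
    by (rule transform_L2[OF f a])
  also have "\<dots> \<le> (\<Sum>m | m \<le> n. 2 * (LINT x|\<mu>. (norm (mdiff f m x))\<^sup>2 * ?J x))"
    by (rule sum_mono) (rule term_le)
  also have "\<dots> = 2 * (LINT x|\<mu>. (\<Sum>m | m \<le> n. (norm (mdiff f m x))\<^sup>2 * ?J x))"
    by (subst Bochner_Integration.integral_sum[OF imJ]) (rule sum_distrib_left[symmetric])
  also have "\<dots> \<le> 2 * (LINT x|\<mu>. (w x)\<^sup>2 * ?J x)"
  proof (intro mult_left_mono integral_mono_AE iw Bochner_Integration.integrable_sum imJ)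
    show "AE x in \<mu>. (\<Sum>m | m \<le> n. (norm (mdiff f m x))\<^sup>2 * ?J x) \<le> (w x)\<^sup>2 * ?J x"
      using sq
    proof eventually_elim
      case (elim x)
      then have "(\<Sum>m | m \<le> n. (norm (mdiff f m x))\<^sup>2) * ?J x \<le> (w x)\<^sup>2 * ?J x"
        by (intro mult_right_mono) auto
      then show ?case by (simp only: sum_distrib_right)
    qed
  qed simp
  finally show "(LINT x|\<mu>. (norm (transform ?a f n x))\<^sup>2) \<le> 2 * (LINT x|\<mu>. (w x)\<^sup>2 * ?J x)" .
qed

lemma vmart_measurable: "vmartingale p f \<Longrightarrow> mdiff f n \<in> borel_measurable \<mu>"
  by (rule borel_measurable_integrable[OF step_integrable[OF mdiff_step]])

lemma Lp_norm_step:
  assumes "step n g"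
  shows "(\<integral>\<^sup>+ x. ennreal (norm (g x) powr s) \<partial>\<mu>) = ennreal (LINT x|\<mu>. norm (g x) powr s)"
  by (rule nn_integral_eq_integral[OF step_integrable[OF step_comp[OF assms, where F = "\<lambda>z. norm z powr s"]]]) simp

text \<open>One set \<open>e n\<close> serves for all blocks \<open>l\<close> of the generation \<open>n\<close>.  The generation \<open>0\<close> does not contribute
to the union, since its only difference \<open>f 0\<close> is zero.\<close>
definition local_on :: "('d family \<Rightarrow> real ^ 'd \<Rightarrow> complex) \<Rightarrow> bool" where
  "local_on V \<longleftrightarrow> (\<forall>f e. vmartingale p f \<longrightarrow> 
       (\<forall>x\<in>unit_cube. f (\<lambda>d. 0) x = 0) \<longrightarrow>
       (\<forall>n. e n \<in> sets (vfiltration p (pred_index n)) \<and>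
          (\<forall>l\<in>L_index p n. \<forall>x\<in>unit_cube.
             mod_mdiff p f n l x = indicator (e n) x * mod_mdiff p f n l x)) \<longrightarrow>
       (AE x in \<mu>. norm (V f x) > 0 \<longrightarrow> x \<in> (\<Union>n\<in>UNIV - {\<lambda>d. 0}. e n)))"

text \<open>The splitting at the level \<open>t\<close>.  Let \<open>\<Omega> = {w > t}\<close>, let \<open>e n\<close> be the exceptional set of the index \<open>n\<close>,
and \<open>U\<close> the set where some average of the indicator of \<open>\<Omega>\<close> is large; it contains all sets \<open>e n\<close>.  The transform \<open>h\<close> keeps the differences off the sets \<open>e n\<close> and
is controlled in \<open>L\<^sup>2\<close>; the remaining part \<open>g = f - h\<close> has its differences supported in the sets \<open>e n\<close>, so
that by locality \<open>V g\<close> vanishes off \<open>U\<close>, which is small by the strong maximal inequality.\<close>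
lemma weak_estimate:
  assumes lin: "linear_operator p V" and loc: "local_on V"
    and bdd: "\<And>h. vmartingale p h \<Longrightarrow> mart_L_norm 2 h < \<infinity> \<Longrightarrow> Lp_norm 2 (V h)
        \<le> ennreal C * mart_L_norm 2 h" and C: "0 \<le> C"
    and f: "vmartingale p f" and wm: "w \<in> borel_measurable \<mu>" and w0: "\<And>x. 0 \<le> w x"
    and sq: "AE x in \<mu>. \<forall>n. (\<Sum>m | m \<le> n. (norm (mdiff f m x))\<^sup>2) \<le> (w x)\<^sup>2"
    and R: "\<And>n. ncells n \<le> R * ncells (pred_index n)" and R0: "0 < R" and t: "0 < t"
  shows "emeasure \<mu> {x \<in> space \<mu>. t \<le> norm (V f x)}
    \<le> ennreal (4 ^ CARD('d) * (2 * R)\<^sup>2) * emeasure \<mu> {x \<in> space \<mu>. t \<le> w x}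
      + ennreal (2 * C\<^sup>2 / t\<^sup>2) * (\<integral>\<^sup>+ x. ennreal ((w x)\<^sup>2) * indicator {x. w x \<le> t} x \<partial>\<mu>)"
proof -
  define \<Omega> where "\<Omega> = {x \<in> unit_cube. t < w x}"
  define c where "c = 1 / (2 * R)"
  define e where "e n = {x \<in> unit_cube. avg (pred_index n) (indicator \<Omega>) x > c}" for n
  define U where "U = (\<Union>n. {x \<in> unit_cube. avg n (indicator \<Omega>) x > c})"
  let ?A = "4 ^ CARD('d) * (2 * R)\<^sup>2"
  let ?N = "emeasure \<mu> {x \<in> space \<mu>. t \<le> w x}"
  let ?J = "\<lambda>x. (w x)\<^sup>2 * indicator {x. w x \<le> t} x :: real"
  have c0: "0 < c" using R0 by (simp add: c_def)
  have Vm: "V h \<in> borel_measurable \<mu>" if "vmartingale p h" for h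
    using lin that by (simp add: linear_operator_def)
  have "{x \<in> space \<mu>. t < w x} \<in> sets \<mu>" using wm by measurable
  then have \<Omega>s: "\<Omega> \<in> sets \<mu>" by (simp add: \<Omega>_def)
  have Us: "U \<in> sets \<mu>" unfolding U_def by (rule maximal_measure(1)[OF \<Omega>s c0])
  have "measure \<mu> U \<le> ?A * measure \<mu> \<Omega>"
  proof -
    have "4 ^ CARD('d) / c\<^sup>2 = ?A" by (simp add: c_def power2_eq_square)
    then show ?thesis using maximal_measure(2)[OF \<Omega>s c0] unfolding U_def by (simp only:)
  qed
  also have "\<dots> \<le> ?A * measure \<mu> {x \<in> space \<mu>. t \<le> w x}"
  proof (intro mult_left_mono cube.finite_measure_mono)
    show "{x \<in> space \<mu>. t \<le> w x} \<in> sets \<mu>" using wm by measurable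
  qed (auto simp: \<Omega>_def)
  finally have Ubound: "emeasure \<mu> U \<le> ennreal ?A * ?N"
    by (simp add: cube.emeasure_eq_measure flip: ennreal_mult)
  have eU: "e n \<subseteq> U" for n unfolding e_def U_def by blast
  \<comment> \<open>locality requires \<open>g 0 = 0\<close>, that is, an empty exceptional set in generation \<open>0\<close>\<close>
  show ?thesis
  proof (cases "e (\<lambda>_. 0) = {}")
    case False
    \<comment> \<open>the cube is the only cell of generation \<open>0\<close>; if it is exceptional, then \<open>U\<close> is the whole cube\<close>
    then obtain x0 where x0: "x0 \<in> e (\<lambda>_. 0)" by blast
    have p0: "pred_index (\<lambda>_::'d. 0) = (\<lambda>_. 0)" by (simp add: pred_index_def)
    have "x \<in> e (\<lambda>_. 0)" if x: "x \<in> unit_cube" for x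
    proof -
      have x0c: "x0 \<in> unit_cube" using x0 by (simp add: e_def)
      have "cell (\<lambda>_. 0) x = cell (\<lambda>_. 0) x0" using cube_nonneg[OF x] cube_nonneg[OF x0c] by (simp add: cell_def icell_0)
      then show ?thesis
        using stepD[OF exceptional_sets_step[OF e_def[of "\<lambda>_. 0", unfolded p0]] x x0c] x0 by simp
    qed
    then have "unit_cube \<subseteq> U" using eU by blast
    then have "emeasure \<mu> {x \<in> space \<mu>. t \<le> norm (V f x)} \<le> emeasure \<mu> U"
      by (intro emeasure_mono Us) auto
    also have "\<dots> \<le> ennreal ?A * ?N" by (rule Ubound)
    finally show ?thesis by (rule order_trans) simp
  next
    case True
    define a where "a = (\<lambda>n x. if x \<in> e n then 0 else (1::complex))"
    define h where "h = transform a f"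
    define g where "g = (\<lambda>n x. f n x - h n x)"
    note L2 = transform_L2_bound[OF f wm w0 sq R R0 e_def[unfolded c_def \<Omega>_def], folded a_def c_def \<Omega>_def]
    have hm: "vmartingale p h" unfolding h_def by (rule vmart_transform[OF f L2(1)])
    have gm: "vmartingale p g" unfolding g_def by (rule vmart_diff[OF f hm])
    have mg: "mdiff g n x = (if x \<in> e n then mdiff f n x else 0)" for n x
      unfolding g_def mdiff_diff h_def mdiff_transform by (simp add: a_def)
    have "AE x in \<mu>. norm (V g x) > 0 \<longrightarrow> x \<in> (\<Union>n\<in>UNIV - {\<lambda>d. 0}. e n)"
    proof -
      have supp: "mod_mdiff p g n l x = indicator (e n) x * mod_mdiff p g n l x"
        if l: "l \<in> L_index p n" and x: "x \<in> unit_cube" for n l x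
      proof (cases "x \<in> e n")
        case False
        have "mod_mdiff p g n l x = 0"
        proof (rule mod_mdiff_eq_0[OF gm x l])
          fix y assume y: "y \<in> atom (pred_index n) x"
          have "(y \<in> e n) = (x \<in> e n)" by (rule step_atomD[OF exceptional_sets_step[OF e_def] x y])
          then show "mdiff g n y = 0" using False by (simp add: mg)
        qed
        then show ?thesis by simp
      qed simp
      show ?thesis
      proof (rule loc[unfolded local_on_def, THEN spec, THEN spec, THEN mp, THEN mp, THEN mp])
        show "vmartingale p g" by (rule gm)
        show "\<forall>x\<in>unit_cube. g (\<lambda>d. 0) x = 0"
          using mdiff_0[of g] mg[of "\<lambda>d. 0"] True by simp
        show "\<forall>n. e n \<in> sets (vfiltration p (pred_index n)) \<and> (\<forall>l\<in>L_index p n. \<forall>x\<in>unit_cube.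
            mod_mdiff p g n l x = indicator (e n) x * mod_mdiff p g n l x)"
        proof (intro allI conjI ballI)
          fix n
          show "e n \<in> sets (vfiltration p (pred_index n))"
            unfolding vfiltration_sets_iff using exceptional_sets_step[OF e_def] by (auto simp: e_def)
        qed (rule supp)
      qed
    qed
    moreover have "AE x in \<mu>. V f x = V g x + V h x"
    proof -
      have "AE x in \<mu>. V (\<lambda>n y. g n y + h n y) x = V g x + V h x"
        using lin gm hm by (simp add: linear_operator_def)
      moreover have "(\<lambda>n y. g n y + h n y) = f" by (simp add: g_def)
      ultimately show ?thesis by simp
    qed
    ultimately have "AE x in \<mu>. t \<le> norm (V f x) \<longrightarrow> x \<in> U \<union> {x \<in> space \<mu>. t \<le> norm (V h x)}"
      using AE_space[of \<mu>]
    proof eventually_elim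
      case (elim x)
      show ?case
      proof (rule impI)
        assume tx: "t \<le> norm (V f x)"
        show "x \<in> U \<union> {x \<in> space \<mu>. t \<le> norm (V h x)}"
        proof (cases "V g x = 0")
          case True then show ?thesis using elim tx by auto
        next
          case False then show ?thesis using elim eU by auto
        qed
      qed
    qed
    \<comment> \<open>off \<open>U\<close> the functions \<open>V f\<close> and \<open>V h\<close> agree\<close>
    then have cover: "AE x in \<mu>. x \<in> {x \<in> space \<mu>. t \<le> norm (V f x)}
        \<longrightarrow> x \<in> U \<union> {x \<in> space \<mu>. t \<le> norm (V h x)}"
      by eventually_elim auto
    have Ts: "{x \<in> space \<mu>. t \<le> norm (V h x)} \<in> sets \<mu>" using Vm[OF hm] by measurable
    have "emeasure \<mu> {x \<in> space \<mu>. t \<le> norm (V f x)}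
        \<le> emeasure \<mu> (U \<union> {x \<in> space \<mu>. t \<le> norm (V h x)})"
      by (rule emeasure_mono_AE[OF cover sets.Un[OF Us Ts]])
    also have "\<dots> \<le> emeasure \<mu> U + emeasure \<mu> {x \<in> space \<mu>. t \<le> norm (V h x)}"
      by (rule emeasure_subadditive[OF Us Ts])
    also have "\<dots> \<le> ennreal ?A * ?N + emeasure \<mu> {x \<in> space \<mu>. t \<le> norm (V h x)}"
      by (intro add_right_mono Ubound)
    also have "emeasure \<mu> {x \<in> space \<mu>. t \<le> norm (V h x)}
      \<le> ennreal (2 * C\<^sup>2 / t\<^sup>2) * (\<integral>\<^sup>+ x. ennreal ((w x)\<^sup>2) * indicator {x. w x \<le> t} x \<partial>\<mu>)"
    proof -
      define J where "J = (LINT x|\<mu>. ?J x)"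
      have J0: "0 \<le> J" unfolding J_def by (rule Bochner_Integration.integral_nonneg) simp
      have nnJ: "(\<integral>\<^sup>+ x. ennreal ((w x)\<^sup>2) * indicator {x. w x \<le> t} x \<partial>\<mu>) = ennreal J"
      proof -
        have "(\<integral>\<^sup>+ x. ennreal ((w x)\<^sup>2) * indicator {x. w x \<le> t} x \<partial>\<mu>)
            = (\<integral>\<^sup>+ x. ennreal (?J x) \<partial>\<mu>)"
          by (intro nn_integral_cong) (auto simp: indicator_def)
        also have "\<dots> = ennreal J" unfolding J_def by (rule nn_integral_eq_integral[OF L2(2)]) simp
        finally show ?thesis .
      qed
      have hL: "Lp_norm 2 (h n) \<le> ennreal ((2 * J) powr (1 / 2))" for n
      proof -
        have "(LINT x|\<mu>. norm (h n x) powr 2) \<le> 2 * J"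
          using L2(3)[of n] unfolding h_def J_def by simp
        then have "Lp_norm 2 (h n) \<le> enn_powr (ennreal (2 * J)) (1 / 2)"
          unfolding Lp_norm_eq Lp_norm_step[OF vmart_step[OF hm]] by (intro enn_powr_mono ennreal_leI) simp_all
        then show ?thesis using J0 by (simp add: enn_powr_ennreal)
      qed
      then have Hnorm: "mart_L_norm 2 h \<le> ennreal ((2 * J) powr (1 / 2))"
        unfolding mart_L_norm_def by (rule SUP_least)
      then have "mart_L_norm 2 h < \<infinity>" by (rule le_less_trans) simp
      then have "Lp_norm 2 (V h) \<le> ennreal C * mart_L_norm 2 h" by (rule bdd[OF hm])
      also have "\<dots> \<le> ennreal C * ennreal ((2 * J) powr (1 / 2))" by (rule mult_left_mono[OF Hnorm]) simp
      also have "\<dots> = ennreal (C * (2 * J) powr (1 / 2))" using C by (simp add: ennreal_mult)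
      finally have "enn_powr (Lp_norm 2 (V h)) 2 \<le> enn_powr (ennreal (C * (2 * J) powr (1 / 2))) 2"
        by (intro enn_powr_mono) simp_all
      also have "\<dots> = ennreal ((C * (2 * J) powr (1 / 2)) powr 2)" using C by (intro enn_powr_ennreal) simp
      also have "(C * (2 * J) powr (1 / 2)) powr 2 = C\<^sup>2 * (2 * J)"
      proof -
        have "(C * (2 * J) powr (1 / 2)) powr 2 = C powr 2 * ((2 * J) powr (1 / 2)) powr 2" by (rule powr_mult)
        also have "((2 * J) powr (1 / 2)) powr 2 = 2 * J" using J0 by (simp only: powr_powr) simp
        finally show ?thesis using C by simp
      qed
      finally have V2: "(\<integral>\<^sup>+ x. ennreal (norm (V h x) powr 2) \<partial>\<mu>) \<le> ennreal (C\<^sup>2 * (2 * J))"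
        by (subst (asm) Lp_norm_enn_powr) simp_all
      let ?T = "{x \<in> space \<mu>. t \<le> norm (V h x)}"
      have "ennreal (t\<^sup>2) * emeasure \<mu> ?T = (\<integral>\<^sup>+ x. ennreal (t\<^sup>2) * indicator ?T x \<partial>\<mu>)"
        using Ts by (simp add: nn_integral_cmult_indicator)
      also have "\<dots> \<le> (\<integral>\<^sup>+ x. ennreal (norm (V h x) powr 2) \<partial>\<mu>)"
      proof (rule nn_integral_mono)
        fix x :: "real^'d"
        show "ennreal (t\<^sup>2) * indicator ?T x \<le> ennreal (norm (V h x) powr 2)"
          using t by (cases "x \<in> ?T") (auto intro!: power_mono ennreal_leI)
      qed
      also note V2
      finally have "ennreal (1 / t\<^sup>2) * (ennreal (t\<^sup>2) * emeasure \<mu> ?T) \<le> ennreal (1 / t\<^sup>2) * ennreal (C\<^sup>2 * (2 * J))"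
        by (rule mult_left_mono) simp
      moreover have "ennreal (1 / t\<^sup>2) * (ennreal (t\<^sup>2) * emeasure \<mu> ?T) = emeasure \<mu> ?T"
      proof -
        have "ennreal (1 / t\<^sup>2) * ennreal (t\<^sup>2) = 1" using t by (simp flip: ennreal_mult)
        then show ?thesis by (simp only: mult.assoc[symmetric] mult_1)
      qed
      moreover have "ennreal (1 / t\<^sup>2) * ennreal (C\<^sup>2 * (2 * J)) = ennreal (2 * C\<^sup>2 / t\<^sup>2) * ennreal J"
        using J0 by (simp flip: ennreal_mult add: mult_ac)
      ultimately show ?thesis unfolding nnJ by simp
    qed
    finally show ?thesis by (simp add: add_left_mono)
  qed
qed

definition square_sum :: "'d family \<Rightarrow> real^'d \<Rightarrow> ennreal" where
  "square_sum f x = (\<Sum>\<^sub>\<infinity>n\<in>UNIV. ennreal ((norm (mdiff f n x))\<^sup>2))"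

lemma square_sum_eq_SUP: "square_sum f x = (SUP k. \<Sum>n | n \<le> (\<lambda>_. k). ennreal ((norm (mdiff f n x))\<^sup>2))"
  unfolding square_sum_def by (rule square_sum_SUP)

lemma square_sum_measurable:
  assumes "vmartingale p f" shows "square_sum f \<in> borel_measurable \<mu>"
proof -
  have [measurable]: "mdiff f n \<in> borel_measurable \<mu>" for n by (rule vmart_measurable[OF assms])
  show ?thesis unfolding square_sum_eq_SUP[abs_def] by measurable
qed

lemma mart_H_norm_eq:
  "0 < s \<Longrightarrow> mart_H_norm s f = enn_powr (\<integral>\<^sup>+ x. enn_powr (square_sum f x) (s / 2) \<partial>\<mu>) (1 / s)"
  unfolding mart_H_norm_def Lp_norm_enn_def square_sum_def[symmetric] by (simp add: enn_powr_powr)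

text \<open>The square function is finite almost everywhere and serves as \<open>w\<close> in the splitting.  Since the
splitting concerns \<open>f\<close> itself and not a limit of simpler martingales, no continuity of the operator
on \<open>H^s\<close> is involved.\<close>
lemma H_to_L:
  assumes lin: "linear_operator p V" and loc: "local_on V"
    and bdd: "\<And>h. vmartingale p h \<Longrightarrow> mart_L_norm 2 h < \<infinity> \<Longrightarrow> Lp_norm 2 (V h)
        \<le> ennreal C * mart_L_norm 2 h" and C: "0 \<le> C"
    and R: "\<And>n. ncells n \<le> R * ncells (pred_index n)" and R0: "0 < R" and s: "0 < s" "s < 2"
  shows "bounded_operator p V (mart_H_norm s) s"
proof -
  define A where "A = 4 ^ CARD('d) * (2 * R)\<^sup>2"
  define K where "K = A + 2 * C\<^sup>2 * (s / (2 - s))"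
  have A0: "0 \<le> A" by (simp add: A_def)
  have K0: "0 \<le> K" using A0 s by (simp add: K_def)
  have "Lp_norm s (V f) \<le> ennreal (K powr (1 / s)) * mart_H_norm s f"
    if f: "vmartingale p f" and fin: "mart_H_norm s f < \<infinity>" for f
  proof -
    note Sm [measurable] = square_sum_measurable[OF f]
    have Vm [measurable]: "V f \<in> borel_measurable \<mu>" using lin f by (simp add: linear_operator_def)
    let ?X = "\<integral>\<^sup>+ x. enn_powr (square_sum f x) (s / 2) \<partial>\<mu>"
    have "?X < \<infinity>" using fin s by (simp only: mart_H_norm_eq enn_powr_less_top_iff)
    then have "AE x in \<mu>. enn_powr (square_sum f x) (s / 2) \<noteq> \<infinity>"
      by (intro nn_integral_noteq_infinite) auto
    then have finite: "AE x in \<mu>. square_sum f x < \<infinity>"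
    proof eventually_elim
      case (elim x)
      then have "enn_powr (square_sum f x) (s / 2) < \<infinity>" by (simp only: less_top infinity_ennreal_def)
      then show ?case by (simp only: enn_powr_less_top_iff)
    qed
    define w where "w x = sqrt (enn2real (square_sum f x))" for x
    have wm [measurable]: "w \<in> borel_measurable \<mu>" unfolding w_def[abs_def] by measurable
    have w0: "0 \<le> w x" for x by (simp add: w_def)
    have wS: "ennreal ((w x)\<^sup>2) = square_sum f x" if "square_sum f x < \<infinity>" for x
      using that by (simp add: w_def)
    have sq: "AE x in \<mu>. \<forall>n. (\<Sum>m | m \<le> n. (norm (mdiff f m x))\<^sup>2) \<le> (w x)\<^sup>2"
      using finite
    proof eventually_elim
      case (elim x)
      show ?case
      proof
        fix n
        have "ennreal (\<Sum>m | m \<le> n. (norm (mdiff f m x))\<^sup>2) = (\<Sum>m | m \<le> n. ennreal ((norm (mdiff f m x))\<^sup>2))"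
          by (rule sum_ennreal[symmetric]) simp
        also have "\<dots> \<le> square_sum f x"
          unfolding square_sum_def by (subst nonneg_infsum_complete) (auto intro!: SUP_upper)
        finally have "ennreal (\<Sum>m | m \<le> n. (norm (mdiff f m x))\<^sup>2) \<le> ennreal ((w x)\<^sup>2)"
          by (simp only: wS[OF elim])
        then show "(\<Sum>m | m \<le> n. (norm (mdiff f m x))\<^sup>2) \<le> (w x)\<^sup>2" by simp
      qed
    qed
    have "(\<integral>\<^sup>+ x. ennreal (norm (V f x) powr s) \<partial>\<mu>)
        \<le> ennreal (A + 2 * C\<^sup>2 * (s / (2 - s))) * (\<integral>\<^sup>+ x. ennreal (w x powr s) \<partial>\<mu>)"
    proof (rule strong_from_distribution[OF cube.sigma_finite_measure_axioms _ wm _ w0 s A0])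
      show "(\<lambda>x. norm (V f x)) \<in> borel_measurable \<mu>" by measurable
      show "emeasure \<mu> {x \<in> space \<mu>. t \<le> norm (V f x)} \<le> ennreal A * emeasure \<mu> {x \<in> space \<mu>. t \<le> w x}
       + ennreal (2 * C\<^sup>2 / t\<^sup>2) * (\<integral>\<^sup>+ x. ennreal ((w x)\<^sup>2) * indicator {x. w x \<le> t} x \<partial>\<mu>)" if "0 < t" for t
        unfolding A_def by (rule weak_estimate[OF lin loc bdd C f wm w0 sq R R0 that])
    qed simp_all
    also have "(\<integral>\<^sup>+ x. ennreal (w x powr s) \<partial>\<mu>) = ?X"
    proof (rule nn_integral_cong_AE)
      show "AE x in \<mu>. ennreal (w x powr s) = enn_powr (square_sum f x) (s / 2)"
        using finite
      proof eventually_elim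
        case (elim x)
        have "enn_powr (square_sum f x) (s / 2) = ennreal (((w x)\<^sup>2) powr (s / 2))"
          unfolding wS[OF elim, symmetric] by (rule enn_powr_ennreal) simp
        also have "((w x)\<^sup>2) powr (s / 2) = w x powr s"
          using w0[of x] by (cases "w x = 0") (simp_all add: powr_powr flip: powr_numeral)
        finally show ?case ..
      qed
    qed
    finally have "Lp_norm s (V f) \<le> enn_powr (ennreal K * ?X) (1 / s)"
      unfolding Lp_norm_eq K_def using s by (intro enn_powr_mono) simp_all
    also have "\<dots> \<le> ennreal (K powr (1 / s)) * enn_powr ?X (1 / s)"
      using s K0 by (intro enn_powr_cmult) simp_all
    finally show ?thesis using s by (simp only: mart_H_norm_eq)
  qed
  then show ?thesis unfolding bounded_operator_def by (intro exI[of _ "K powr (1 / s)"]) simp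
qed

text \<open>The estimate of the square function passes from finitely many differences to all of them by
monotone convergence.\<close>
lemma H_norm_le_L_norm:
  assumes r: "1 < r" "r < 2" and f: "vmartingale p f"
  shows "mart_H_norm r f \<le> ennreal ((square_const r ^ CARD('d)) powr (1 / r)) * mart_L_norm r f"
proof -
  let ?C = "square_const r ^ CARD('d)"
  have C0: "0 \<le> ?C" using square_const_nonneg[OF r(1)] by simp
  have [measurable]: "mdiff f n \<in> borel_measurable \<mu>" for n by (rule vmart_measurable[OF f])
  let ?S = "\<lambda>k x. \<Sum>n | n \<le> (\<lambda>_. k). ennreal ((norm (mdiff f n x))\<^sup>2)"
  have "(\<integral>\<^sup>+ x. enn_powr (square_sum f x) (r / 2) \<partial>\<mu>)
      = (\<integral>\<^sup>+ x. (SUP k. enn_powr (?S k x) (r / 2)) \<partial>\<mu>)"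
    unfolding square_sum_eq_SUP using r by (simp add: enn_powr_SUP)
  also have "\<dots> = (SUP k. \<integral>\<^sup>+ x. enn_powr (?S k x) (r / 2) \<partial>\<mu>)"
  proof (rule nn_integral_monotone_convergence_SUP)
    show "incseq (\<lambda>k x. enn_powr (?S k x) (r / 2))"
      using r by (intro incseq_SucI le_funI enn_powr_mono sum_mono2[OF finite_le_multi]) (auto simp: le_fun_def intro: le_SucI)
    show "(\<lambda>x. enn_powr (?S k x) (r / 2)) \<in> borel_measurable \<mu>" for k by measurable
  qed
  also have "\<dots> \<le> ennreal ?C * enn_powr (mart_L_norm r f) r"
  proof (rule SUP_least)
    fix k
    let ?N = "\<lambda>_::'d. k :: nat"
    have "(\<integral>\<^sup>+ x. enn_powr (?S k x) (r / 2) \<partial>\<mu>) = (\<integral>\<^sup>+ x. ennreal ((\<Sum>n | n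
        \<le> ?N. (norm (mdiff f n x))\<^sup>2) powr (r / 2)) \<partial>\<mu>)"
    proof (rule nn_integral_cong)
      fix x :: "real^'d"
      have "?S k x = ennreal (\<Sum>n | n \<le> ?N. (norm (mdiff f n x))\<^sup>2)" by (rule sum_ennreal) simp
      then show "enn_powr (?S k x) (r / 2) = ennreal ((\<Sum>n | n \<le> ?N. (norm (mdiff f n x))\<^sup>2) powr (r / 2))"
        by (simp only: enn_powr_ennreal[OF sum_nonneg] zero_le_power2)
    qed
    also have "\<dots> = ennreal (LINT x|\<mu>. (\<Sum>n | n \<le> ?N. (norm (mdiff f n x))\<^sup>2) powr (r / 2))"
    proof (rule nn_integral_eq_integral)
      have "step ?N (\<lambda>x. \<Sum>n | n \<le> ?N. (norm (mdiff f n x))\<^sup>2)"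
      proof (rule step_sum)
        fix n assume "n \<in> {n. n \<le> ?N}"
        then have "step ?N (mdiff f n)" by (intro step_mono[OF mdiff_step[OF f]]) simp
        then show "step ?N (\<lambda>x. (norm (mdiff f n x))\<^sup>2)" by (rule step_comp[where F = "\<lambda>z. (norm z)\<^sup>2"])
      qed
      then have "step ?N (\<lambda>x. (\<Sum>n | n \<le> ?N. (norm (mdiff f n x))\<^sup>2) powr (r / 2))"
        by (rule step_comp[where F = "\<lambda>z. z powr (r / 2)"])
      then show "integrable \<mu> (\<lambda>x. (\<Sum>n | n \<le> ?N. (norm (mdiff f n x))\<^sup>2) powr (r / 2))"
        by (rule step_integrable)
    qed simp
    also have "\<dots> \<le> ennreal (?C * (LINT x|\<mu>. norm (f ?N x) powr r))"
      by (intro ennreal_leI martingale_square_function[OF r f])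
    also have "\<dots> = ennreal ?C * ennreal (LINT x|\<mu>. norm (f ?N x) powr r)"
      using C0 by (intro ennreal_mult) (auto intro!: Bochner_Integration.integral_nonneg)
    also have "ennreal (LINT x|\<mu>. norm (f ?N x) powr r) = enn_powr (Lp_norm r (f ?N)) r"
      using r by (simp add: Lp_norm_enn_powr Lp_norm_step[OF vmart_step[OF f]])
    also have "ennreal ?C * \<dots> \<le> ennreal ?C * enn_powr (mart_L_norm r f) r"
      unfolding mart_L_norm_def using r by (intro mult_left_mono enn_powr_mono SUP_upper) simp_all
    finally show "(\<integral>\<^sup>+ x. enn_powr (?S k x) (r / 2) \<partial>\<mu>) \<le> ennreal ?C * enn_powr (mart_L_norm r f) r" .
  qed
  finally have "mart_H_norm r f \<le> enn_powr (ennreal ?C * enn_powr (mart_L_norm r f) r) (1 / r)"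
    using r by (simp add: mart_H_norm_eq enn_powr_mono)
  also have "\<dots> \<le> ennreal (?C powr (1 / r)) * enn_powr (enn_powr (mart_L_norm r f) r) (1 / r)"
    using r C0 by (intro enn_powr_cmult) simp_all
  also have "enn_powr (enn_powr (mart_L_norm r f) r) (1 / r) = mart_L_norm r f"
    using r by (intro enn_powr_inverse) simp
  finally show ?thesis .
qed

text \<open>The product of the bounds on the sequences \<open>p d\<close> is a regularity constant.\<close>
lemma regular_filtration:
  assumes "\<forall>d. bdd_above (p d ` {1..})"
  obtains R where "0 < R" "\<And>n. ncells n \<le> R * ncells (pred_index n)"
proof -
  have "\<exists>b. \<forall>k\<ge>1. p d k \<le> b" for d
  proof -
    have "bdd_above (p d ` {1..})" using assms by simp
    then obtain M where "\<forall>x\<in>p d ` {1..}. x \<le> M" unfolding bdd_above_def by blast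
    then show ?thesis by (intro exI[of _ M]) auto
  qed
  then obtain b where b: "\<And>d k. k \<ge> 1 \<Longrightarrow> p d k \<le> b d" by metis
  have "1 \<le> b d" for d using b[of 1 d] p_ge[of 1 d] by simp
  define R where "R = (\<Prod>d\<in>UNIV. real (b d))"
  have "0 < R" unfolding R_def
  proof (rule prod_pos)
    fix d show "0 < real (b d)" using \<open>1 \<le> b d\<close> by simp
  qed
  moreover have "ncells n \<le> R * ncells (pred_index n)" for n
  proof -
    have "real (pprod (p d) (n d)) \<le> real (b d) * real (pprod (p d) (n d - 1))" for d
    proof (cases "n d")
      case 0
      then show ?thesis using \<open>1 \<le> b d\<close> by (simp add: pprod_def)
    next
      case (Suc m)
      have "pprod (p d) (Suc m) = p d (Suc m) * pprod (p d) m" by (rule pprod_Suc) (rule p_ge)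
      also have "\<dots> \<le> b d * pprod (p d) m" by (intro mult_right_mono b) simp_all
      finally have "real (pprod (p d) (Suc m)) \<le> real (b d * pprod (p d) m)" by (rule of_nat_mono)
      then show ?thesis by (simp add: Suc)
    qed
    then show ?thesis unfolding ncells_def R_def pred_index_def prod.distrib[symmetric]
      by (intro prod_mono) simp
  qed
  ultimately show ?thesis using that by blast
qed

end

theorem corollary1:
  fixes p :: "'d::finite \<Rightarrow> nat \<Rightarrow> nat"
    and V :: "'d family \<Rightarrow> real ^ 'd \<Rightarrow> complex"
  assumes dim: "CARD('d) \<ge> 2"
    and p_ge: "\<forall>d. \<forall>n\<ge>1. p d n \<ge> 2"
    and p_bdd: "\<forall>d. bdd_above (p d ` {1..})"
    and lin: "linear_operator p V"
    and bdd: "bounded_operator p V (mart_L_norm 2) 2"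
    and loc: "\<forall>f e. vmartingale p f \<longrightarrow> (\<forall>x\<in>unit_cube. f (\<lambda>d. 0) x = 0) \<longrightarrow>
       (\<forall>n. e n \<in> sets (vfiltration p (pred_index n)) \<and>
          (\<forall>l\<in>L_index p n. \<forall>x\<in>unit_cube.
             mod_mdiff p f n l x = indicator (e n) x * mod_mdiff p f n l x)) \<longrightarrow>
       (AE x in cube_measure. norm (V f x) > 0 \<longrightarrow> x \<in> (\<Union>n\<in>UNIV - {\<lambda>d. 0}. e n))"
  shows "(\<forall>s. 0 < s \<and> s \<le> 1 \<longrightarrow> bounded_operator p V (mart_H_norm s) s) \<and>
         (\<forall>r. 1 < r \<and> r \<le> 2 \<longrightarrow> bounded_operator p V (mart_L_norm r) r)"
proof -
  interpret vilenkin_system p by standard (use p_ge in blast)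
  obtain C where C: "0 \<le> C"
    and L2: "\<And>h. vmartingale p h \<Longrightarrow> mart_L_norm 2 h < \<infinity> \<Longrightarrow> Lp_norm 2 (V h) \<le> ennreal C * mart_L_norm 2 h"
    using bdd unfolding bounded_operator_def by blast
  obtain R where R0: "0 < R" and R: "\<And>n. ncells n \<le> R * ncells (pred_index n)"
    using regular_filtration[OF p_bdd] by blast
  have local: "local_on V" unfolding local_on_def by (rule loc)
  have H: "bounded_operator p V (mart_H_norm s) s" if "0 < s" "s < 2" for s
    by (rule H_to_L[OF lin local L2 C R R0 that])
  have L: "bounded_operator p V (mart_L_norm r) r" if r: "1 < r" "r < 2" for r
  proof -
    obtain B where B: "0 \<le> B"
      and HB: "\<And>f. vmartingale p f \<Longrightarrow> mart_H_norm r f < \<infinity> \<Longrightarrow> Lp_norm r (V f) \<le> ennreal B * mart_H_norm r f"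
      using H[of r] r unfolding bounded_operator_def by auto
    define K where "K = (square_const r ^ CARD('d)) powr (1 / r)"
    have "Lp_norm r (V f) \<le> ennreal (B * K) * mart_L_norm r f"
      if f: "vmartingale p f" and fin: "mart_L_norm r f < \<infinity>" for f
    proof -
      have le: "mart_H_norm r f \<le> ennreal K * mart_L_norm r f" unfolding K_def by (rule H_norm_le_L_norm[OF r f])
      also have "\<dots> < \<infinity>" using fin by (simp add: ennreal_mult_less_top)
      finally have "Lp_norm r (V f) \<le> ennreal B * mart_H_norm r f" by (rule HB[OF f])
      also have "\<dots> \<le> ennreal B * (ennreal K * mart_L_norm r f)" by (rule mult_left_mono[OF le]) simp
      also have "\<dots> = ennreal (B * K) * mart_L_norm r f" using B by (simp add: ennreal_mult K_def mult.assoc)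
      finally show ?thesis .
    qed
    then show ?thesis unfolding bounded_operator_def using B by (intro exI[of _ "B * K"]) (simp add: K_def)
  qed
  show ?thesis
  proof (intro conjI allI impI)
    fix s :: real assume "0 < s \<and> s \<le> 1"
    then show "bounded_operator p V (mart_H_norm s) s" by (intro H) auto
  next
    fix r :: real assume r: "1 < r \<and> r \<le> 2"
    show "bounded_operator p V (mart_L_norm r) r"
    proof (cases "r = 2")
      case True then show ?thesis using bdd by simp
    next
      case False then show ?thesis using r by (intro L) auto
    qed
  qed
qed

end
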